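(* Consider an invertible Bloom lookup table with $m$ cells and $k$ fully random hash functions (distinct locations per key) storing $n$ keys, with each cell additionally holding a hashkeySum field (sum of $G_1(x)$ over keys $x$ mapped to it) and a hashvalueSum field (sum of $G_2(y)$ over values), used as checks so that a cell with count $\pm 1$ is decoded only if the hashes match. Suppose there are $n^{1-\beta}$ invalid keys (keys associated with multiple values, e.g. inserted multiple times with different values, or inserted and deleted with different values). Let $k = \lceil 1/\beta \rceil + 4$. Let $c_k$ denote the 2-core threshold constant, $c_k^{-1} = \sup \{ \alpha : 0 < \alpha < 1; \forall x \in (0,1), 1 - e^{-k\alpha x^{k-1}} < x \}$. Then if $m > (c_k + \epsilon) n$ for some $\epsilon > 0$, the listEntries operation (repeatedly decoding cells with count $\pm1$ whose hash checks pass, outputting the pair and removing it from the structure) succeeds with high probability in listing all key-value pairs of valid keys (keys with a single associated value).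
   Context: In the fault-tolerant invertible Bloom lookup table, each key $x$ has an additional hash $G_1(x)$ taking uniform random values in a large range, and values $y$ have a hash $G_2(y)$; each cell stores count, keySum, valueSum, hashkeySum and hashvalueSum fields, updated on insert/delete at cells $T[h_1(x)],\ldots,T[h_k(x)]$. Cells touched by invalid keys are "poisoned" and cannot be used for decoding. The goal of listEntries in this setting is to return all key-value pairs for valid keys. It is assumed that hash checks never produce false matches.
   Formalization: Each valid key's pair is assumed to be stored with net multiplicity +1 or -1 (insertions minus deletions); a pair inserted twice with the same value never yields a decodable count of ±1, so the claim fails for it. *)

theory Defs
  imports "HOL-Probability.Probability" "HOL-Probability.Product_PMF"
begin

record ('k, 'v, 'g, 'w) cell =
  cell_count :: int
  key_sum :: 'k
  value_sum :: 'v
  hashkey_sum :: 'g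
  hashvalue_sum :: 'w

datatype ('k, 'v) operation = Insert (op_key: 'k) (op_value: 'v) | Delete (op_key: 'k) (op_value: 'v)

definition empty_cell :: "('k::ab_group_add, 'v::ab_group_add, 'g::ab_group_add, 'w::ab_group_add) cell" where
  "empty_cell = \<lparr>cell_count = 0, key_sum = 0, value_sum = 0, hashkey_sum = 0, hashvalue_sum = 0\<rparr>"

fun update_cell ::
  "('k \<Rightarrow> 'g) \<Rightarrow> ('v \<Rightarrow> 'w) \<Rightarrow> ('k, 'v) operation \<Rightarrow>
   ('k::ab_group_add, 'v::ab_group_add, 'g::ab_group_add, 'w::ab_group_add) cell \<Rightarrow> ('k, 'v, 'g, 'w) cell" where
  "update_cell G1 G2 (Insert x y) c =
     \<lparr>cell_count = cell_count c + 1, key_sum = key_sum c + x, value_sum = value_sum c + y,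
      hashkey_sum = hashkey_sum c + G1 x, hashvalue_sum = hashvalue_sum c + G2 y\<rparr>"
| "update_cell G1 G2 (Delete x y) c =
     \<lparr>cell_count = cell_count c - 1, key_sum = key_sum c - x, value_sum = value_sum c - y,
      hashkey_sum = hashkey_sum c - G1 x, hashvalue_sum = hashvalue_sum c - G2 y\<rparr>"

text \<open>A hashing \<open>h\<close> sends a key \<open>x\<close> to the list of its locations \<open>h\<^sub>1(x), \<dots>, h\<^sub>k(x)\<close>. A table with
  \<open>m\<close> cells uses the indices below \<open>m\<close>.\<close>

definition update_table ::
  "('k \<Rightarrow> nat list) \<Rightarrow> ('k \<Rightarrow> 'g) \<Rightarrow> ('v \<Rightarrow> 'w) \<Rightarrow> ('k, 'v) operation \<Rightarrow>
   (nat \<Rightarrow> ('k::ab_group_add, 'v::ab_group_add, 'g::ab_group_add, 'w::ab_group_add) cell) \<Rightarrow>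
   nat \<Rightarrow> ('k, 'v, 'g, 'w) cell" where
  "update_table h G1 G2 a T =
     (\<lambda>i. if i \<in> set (h (op_key a)) then update_cell G1 G2 a (T i) else T i)"

definition iblt ::
  "('k \<Rightarrow> nat list) \<Rightarrow> ('k \<Rightarrow> 'g) \<Rightarrow> ('v \<Rightarrow> 'w) \<Rightarrow> ('k, 'v) operation list \<Rightarrow>
   nat \<Rightarrow> ('k::ab_group_add, 'v::ab_group_add, 'g::ab_group_add, 'w::ab_group_add) cell" where
  "iblt h G1 G2 ops = fold (update_table h G1 G2) ops (\<lambda>_. empty_cell)"

definition net_weight :: "('k, 'v) operation list \<Rightarrow> 'k \<Rightarrow> 'v \<Rightarrow> int" where
  "net_weight ops x y = int (count_list ops (Insert x y)) - int (count_list ops (Delete x y))"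

definition key_values :: "('k, 'v) operation list \<Rightarrow> 'k \<Rightarrow> 'v set" where
  "key_values ops x = {y. net_weight ops x y \<noteq> 0}"

definition stored_keys :: "('k, 'v) operation list \<Rightarrow> 'k set" where
  "stored_keys ops = {x. key_values ops x \<noteq> {}}"

definition invalid_keys :: "('k, 'v) operation list \<Rightarrow> 'k set" where
  "invalid_keys ops = {x. \<exists>y\<in>key_values ops x. \<exists>y'\<in>key_values ops x. y \<noteq> y'}"

definition valid_pairs :: "('k, 'v) operation list \<Rightarrow> ('k \<times> 'v) set" where
  "valid_pairs ops = {(x, y). key_values ops x = {y}}"

definition decodes_pos ::
  "('k \<Rightarrow> 'g) \<Rightarrow> ('v \<Rightarrow> 'w) \<Rightarrow>
   ('k::ab_group_add, 'v::ab_group_add, 'g::ab_group_add, 'w::ab_group_add) cell \<Rightarrow> 'k \<Rightarrow> 'v \<Rightarrow> bool" where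
  "decodes_pos G1 G2 c x y \<longleftrightarrow>
     cell_count c = 1 \<and> key_sum c = x \<and> value_sum c = y \<and>
     hashkey_sum c = G1 x \<and> hashvalue_sum c = G2 y"

definition decodes_neg ::
  "('k \<Rightarrow> 'g) \<Rightarrow> ('v \<Rightarrow> 'w) \<Rightarrow>
   ('k::ab_group_add, 'v::ab_group_add, 'g::ab_group_add, 'w::ab_group_add) cell \<Rightarrow> 'k \<Rightarrow> 'v \<Rightarrow> bool" where
  "decodes_neg G1 G2 c x y \<longleftrightarrow>
     cell_count c = - 1 \<and> - key_sum c = x \<and> - value_sum c = y \<and>
     - hashkey_sum c = G1 x \<and> - hashvalue_sum c = G2 y"

inductive list_step ::
  "nat \<Rightarrow> ('k \<Rightarrow> nat list) \<Rightarrow> ('k \<Rightarrow> 'g) \<Rightarrow> ('v \<Rightarrow> 'w) \<Rightarrow>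
   (nat \<Rightarrow> ('k::ab_group_add, 'v::ab_group_add, 'g::ab_group_add, 'w::ab_group_add) cell) \<times> ('k \<times> 'v) list \<Rightarrow>
   (nat \<Rightarrow> ('k, 'v, 'g, 'w) cell) \<times> ('k \<times> 'v) list \<Rightarrow> bool"
  for m h G1 G2 where
  pos: "i < m \<Longrightarrow> decodes_pos G1 G2 (T i) x y \<Longrightarrow>
    list_step m h G1 G2 (T, out) (update_table h G1 G2 (Delete x y) T, out @ [(x, y)])"
| neg: "i < m \<Longrightarrow> decodes_neg G1 G2 (T i) x y \<Longrightarrow>
    list_step m h G1 G2 (T, out) (update_table h G1 G2 (Insert x y) T, out @ [(x, y)])"

text \<open>Whatever decodable cell is picked in each round, the process stops, and when no decodable cell
  is left the pairs \<open>P\<close> have been output.\<close>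

definition list_entries_succeeds ::
  "nat \<Rightarrow> ('k \<Rightarrow> nat list) \<Rightarrow> ('k \<Rightarrow> 'g) \<Rightarrow> ('v \<Rightarrow> 'w) \<Rightarrow>
   (nat \<Rightarrow> ('k::ab_group_add, 'v::ab_group_add, 'g::ab_group_add, 'w::ab_group_add) cell) \<Rightarrow>
   ('k \<times> 'v) set \<Rightarrow> bool" where
  "list_entries_succeeds m h G1 G2 T P \<longleftrightarrow>
     termip (list_step m h G1 G2) (T, []) \<and>
     (\<forall>T' out. (list_step m h G1 G2)\<^sup>*\<^sup>* (T, []) (T', out) \<and> (\<nexists>s. list_step m h G1 G2 (T', out) s) \<longrightarrow>
        set out = P)"

text \<open>\<open>K\<close> ranges over the possible sets of keys that share a cell and have not been removed yet. If the
  resulting cell passes the checks for \<open>(x, y)\<close>, then this pair, with its sign, is all it contains.\<close>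

definition no_false_matches ::
  "('k::ab_group_add \<Rightarrow> 'g::ab_group_add) \<Rightarrow> ('v::ab_group_add \<Rightarrow> 'w::ab_group_add) \<Rightarrow>
   ('k, 'v) operation list \<Rightarrow> bool" where
  "no_false_matches G1 G2 ops \<longleftrightarrow>
     (\<forall>K x y. let c = fold (update_cell G1 G2) (filter (\<lambda>a. op_key a \<in> K) ops) empty_cell in
        (decodes_pos G1 G2 c x y \<longrightarrow>
           (\<forall>x'\<in>K. \<forall>y'. net_weight ops x' y' = (if (x', y') = (x, y) then 1 else 0))) \<and>
        (decodes_neg G1 G2 c x y \<longrightarrow>
           (\<forall>x'\<in>K. \<forall>y'. net_weight ops x' y' = (if (x', y') = (x, y) then - 1 else 0))))"

definition random_hashing :: "nat \<Rightarrow> nat \<Rightarrow> 'k set \<Rightarrow> ('k \<Rightarrow> nat list) pmf" where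
  "random_hashing k m X =
     Pi_pmf X [] (\<lambda>_. pmf_of_set {l. length l = k \<and> distinct l \<and> set l \<subseteq> {..<m}})"

definition core_threshold :: "nat \<Rightarrow> real" where
  "core_threshold k =
     inverse (Sup {\<alpha>. 0 < \<alpha> \<and> \<alpha> < 1 \<and>
       (\<forall>x\<in>{0<..<1}. 1 - exp (- real k * \<alpha> * x ^ (k - 1)) < x)})"

end

theory Submission
  imports Defs
begin

text \<open>
  Call a set \<open>S\<close> of valid keys stopping if every cell of every key in \<open>S\<close> is also hit by another key of \<open>S\<close>
  or by an invalid key. Decoding lists all valid pairs as soon as no nonempty stopping set exists. Two
  first moment arguments exclude such sets.

  \<^item> A key \<open>e\<close> of a stopping set, unless it lies in a bounded-size set of keys that contains an invalid key
    or covers too few cells (which happens for \<open>o(n)\<close> keys on average), is the root of a tree of edges of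
    depth \<open>t\<close>. In the hypergraph in which every edge is present independently, the Harris
    inequality (for the edges at a cell) and the van den Berg--Kesten inequality (for the cells of an
    edge) bound the probability of such a tree by the iterates of \<open>x \<mapsto> 1 - exp (- k \<alpha> x^(k - 1))\<close>, which tend to
    \<open>0\<close> below the threshold. By Markov's inequality, at most \<open>\<delta> n\<close> keys lie in stopping sets.
  \<^item> The expected number of stopping sets of size \<open>s \<le> \<delta> n\<close> is at most \<open>(y + C s / n)^s\<close> with \<open>y\<close> of order
    \<open>n powr (1 - k \<beta>) + n powr (1 - k)\<close>. The sum over \<open>s \<ge> 1\<close> tends to \<open>0\<close> because \<open>k \<beta> > 1\<close> and \<open>k \<ge> 4\<close>.
\<close>

section \<open>Bernoulli random edge sets\<close>

text \<open>The branches below a key are not independent, since they compete for the same edges.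
  Instead of coupling an exploration with a branching process, the argument fixes one increasing
  event, that disjoint trees hang from all cells of \<open>e\<close>, and bounds it by two
  correlation inequalities that act in opposite directions. Both need a product measure, whereas the
  keys are at most \<open>n\<close> independent draws. The transfer costs a factor 2: the draws are
  dominated by a uniform edge set of size \<open>n\<close>, and this one by a Bernoulli set
  conditioned on having at least \<open>n\<close> edges, which has probability at least 1/2 if the
  mean is (1 + \<eta>) n. The slack \<eta> comes from \<epsilon>. Edges are ordered lists of
  distinct cells, that is, literally the values of a hashing. Invalid keys obstruct the growth of
  trees: the second key demanded at a cell may be invalid, and then nothing forces the tree to go
  on. Hence an invalid key counts as a defect. There are only about n powr (1 - \<beta>) of them, so
  few neighbourhoods contain one; a single valid key covered by their cells is the worst case for
  small stopping sets and is what asks for k \<beta> > 1.\<close>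

definition bern :: "real \<Rightarrow> 'a set \<Rightarrow> ('a set \<Rightarrow> bool) \<Rightarrow> real" where
  "bern p E A = (\<Sum>F\<in>Pow E. if A F then p ^ card F * (1 - p) ^ card (E - F) else 0)"

lemma bern_empty: "bern p {} A = of_bool (A {})"
  by (simp add: bern_def)

text \<open>Conditioning on whether \<open>x\<close> belongs to the random set. As
  \<open>bern\<close> is a finite sum and not a measure, this recursion is what the inductions on
  \<open>E\<close> run on.\<close>

lemma bern_insert:
  assumes "finite E" "x \<notin> E"
  shows "bern p (insert x E) A = (1 - p) * bern p E A + p * bern p E (\<lambda>F. A (insert x F))"
proof -
  let ?w = "\<lambda>F. if A F then p ^ card F * (1 - p) ^ card (insert x E - F) else 0"
  have inj: "inj_on (insert x) (Pow E)"
    using assms by (auto simp: inj_on_def)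
  have "bern p (insert x E) A = sum ?w (Pow E) + sum ?w (insert x ` Pow E)"
    unfolding bern_def Pow_insert using assms by (intro sum.union_disjoint) auto
  also have "sum ?w (Pow E) = (1 - p) * bern p E A"
    unfolding bern_def sum_distrib_left
  proof (rule sum.cong)
    fix F assume F: "F \<in> Pow E"
    have "insert x E - F = insert x (E - F)" using F assms by auto
    then show "?w F = (1 - p) * (if A F then p ^ card F * (1 - p) ^ card (E - F) else 0)"
      using assms by simp
  qed simp
  also have "sum ?w (insert x ` Pow E) = p * bern p E (\<lambda>F. A (insert x F))"
    unfolding bern_def sum_distrib_left sum.reindex[OF inj]
  proof (rule sum.cong)
    fix F assume F: "F \<in> Pow E"
    have "insert x E - insert x F = E - F" "finite F" "x \<notin> F"
      using F assms finite_subset[of F E] by auto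
    then show "(?w \<circ> insert x) F =
        p * (if A (insert x F) then p ^ card F * (1 - p) ^ card (E - F) else 0)"
      by simp
  qed simp
  finally show ?thesis .
qed

lemma bern_mono:
  assumes "0 \<le> p" "p \<le> 1" "\<And>F. F \<subseteq> E \<Longrightarrow> A F \<Longrightarrow> B F"
  shows "bern p E A \<le> bern p E B"
  unfolding bern_def using assms by (intro sum_mono) auto

lemma bern_nonneg: "0 \<le> p \<Longrightarrow> p \<le> 1 \<Longrightarrow> 0 \<le> bern p E A"
  unfolding bern_def by (intro sum_nonneg) auto

lemma bern_True: "finite E \<Longrightarrow> bern p E (\<lambda>_. True) = 1"
  by (induction E rule: finite_induct) (auto simp: bern_empty bern_insert)

lemma bern_le_1: "finite E \<Longrightarrow> 0 \<le> p \<Longrightarrow> p \<le> 1 \<Longrightarrow> bern p E A \<le> 1"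
  using bern_mono[of p E A "\<lambda>_. True"] by (simp add: bern_True)

lemma bern_disj: "bern p E (\<lambda>F. A F \<or> B F) = bern p E A + bern p E B - bern p E (\<lambda>F. A F \<and> B F)"
  unfolding bern_def sum.distrib[symmetric] sum_subtractf[symmetric] by (intro sum.cong) auto

lemma bern_not: "finite E \<Longrightarrow> bern p E (\<lambda>F. \<not> A F) = 1 - bern p E A"
  using bern_disj[of p E A "\<lambda>F. \<not> A F"] by (simp add: bern_True) (simp add: bern_def)

section \<open>Correlation inequalities for increasing events\<close>

definition upward :: "('a set \<Rightarrow> bool) \<Rightarrow> bool" where
  "upward A \<longleftrightarrow> (\<forall>F G. F \<subseteq> G \<longrightarrow> A F \<longrightarrow> A G)"

lemma upwardI: "(\<And>F G. F \<subseteq> G \<Longrightarrow> A F \<Longrightarrow> A G) \<Longrightarrow> upward A"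
  unfolding upward_def by blast

lemma upwardD: "upward A \<Longrightarrow> F \<subseteq> G \<Longrightarrow> A F \<Longrightarrow> A G"
  unfolding upward_def by blast

lemma upward_insertI: "upward A \<Longrightarrow> A F \<Longrightarrow> A (insert x F)"
  by (erule upwardD) auto

lemma upward_comp_insert: "upward A \<Longrightarrow> upward (\<lambda>F. A (insert x F))"
  by (intro upwardI, erule upwardD) auto

lemma bern_Diff_le:
  assumes "finite E" "0 \<le> p" "p \<le> 1" "upward A"
  shows "bern p (E - {x}) A \<le> bern p E A"
proof (cases "x \<in> E")
  case True
  have "bern p E A = bern p (insert x (E - {x})) A"
    using True by (simp add: insert_absorb)
  also have "\<dots> = (1 - p) * bern p (E - {x}) A + p * bern p (E - {x}) (\<lambda>F. A (insert x F))"
    using assms by (intro bern_insert) auto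
  also have "\<dots> \<ge> (1 - p) * bern p (E - {x}) A + p * bern p (E - {x}) A"
    using assms by (intro add_left_mono mult_left_mono bern_mono) (auto dest: upward_insertI)
  finally show ?thesis by (simp add: algebra_simps)
qed simp

text \<open>Induction on the ground set. Conditioning on \<open>x\<close> turns each probability
  into a mixture of two values. Both events lose probability when \<open>x\<close> is present, and
  the mixture of the products exceeds the product of the mixtures by p (1 - p) (a0 - a1) (b0 - b1).
  Complements appear because the application is the event that no edge at a cell starts a
  tree.\<close>

lemma bern_Harris:
  assumes "finite E" "0 \<le> p" "p \<le> 1" "upward A" "upward B"
  shows "bern p E (\<lambda>F. \<not> A F) * bern p E (\<lambda>F. \<not> B F) \<le> bern p E (\<lambda>F. \<not> A F \<and> \<not> B F)"
  using assms(1,4,5)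
proof (induction E arbitrary: A B rule: finite_induct)
  case empty
  then show ?case by (simp add: bern_empty)
next
  case (insert x E)
  define A' B' where "A' = (\<lambda>F. A (insert x F))" and "B' = (\<lambda>F. B (insert x F))"
  have mono': "upward A'" "upward B'"
    unfolding A'_def B'_def using insert.prems by (auto intro: upward_comp_insert)
  define a0 a1 b0 b1 where "a0 = bern p E (\<lambda>F. \<not> A F)" and "a1 = bern p E (\<lambda>F. \<not> A' F)"
    and "b0 = bern p E (\<lambda>F. \<not> B F)" and "b1 = bern p E (\<lambda>F. \<not> B' F)"
  have "a1 \<le> a0" "b1 \<le> b0"
    unfolding a0_def a1_def b0_def b1_def A'_def B'_def
    using assms(2,3) insert.prems by (auto intro!: bern_mono dest: upward_insertI)
  then have "0 \<le> p * (1 - p) * ((a0 - a1) * (b0 - b1))"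
    using assms(2,3) by auto
  then have "((1 - p) * a0 + p * a1) * ((1 - p) * b0 + p * b1) \<le> (1 - p) * (a0 * b0) + p * (a1 * b1)"
    by (simp add: algebra_simps)
  also have "\<dots> \<le> (1 - p) * bern p E (\<lambda>F. \<not> A F \<and> \<not> B F) + p * bern p E (\<lambda>F. \<not> A' F \<and> \<not> B' F)"
    unfolding a0_def a1_def b0_def b1_def using assms(2,3) mono' insert.prems
    by (intro add_mono mult_left_mono insert.IH) auto
  finally show ?case
    using insert.hyps by (simp add: bern_insert a0_def a1_def b0_def b1_def A'_def B'_def)
qed

lemma bern_Harris_family:
  assumes "finite E" "0 \<le> p" "p \<le> 1" "finite J" "\<And>s. s \<in> J \<Longrightarrow> upward (C s)"
  shows "(\<Prod>s\<in>J. 1 - bern p E (C s)) \<le> bern p E (\<lambda>F. \<forall>s\<in>J. \<not> C s F)"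
  using assms(4,5)
proof (induction J rule: finite_induct)
  case empty
  then show ?case by (simp add: bern_True assms)
next
  case (insert s J)
  have m: "upward (\<lambda>F. \<exists>r\<in>J. C r F)"
    using insert.prems by (intro upwardI) (auto dest: upwardD)
  have "(\<Prod>r\<in>insert s J. 1 - bern p E (C r)) \<le> (1 - bern p E (C s)) * bern p E (\<lambda>F. \<not> (\<exists>r\<in>J. C r F))"
    using insert bern_le_1[of E p] assms(1-3) by (auto intro!: mult_left_mono)
  also have "\<dots> = bern p E (\<lambda>F. \<not> C s F) * bern p E (\<lambda>F. \<not> (\<exists>r\<in>J. C r F))"
    using assms(1) by (simp add: bern_not)
  also have "\<dots> \<le> bern p E (\<lambda>F. \<not> C s F \<and> \<not> (\<exists>r\<in>J. C r F))"
    using m insert.prems assms(1-3) by (intro bern_Harris) auto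
  finally show ?case by simp
qed

text \<open>The box product of van den Berg and Kesten. For upward events a witness can be a plain
  set of present elements on which the event already holds.\<close>

definition disj_occ :: "('a set \<Rightarrow> bool) \<Rightarrow> ('a set \<Rightarrow> bool) \<Rightarrow> 'a set \<Rightarrow> bool" where
  "disj_occ A B F \<longleftrightarrow> (\<exists>K L. K \<inter> L = {} \<and> K \<union> L \<subseteq> F \<and> A K \<and> B L)"

lemma upward_disj_occ: "upward (disj_occ A B)"
  unfolding upward_def disj_occ_def by (meson subset_trans)

lemma disj_occ_cong_imp: "disj_occ A B F \<Longrightarrow> (\<And>K. A K \<Longrightarrow> A' K) \<Longrightarrow> (\<And>K. B K \<Longrightarrow> B' K) \<Longrightarrow> disj_occ A' B' F"
  unfolding disj_occ_def by blast

text \<open>At most one of two disjoint witnesses contains \<open>x\<close>. If the second one does,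
  it is credited with \<open>x\<close>; otherwise monotonicity allows \<open>x\<close> to be granted
  to the first, even if neither uses it.\<close>

lemma disj_occ_insert:
  assumes "upward A" "upward B" "x \<notin> F" "disj_occ A B (insert x F)"
  shows "disj_occ (\<lambda>F. A (insert x F)) B F \<or> disj_occ A (\<lambda>F. B (insert x F)) F"
proof -
  obtain K L where KL: "K \<inter> L = {}" "K \<union> L \<subseteq> insert x F" "A K" "B L"
    using assms(4) unfolding disj_occ_def by blast
  show ?thesis
  proof (cases "x \<in> L")
    case True
    then have "K \<inter> (L - {x}) = {}" "K \<union> (L - {x}) \<subseteq> F" "A K" "B (insert x (L - {x}))"
      using KL by (auto simp: insert_absorb)
    then show ?thesis unfolding disj_occ_def by blast
  next
    case False
    have "A (insert x (K - {x}))"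
      using upwardD[OF assms(1), of K "insert x (K - {x})"] KL(3) by auto
    moreover have "(K - {x}) \<inter> L = {}" "(K - {x}) \<union> L \<subseteq> F"
      using KL False by auto
    ultimately show ?thesis using KL(4) unfolding disj_occ_def by blast
  qed
qed

text \<open>When a new element \<open>x\<close> is present, disjoint occurrence splits into two
  events by the owner of \<open>x\<close>. Their intersection contains the disjoint occurrence
  without \<open>x\<close>, so its probability d is subtracted once. It remains to compare (1 - 2 p)
  d + p (a1 b0 + a0 b1) with the product of the mixtures; after d \<le> a0 b0 the gap is p^2 (a1 -
  a0) (b1 - b0).\<close>

lemma bern_BK:
  assumes "finite E" "0 \<le> p" "p \<le> 1 / 2" "upward A" "upward B"
  shows "bern p E (disj_occ A B) \<le> bern p E A * bern p E B"
  using assms(1,4,5)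
proof (induction E arbitrary: A B rule: finite_induct)
  case empty
  then show ?case by (simp add: bern_empty disj_occ_def)
next
  case (insert x E)
  define A' B' where "A' = (\<lambda>F. A (insert x F))" and "B' = (\<lambda>F. B (insert x F))"
  have mono': "upward A'" "upward B'"
    unfolding A'_def B'_def using insert.prems by (auto intro: upward_comp_insert)
  have p: "0 \<le> p" "p \<le> 1" using assms(2,3) by auto
  have up: "A F \<Longrightarrow> A' F" "B F \<Longrightarrow> B' F" for F
    unfolding A'_def B'_def using insert.prems by (auto intro: upward_insertI)
  define a0 a1 b0 b1 where "a0 = bern p E A" and "a1 = bern p E A'"
    and "b0 = bern p E B" and "b1 = bern p E B'"
  define d where "d = bern p E (disj_occ A B)"
  have le: "a0 \<le> a1" "b0 \<le> b1"
    unfolding a0_def a1_def b0_def b1_def using p up by (auto intro!: bern_mono)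
  have "bern p E (\<lambda>F. disj_occ A B (insert x F)) \<le> bern p E (\<lambda>F. disj_occ A' B F \<or> disj_occ A B' F)"
    using p disj_occ_insert[OF insert.prems] insert.hyps(2)
    unfolding A'_def B'_def by (intro bern_mono) blast+
  also have "\<dots> \<le> bern p E (disj_occ A' B) + bern p E (disj_occ A B') - d"
    unfolding bern_disj d_def using p up
    by (intro diff_left_mono bern_mono) (auto elim: disj_occ_cong_imp)
  also have "\<dots> \<le> a1 * b0 + a0 * b1 - d"
    unfolding a0_def a1_def b0_def b1_def using insert.IH insert.prems mono'
    by (intro diff_right_mono add_mono) auto
  finally have step: "bern p E (\<lambda>F. disj_occ A B (insert x F)) \<le> a1 * b0 + a0 * b1 - d" .
  have "bern p (insert x E) (disj_occ A B) \<le> (1 - p) * d + p * (a1 * b0 + a0 * b1 - d)"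
    using insert.hyps p mult_left_mono[OF step, of p] by (simp add: bern_insert d_def)
  also have "\<dots> = (1 - 2 * p) * d + p * (a1 * b0 + a0 * b1)"
    by (simp add: algebra_simps)
  \<comment> \<open>The bound 1/2 on \<open>p\<close> makes the coefficient of d nonnegative, so
    that the induction hypothesis for d may be inserted.\<close>
  also have "\<dots> \<le> (1 - 2 * p) * (a0 * b0) + p * (a1 * b0 + a0 * b1)"
    unfolding d_def a0_def b0_def using insert.IH[OF insert.prems] assms(3)
    by (intro add_right_mono mult_left_mono) auto
  also have "\<dots> \<le> ((1 - p) * a0 + p * a1) * ((1 - p) * b0 + p * b1)"
  proof -
    have "0 \<le> p * p * ((a1 - a0) * (b1 - b0))" using le by simp
    then show ?thesis by (simp add: algebra_simps)
  qed
  finally show ?case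
    using insert.hyps by (simp add: bern_insert a0_def a1_def b0_def b1_def A'_def B'_def)
qed

primrec all_disj :: "('a set \<Rightarrow> bool) list \<Rightarrow> 'a set \<Rightarrow> bool" where
  "all_disj [] = (\<lambda>F. True)"
| "all_disj (A # As) = disj_occ A (all_disj As)"

lemma upward_all_disj: "upward (all_disj As)"
  by (cases As) (auto simp: upward_disj_occ intro: upwardI)

lemma bern_all_disj:
  assumes "finite E" "0 \<le> p" "p \<le> 1 / 2" "\<And>A. A \<in> set As \<Longrightarrow> upward A \<and> bern p E A \<le> q"
  shows "bern p E (all_disj As) \<le> q ^ length As"
  using assms(4)
proof (induction As)
  case Nil
  then show ?case by (simp add: bern_True assms)
next
  case (Cons A As)
  have "bern p E (disj_occ A (all_disj As)) \<le> bern p E A * bern p E (all_disj As)"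
    using Cons.prems assms(1-3) by (intro bern_BK upward_all_disj) auto
  also have "\<dots> \<le> q * q ^ length As"
    using Cons assms(2,3) order_trans[OF bern_nonneg[of p E A], of q]
    by (intro mult_mono bern_nonneg) auto
  finally show ?case by simp
qed

text \<open>\<open>tree t v F\<close>: from the cell \<open>v\<close> hangs a tree of depth \<open>t\<close> made of distinct edges of \<open>F\<close>.\<close>

primrec tree :: "nat \<Rightarrow> 'c \<Rightarrow> 'c list set \<Rightarrow> bool" where
  "tree 0 = (\<lambda>v F. True)"
| "tree (Suc t) = (\<lambda>v F. \<exists>s\<in>F. v \<in> set s \<and> all_disj (map (tree t) (filter (\<lambda>u. u \<noteq> v) s)) (F - {s}))"

lemma upward_tree: "upward (tree t v)"
proof (cases t)
  case (Suc t')
  show ?thesis unfolding Suc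
  proof (intro upwardI, simp)
    fix F G :: "'a list set"
    assume FG: "F \<subseteq> G"
    assume "\<exists>s\<in>F. v \<in> set s \<and> all_disj (map (tree t') (filter (\<lambda>u. u \<noteq> v) s)) (F - {s})"
    then obtain s where s: "s \<in> F" "v \<in> set s" "all_disj (map (tree t') (filter (\<lambda>u. u \<noteq> v) s)) (F - {s})"
      by blast
    then have "all_disj (map (tree t') (filter (\<lambda>u. u \<noteq> v) s)) (G - {s})"
      using upwardD[OF upward_all_disj, of "F - {s}" "G - {s}"] FG by auto
    then show "\<exists>s\<in>G. v \<in> set s \<and> all_disj (map (tree t') (filter (\<lambda>u. u \<noteq> v) s)) (G - {s})"
      using s FG by blast
  qed
qed (auto intro: upwardI)

text \<open>A branching process: each cell has Binomial(d, p) many edges, and a cell survives one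
  more level if for some edge all of the k - 1 further cells survive.\<close>

primrec tree_bound :: "real \<Rightarrow> nat \<Rightarrow> nat \<Rightarrow> nat \<Rightarrow> real" where
  "tree_bound p k d 0 = 1"
| "tree_bound p k d (Suc t) = 1 - (1 - p * tree_bound p k d t ^ (k - 1)) ^ d"

lemma tree_bound_range: "0 \<le> p \<Longrightarrow> p \<le> 1 \<Longrightarrow> 0 \<le> tree_bound p k d t \<and> tree_bound p k d t \<le> 1"
proof (induction t)
  case (Suc t)
  then have "0 \<le> p * tree_bound p k d t ^ (k - 1)" "p * tree_bound p k d t ^ (k - 1) \<le> 1"
    by (auto intro!: mult_le_one power_le_one)
  then show ?case by (auto intro!: power_le_one)
qed simp

text \<open>The event \<open>A (F - {s})\<close> ignores \<open>s\<close>, hence is independent of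
  its presence. Returning from \<open>E - {s}\<close> to \<open>E\<close> by monotonicity keeps the
  ground set fixed, so that the bound can be iterated along a tree.\<close>

lemma bern_edge:
  assumes "finite E" "0 \<le> p" "p \<le> 1" "upward A"
  shows "bern p E (\<lambda>F. s \<in> F \<and> A (F - {s})) \<le> p * bern p E A"
proof (cases "s \<in> E")
  case True
  have "bern p E (\<lambda>F. s \<in> F \<and> A (F - {s})) = bern p (insert s (E - {s})) (\<lambda>F. s \<in> F \<and> A (F - {s}))"
    using True by (simp add: insert_absorb)
  also have "\<dots> = (1 - p) * bern p (E - {s}) (\<lambda>F. s \<in> F \<and> A (F - {s}))
      + p * bern p (E - {s}) (\<lambda>F. A (insert s F - {s}))"
    using assms by (subst bern_insert) auto
  also have "bern p (E - {s}) (\<lambda>F. s \<in> F \<and> A (F - {s})) = 0"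
    unfolding bern_def by (intro sum.neutral) auto
  also have "bern p (E - {s}) (\<lambda>F. A (insert s F - {s})) \<le> bern p (E - {s}) A"
  proof (intro bern_mono assms)
    fix F assume "F \<subseteq> E - {s}" "A (insert s F - {s})"
    moreover have "insert s F - {s} \<subseteq> F" by auto
    ultimately show "A F" using upwardD[OF assms(4), of "insert s F - {s}" F] by auto
  qed
  also have "bern p (E - {s}) A \<le> bern p E A"
    using assms by (intro bern_Diff_le) auto
  finally show ?thesis using assms by (simp add: mult_left_mono)
next
  case False
  then have "bern p E (\<lambda>F. s \<in> F \<and> A (F - {s})) = 0"
    unfolding bern_def by (intro sum.neutral) auto
  then show ?thesis using assms by (simp add: bern_nonneg)
qed

lemma length_filter_neq_distinct:
  "distinct s \<Longrightarrow> v \<in> set s \<Longrightarrow> length (filter (\<lambda>u. u \<noteq> v) s) = length s - 1"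
proof -
  assume s: "distinct s" "v \<in> set s"
  have "length (filter (\<lambda>u. u \<noteq> v) s) = card (set s - {v})"
    using s distinct_card[of "filter (\<lambda>u. u \<noteq> v) s"] by (simp add: set_diff_eq)
  then show ?thesis using s by (simp add: distinct_card)
qed

text \<open>An edge at \<open>v\<close> succeeds with probability at most p q^(k - 1): one factor
  for the edge, the others for disjoint subtrees at its remaining cells. Subtrees of different edges
  may overlap, but the failures of the edges are positively correlated, so all of the at most d
  edges fail with probability at least (1 - p q^(k - 1))^d.\<close>

lemma bern_tree:
  fixes E :: "'c list set"
  assumes "finite E" "0 \<le> p" "p \<le> 1 / 2" "\<And>s. s \<in> E \<Longrightarrow> distinct s \<and> length s = k"
    and "\<And>v. card {s \<in> E. v \<in> set s} \<le> d"
  shows "bern p E (tree t v) \<le> tree_bound p k d t"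
proof (induction t arbitrary: v)
  case 0
  show ?case using assms by (simp add: bern_True)
next
  case (Suc t)
  define J where "J = {s \<in> E. v \<in> set s}"
  define B where "B s = all_disj (map (tree t) (filter (\<lambda>u. u \<noteq> v) s))" for s :: "'c list"
  define C where "C s F \<longleftrightarrow> s \<in> F \<and> B s (F - {s})" for s F
  define q where "q = tree_bound p k d t"
  have p: "0 \<le> p" "p \<le> 1" using assms(2,3) by auto
  have q: "0 \<le> q" "q \<le> 1" unfolding q_def using tree_bound_range[OF p] by auto
  have finJ: "finite J" unfolding J_def using assms(1) by simp
  have mC: "upward (C s)" for s
  proof (intro upwardI)
    fix F G :: "'c list set" assume "F \<subseteq> G" "C s F"
    then show "C s G"
      unfolding C_def B_def using upwardD[OF upward_all_disj, of "F - {s}" "G - {s}"] by auto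
  qed
  have C_le: "bern p E (C s) \<le> p * q ^ (k - 1)" if "s \<in> J" for s
  proof -
    have "length (filter (\<lambda>u. u \<noteq> v) s) = k - 1"
      using that assms(4)[of s] length_filter_neq_distinct[of s v] by (auto simp: J_def)
    then have "bern p E (B s) \<le> q ^ (k - 1)"
      unfolding B_def
      using bern_all_disj[OF assms(1-3), of "map (tree t) (filter (\<lambda>u. u \<noteq> v) s)" q]
        Suc.IH upward_tree unfolding q_def by fastforce
    moreover have "bern p E (C s) \<le> p * bern p E (B s)"
      unfolding C_def using p assms(1) by (intro bern_edge) (auto simp: B_def upward_all_disj)
    ultimately show ?thesis using p by (meson mult_left_mono order_trans)
  qed
  have r: "0 \<le> 1 - p * q ^ (k - 1)" "1 - p * q ^ (k - 1) \<le> 1"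
    using p q by (auto intro!: mult_le_one power_le_one)
  have "(1 - p * q ^ (k - 1)) ^ d \<le> (1 - p * q ^ (k - 1)) ^ card J"
    using assms(5)[of v] r unfolding J_def by (intro power_decreasing) auto
  also have "\<dots> = (\<Prod>s\<in>J. 1 - p * q ^ (k - 1))" by simp
  also have "\<dots> \<le> (\<Prod>s\<in>J. 1 - bern p E (C s))"
    using C_le r by (intro prod_mono) auto
  also have "\<dots> \<le> bern p E (\<lambda>F. \<forall>s\<in>J. \<not> C s F)"
    using p assms(1) finJ mC by (intro bern_Harris_family) auto
  also have "\<dots> \<le> bern p E (\<lambda>F. \<not> tree (Suc t) v F)"
    using p by (intro bern_mono) (auto simp: J_def C_def B_def)
  also have "\<dots> = 1 - bern p E (tree (Suc t) v)"
    using assms(1) by (rule bern_not)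
  finally show ?case by (simp add: q_def)
qed

section \<open>Independent draws versus Bernoulli edge sets\<close>

definition level :: "'a set \<Rightarrow> ('a set \<Rightarrow> bool) \<Rightarrow> nat \<Rightarrow> nat" where
  "level E A j = card {F. F \<subseteq> E \<and> card F = j \<and> A F}"

lemma finite_level: "finite E \<Longrightarrow> finite {F. F \<subseteq> E \<and> card F = j \<and> A F}"
  by (rule finite_subset[of _ "Pow E"]) auto

lemma card_extensions_le:
  assumes "finite E"
  shows "card (SIGMA F:{F. F \<subseteq> E \<and> card F = j}. {e \<in> E - F. A (insert e F)}) \<le> Suc j * level E A (Suc j)"
    (is "card ?P \<le> _")
proof -
  let ?Q = "SIGMA G:{G. G \<subseteq> E \<and> card G = Suc j \<and> A G}. G"
  have finG: "finite G" if "G \<subseteq> E" for G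
    using that assms finite_subset by blast
  have "card ?P \<le> card ?Q"
  proof (rule card_inj_on_le[where f = "\<lambda>(F, e). (insert e F, e)"])
    show "inj_on (\<lambda>(F, e). (insert e F, e)) ?P"
      by (rule inj_on_inverseI[where g = "\<lambda>(G, e). (G - {e}, e)"]) auto
    show "(\<lambda>(F, e). (insert e F, e)) ` ?P \<subseteq> ?Q"
      using finG by auto
    show "finite ?Q"
      using assms finG by (intro finite_SigmaI finite_level) auto
  qed
  also have "card ?Q = (\<Sum>G\<in>{G. G \<subseteq> E \<and> card G = Suc j \<and> A G}. card G)"
    using assms finG by (intro card_SigmaI finite_level) auto
  also have "\<dots> = Suc j * level E A (Suc j)"
    by (simp add: level_def)
  finally show ?thesis .
qed

text \<open>Double counting of pairs of a set and an added element: every good set of size j extends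
  in \<open>card E - j\<close> ways to a good set, and a good set of size j + 1 is reached from at
  most j + 1 pairs.\<close>

lemma level_step:
  assumes "finite E" "upward A"
  shows "(card E - j) * level E A j \<le> Suc j * level E A (Suc j)"
proof -
  let ?L = "{F. F \<subseteq> E \<and> card F = j \<and> A F}"
  have "(card E - j) * level E A j = (\<Sum>F\<in>?L. card (E - F))"
    using assms finite_subset[OF _ assms(1)] by (simp add: level_def card_Diff_subset)
  also have "\<dots> = card (SIGMA F:?L. E - F)"
    using assms by (intro card_SigmaI[symmetric] finite_level) auto
  also have "\<dots> \<le> card (SIGMA F:{F. F \<subseteq> E \<and> card F = j}. {e \<in> E - F. A (insert e F)})"
    using assms finite_level[of E j "\<lambda>_. True"]
    by (intro card_mono finite_SigmaI) (auto dest: upward_insertI)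
  also have "\<dots> \<le> Suc j * level E A (Suc j)"
    by (rule card_extensions_le[OF assms(1)])
  finally show ?thesis .
qed

text \<open>Pairs \<open>(e, F)\<close> are split by \<open>e \<in> F\<close>: a repeated element
  leaves \<open>F\<close> unchanged and can be chosen in j ways, a fresh one yields a set of size j
  + 1. In \<open>card_draws_le_level\<close> the element \<open>e\<close> is one further
  draw.\<close>

lemma sum_level_insert_le:
  assumes "finite E"
  shows "(\<Sum>e\<in>E. level E (\<lambda>F. A (insert e F)) j) \<le> j * level E A j + Suc j * level E A (Suc j)"
proof -
  let ?L = "\<lambda>P. {F. F \<subseteq> E \<and> card F = j \<and> P F}"
  let ?N = "SIGMA F:{F. F \<subseteq> E \<and> card F = j}. {e \<in> E - F. A (insert e F)}"
  have finF: "finite F" if "F \<subseteq> E" for F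
    using that assms finite_subset by blast
  have "(\<Sum>e\<in>E. level E (\<lambda>F. A (insert e F)) j) = card (SIGMA e:E. ?L (\<lambda>F. A (insert e F)))"
    unfolding level_def using assms by (intro card_SigmaI[symmetric]) (auto intro!: finite_level)
  also have "\<dots> \<le> card ((SIGMA F:?L A. F) \<union> ?N)"
  proof (rule card_inj_on_le[where f = prod.swap])
    show "finite ((SIGMA F:?L A. F) \<union> ?N)"
      using assms finF finite_level[of E j "\<lambda>_. True"]
      by (intro finite_UnI finite_SigmaI finite_level) auto
    show "prod.swap ` (SIGMA e:E. ?L (\<lambda>F. A (insert e F))) \<subseteq> (SIGMA F:?L A. F) \<union> ?N"
      by (auto simp: insert_absorb)
  qed simp
  also have "\<dots> \<le> card (SIGMA F:?L A. F) + card ?N"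
    by (rule card_Un_le)
  also have "card (SIGMA F:?L A. F) = (\<Sum>F\<in>?L A. card F)"
    using assms finF by (intro card_SigmaI finite_level) auto
  also have "\<dots> = j * level E A j"
    by (simp add: level_def)
  finally show ?thesis
    using card_extensions_le[OF assms, of j A] by linarith
qed

lemma Suc_times_choose_Suc: "Suc j * (M choose Suc j) = (M - j) * (M choose j)"
proof (cases M)
  case (Suc M')
  then show ?thesis
    using binomial_absorb_comp[of M j] Suc_times_binomial[of j M'] by simp
qed simp

text \<open>This is \<open>level_step\<close> telescoped. Cross-multiplication avoids division: the
  point is that the proportion of good sets among all sets of size j grows with j.\<close>

lemma level_ratio_mono:
  assumes "finite E" "upward A" "n \<le> j" "j \<le> card E"
  shows "level E A n * (card E choose j) \<le> level E A j * (card E choose n)"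
  using assms(3,4)
proof (induction j rule: dec_induct)
  case (step j)
  let ?M = "card E"
  have "Suc j * (level E A n * (?M choose Suc j)) = (?M - j) * (level E A n * (?M choose j))"
    using arg_cong[OF Suc_times_choose_Suc[of j ?M], of "\<lambda>y. level E A n * y"] by (simp only: mult_ac)
  also have "\<dots> \<le> (?M - j) * (level E A j * (?M choose n))"
    using step by (intro mult_le_mono2) auto
  also have "\<dots> = (?M - j) * level E A j * (?M choose n)" by simp
  also have "\<dots> \<le> Suc j * level E A (Suc j) * (?M choose n)"
    by (intro mult_le_mono1 level_step assms)
  finally show ?case by (metis Suc_mult_le_cancel1 mult.assoc)
qed simp

lemma card_PiE_insert_le:
  assumes "finite E" "finite X" "x \<notin> X"
  shows "card {f \<in> insert x X \<rightarrow>\<^sub>E E. A (f ` insert x X)}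
    \<le> (\<Sum>e\<in>E. card {f \<in> X \<rightarrow>\<^sub>E E. A (insert e (f ` X))})"
proof -
  have fin: "finite (X \<rightarrow>\<^sub>E E)" using assms by (intro finite_PiE) auto
  have "card {f \<in> insert x X \<rightarrow>\<^sub>E E. A (f ` insert x X)}
      \<le> card (SIGMA e:E. {f \<in> X \<rightarrow>\<^sub>E E. A (insert e (f ` X))})"
  proof (rule card_inj_on_le[where f = "\<lambda>f. (f x, restrict f X)"])
    show "inj_on (\<lambda>f. (f x, restrict f X)) {f \<in> insert x X \<rightarrow>\<^sub>E E. A (f ` insert x X)}"
    proof (rule inj_onI, rule ext)
      fix f g z
      assume fg: "f \<in> {f \<in> insert x X \<rightarrow>\<^sub>E E. A (f ` insert x X)}"
        "g \<in> {f \<in> insert x X \<rightarrow>\<^sub>E E. A (f ` insert x X)}"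
        "(f x, restrict f X) = (g x, restrict g X)"
      show "f z = g z"
      proof (cases "z \<in> X")
        case True
        then show ?thesis using fg(3) by (metis Pair_inject restrict_apply')
      next
        case False
        then have "z = x \<or> z \<notin> insert x X" by blast
        then show ?thesis
          using fg PiE_arb[of f "insert x X" "\<lambda>_. E" z] PiE_arb[of g "insert x X" "\<lambda>_. E" z] by fastforce
      qed
    qed
    show "(\<lambda>f. (f x, restrict f X)) ` {f \<in> insert x X \<rightarrow>\<^sub>E E. A (f ` insert x X)}
        \<subseteq> (SIGMA e:E. {f \<in> X \<rightarrow>\<^sub>E E. A (insert e (f ` X))})"
      by auto
    show "finite (SIGMA e:E. {f \<in> X \<rightarrow>\<^sub>E E. A (insert e (f ` X))})"
      using assms fin by (intro finite_SigmaI) auto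
  qed
  also have "\<dots> = (\<Sum>e\<in>E. card {f \<in> X \<rightarrow>\<^sub>E E. A (insert e (f ` X))})"
    using assms fin by (intro card_SigmaI) auto
  finally show ?thesis .
qed

text \<open>The set of values of \<open>card X\<close> independent uniform draws from \<open>E\<close> is stochastically dominated by
  a uniform subset of \<open>E\<close> of size \<open>card X\<close>.\<close>

lemma card_draws_le_level:
  assumes "finite E" "finite X" "card X \<le> card E" "upward A"
  shows "card {f \<in> X \<rightarrow>\<^sub>E E. A (f ` X)} * (card E choose card X) \<le> card E ^ card X * level E A (card X)"
  using assms(2,3,4)
proof (induction X arbitrary: A rule: finite_induct)
  case empty
  have "{F. F \<subseteq> E \<and> card F = 0 \<and> A F} = (if A {} then {{}} else {})"
    using finite_subset[OF _ assms(1)] by auto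
  then show ?case by (auto simp: level_def)
next
  case (insert x X)
  define n M where "n = card X" and "M = card E"
  have nM: "n < M" using insert by (simp add: n_def M_def)
  let ?N = "\<lambda>e. card {f \<in> X \<rightarrow>\<^sub>E E. A (insert e (f ` X))}"
  have 1: "?N e * (M choose n) \<le> M ^ n * level E (\<lambda>F. A (insert e F)) n" for e
    using insert.IH[OF _ upward_comp_insert[OF insert.prems(2)]] nM by (simp add: n_def M_def)
  have "card {f \<in> insert x X \<rightarrow>\<^sub>E E. A (f ` insert x X)} * (M choose n) \<le> (\<Sum>e\<in>E. ?N e * (M choose n))"
    using card_PiE_insert_le[OF assms(1) insert.hyps, of A]
    unfolding sum_distrib_right[symmetric] by (rule mult_le_mono1)
  also have "\<dots> \<le> (\<Sum>e\<in>E. M ^ n * level E (\<lambda>F. A (insert e F)) n)"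
    by (intro sum_mono 1)
  also have "\<dots> \<le> M ^ n * (n * level E A n + Suc n * level E A (Suc n))"
    unfolding sum_distrib_left[symmetric] by (intro mult_le_mono2 sum_level_insert_le assms)
  finally have 2: "card {f \<in> insert x X \<rightarrow>\<^sub>E E. A (f ` insert x X)} * (M choose n)
      \<le> M ^ n * (n * level E A n + Suc n * level E A (Suc n))" .
  let ?c = "card {f \<in> insert x X \<rightarrow>\<^sub>E E. A (f ` insert x X)}"
  have "Suc n * (?c * (M choose Suc n)) = (M - n) * (?c * (M choose n))"
    using arg_cong[OF Suc_times_choose_Suc[of n M], of "\<lambda>y. ?c * y"] by (simp only: mult_ac)
  also have "\<dots> \<le> (M - n) * (M ^ n * (n * level E A n + Suc n * level E A (Suc n)))"
    by (intro mult_le_mono2 2)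
  also have "\<dots> = M ^ n * (n * ((M - n) * level E A n) + (M - n) * (Suc n * level E A (Suc n)))"
    by (simp only: distrib_left mult_ac)
  \<comment> \<open>\<open>level_step\<close> moves the contribution of repeated draws from size n
    to size n + 1. Repeated and fresh draws then carry the weights n and M - n of the same
    quantity.\<close>
  also have "\<dots> \<le> M ^ n * (n * (Suc n * level E A (Suc n)) + (M - n) * (Suc n * level E A (Suc n)))"
    using level_step[OF assms(1) insert.prems(2), of n] unfolding M_def
    by (intro mult_le_mono2 add_le_mono1)
  also have "\<dots> = M ^ n * ((n + (M - n)) * (Suc n * level E A (Suc n)))"
    by (simp only: distrib_right)
  also have "n + (M - n) = M"
    using nM by simp
  also have "M ^ n * (M * (Suc n * level E A (Suc n))) = Suc n * (M ^ Suc n * level E A (Suc n))"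
    by (simp only: power_Suc mult_ac)
  finally have "?c * (M choose Suc n) \<le> M ^ Suc n * level E A (Suc n)"
    using Suc_mult_le_cancel1 by blast
  then show ?case using insert.hyps by (simp add: n_def M_def)
qed

section \<open>From sets of fixed size to Bernoulli sets\<close>

lemma bern_eq_sum_level:
  assumes "finite E"
  shows "bern p E A = (\<Sum>j\<le>card E. real (level E A j) * (p ^ j * (1 - p) ^ (card E - j)))"
proof -
  let ?w = "\<lambda>F. if A F then p ^ card F * (1 - p) ^ card (E - F) else 0"
  have "bern p E A = (\<Sum>j\<le>card E. sum ?w {F \<in> Pow E. card F = j})"
    unfolding bern_def using assms by (intro sum.group[symmetric]) (auto intro: card_mono)
  also have "\<dots> = (\<Sum>j\<le>card E. real (level E A j) * (p ^ j * (1 - p) ^ (card E - j)))"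
  proof (rule sum.cong)
    fix j assume "j \<in> {..card E}"
    have "sum ?w {F \<in> Pow E. card F = j} = sum ?w {F. F \<subseteq> E \<and> card F = j \<and> A F}"
      using finite_level[OF assms, of j "\<lambda>_. True"] by (intro sum.mono_neutral_right) auto
    also have "\<dots> = (\<Sum>F\<in>{F. F \<subseteq> E \<and> card F = j \<and> A F}. p ^ j * (1 - p) ^ (card E - j))"
      using finite_subset[OF _ assms] by (intro sum.cong) (auto simp: card_Diff_subset)
    finally show "sum ?w {F \<in> Pow E. card F = j} = real (level E A j) * (p ^ j * (1 - p) ^ (card E - j))"
      by (simp add: level_def)
  qed simp
  finally show ?thesis .
qed

lemma Bernstein_variance:
  "(\<Sum>j\<le>M. (real j - real M * p)\<^sup>2 * Bernstein M j p) = real M * p * (1 - p)"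
proof -
  have "(\<Sum>j\<le>M. (real j - real M * p)\<^sup>2 * Bernstein M j p)
      = (\<Sum>j\<le>M. real j * (real j - 1) * Bernstein M j p) + (1 - 2 * (real M * p)) * (\<Sum>j\<le>M. real j * Bernstein M j p)
        + (real M * p)\<^sup>2 * (\<Sum>j\<le>M. Bernstein M j p)"
    unfolding sum_distrib_left sum.distrib[symmetric]
    by (intro sum.cong) (auto simp: power2_eq_square algebra_simps)
  also have "\<dots> = real M * (real M - 1) * p\<^sup>2 + (1 - 2 * (real M * p)) * (real M * p) + (real M * p)\<^sup>2"
    by simp
  also have "\<dots> = real M * p * (1 - p)"
    by (simp add: power2_eq_square algebra_simps)
  finally show ?thesis .
qed

text \<open>Chebyshev's inequality for the binomial distribution, whose weights are the Bernstein
  polynomials. A value below n misses the mean (1 + \<eta>) n by at least \<eta> n, while the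
  variance is at most the mean.\<close>

lemma Bernstein_upper_tail:
  assumes p: "0 \<le> p" "p \<le> 1" and Mp: "real M * p = (1 + \<eta>) * real n"
    and \<eta>: "\<eta> > 0" "n > 0" "2 * (1 + \<eta>) \<le> \<eta>\<^sup>2 * real n"
  shows "(\<Sum>j=n..M. Bernstein M j p) \<ge> 1 / 2"
proof -
  have nn: "0 \<le> Bernstein M j p" for j
    using p by (rule Bernstein_nonneg)
  let ?L = "{j. j \<le> M \<and> j < n}"
  have "(\<eta> * real n)\<^sup>2 * (\<Sum>j\<in>?L. Bernstein M j p) \<le> (\<Sum>j\<in>?L. (real j - real M * p)\<^sup>2 * Bernstein M j p)"
    unfolding sum_distrib_left
  proof (intro sum_mono mult_right_mono nn)
    fix j assume "j \<in> ?L"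
    then have "real j - real M * p \<le> - (\<eta> * real n)"
      unfolding Mp by (simp add: algebra_simps)
    then have "\<bar>\<eta> * real n\<bar> \<le> \<bar>real j - real M * p\<bar>"
      using \<eta> by auto
    then show "(\<eta> * real n)\<^sup>2 \<le> (real j - real M * p)\<^sup>2"
      by (metis abs_le_square_iff)
  qed
  also have "\<dots> \<le> (\<Sum>j\<le>M. (real j - real M * p)\<^sup>2 * Bernstein M j p)"
    using nn by (intro sum_mono2) auto
  also have "\<dots> \<le> real M * p"
    unfolding Bernstein_variance using p by (simp add: mult_left_le)
  also have "\<dots> \<le> (\<eta> * real n)\<^sup>2 * (1 / 2)"
  proof -
    have "2 * ((1 + \<eta>) * real n) \<le> \<eta>\<^sup>2 * real n * real n"
      using \<eta> by (metis mult.assoc mult_right_mono of_nat_0_le_iff)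
    then show ?thesis unfolding Mp by (simp add: power2_eq_square algebra_simps)
  qed
  finally have "(\<Sum>j\<in>?L. Bernstein M j p) \<le> 1 / 2"
    using \<eta> by (subst (asm) mult_le_cancel_left_pos) auto
  moreover have "(\<Sum>j\<in>?L \<union> {n..M}. Bernstein M j p) = (\<Sum>j\<in>?L. Bernstein M j p) + (\<Sum>j=n..M. Bernstein M j p)"
    by (rule sum.union_disjoint) auto
  moreover have "?L \<union> {n..M} = {..M}" by auto
  ultimately show ?thesis by simp
qed

text \<open>Conditioned on its size j, a Bernoulli set is a uniform set of size j; for j \<ge> n it
  is at least as likely to be good as the set of draws. The factor 2 is the inverse of the lower
  bound 1/2 for the probability of such a size.\<close>

lemma draws_le_bern:
  assumes "finite E" "finite X" "upward A" "card X \<le> n" "n \<le> card E"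
    and p: "0 \<le> p" "p \<le> 1" and Mp: "real (card E) * p = (1 + \<eta>) * real n"
    and \<eta>: "\<eta> > 0" "n > 0" "2 * (1 + \<eta>) \<le> \<eta>\<^sup>2 * real n"
  shows "real (card {f \<in> X \<rightarrow>\<^sub>E E. A (f ` X)}) \<le> real (card E) ^ card X * (2 * bern p E A)"
proof -
  define M x where "M = card E" and "x = card X"
  have xM: "x \<le> M" and nM: "n \<le> M" and xn: "x \<le> n" using assms by (auto simp: M_def x_def)
  have cpos: "real (M choose j) > 0" if "j \<le> M" for j using that by simp
  define r where "r = real (level E A x) / real (M choose x)"
  have r0: "r \<ge> 0" by (simp add: r_def)
  have "card {f \<in> X \<rightarrow>\<^sub>E E. A (f ` X)} * (M choose x) \<le> M ^ x * level E A x"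
    using card_draws_le_level[OF assms(1,2) _ assms(3)] xM unfolding M_def x_def by simp
  then have "real (card {f \<in> X \<rightarrow>\<^sub>E E. A (f ` X)} * (M choose x)) \<le> real (M ^ x * level E A x)"
    by (rule of_nat_mono)
  then have 1: "real (card {f \<in> X \<rightarrow>\<^sub>E E. A (f ` X)}) \<le> real M ^ x * r"
    using cpos[OF xM] by (simp add: r_def field_simps)
  have lev: "r * real (M choose j) \<le> real (level E A j)" if "x \<le> j" "j \<le> M" for j
  proof -
    have "real (level E A x * (M choose j)) \<le> real (level E A j * (M choose x))"
      using level_ratio_mono[OF assms(1,3), of x j] that unfolding M_def by (intro of_nat_mono) auto
    then show ?thesis using cpos[OF xM] by (simp add: r_def field_simps)
  qed
  have "r * (1 / 2) \<le> r * (\<Sum>j=n..M. Bernstein M j p)"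
    using Bernstein_upper_tail[OF p Mp \<eta>] r0 unfolding M_def by (intro mult_left_mono) auto
  also have "\<dots> \<le> (\<Sum>j=n..M. real (level E A j) * (p ^ j * (1 - p) ^ (M - j)))"
    unfolding sum_distrib_left
  proof (rule sum_mono)
    fix j assume j: "j \<in> {n..M}"
    have "r * Bernstein M j p = r * real (M choose j) * (p ^ j * (1 - p) ^ (M - j))"
      by (simp add: Bernstein_def)
    also have "\<dots> \<le> real (level E A j) * (p ^ j * (1 - p) ^ (M - j))"
      using lev[of j] j xn p by (intro mult_right_mono) auto
    finally show "r * Bernstein M j p \<le> real (level E A j) * (p ^ j * (1 - p) ^ (M - j))" .
  qed
  also have "\<dots> \<le> (\<Sum>j\<le>M. real (level E A j) * (p ^ j * (1 - p) ^ (M - j)))"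
    using p by (intro sum_mono2) auto
  also have "\<dots> = bern p E A"
    using bern_eq_sum_level[OF assms(1)] by (simp add: M_def)
  finally have "r \<le> 2 * bern p E A" by simp
  then have "real M ^ x * r \<le> real M ^ x * (2 * bern p E A)"
    by (intro mult_left_mono) auto
  then show ?thesis using 1 by (simp add: M_def x_def)
qed

section \<open>Stopping sets and hypertrees\<close>

definition stopping :: "('k \<Rightarrow> 'c list) \<Rightarrow> 'k set \<Rightarrow> 'k set \<Rightarrow> bool" where
  "stopping h I S \<longleftrightarrow> (\<forall>e\<in>S. \<forall>u\<in>set (h e). \<exists>e'\<in>S \<union> I. e' \<noteq> e \<and> u \<in> set (h e'))"

definition cells :: "('k \<Rightarrow> 'c list) \<Rightarrow> 'k set \<Rightarrow> 'c set" where
  "cells h W = (\<Union>e\<in>W. set (h e))"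

lemma cells_simps [simp]:
  "cells h {} = {}" "cells h (insert e W) = set (h e) \<union> cells h W" "cells h (W \<union> W') = cells h W \<union> cells h W'"
  by (auto simp: cells_def)

lemma finite_cells [intro]: "finite W \<Longrightarrow> finite (cells h W)"
  by (auto simp: cells_def)

text \<open>A connected set of \<open>w\<close> edges of size \<open>k\<close> covers at most \<open>w * (k - 1) + 1\<close> cells, with equality for
  hypertrees. A defect is a set of edges that covers fewer cells, or that is not larger than a hypertree
  and contains an invalid key.\<close>

definition defect :: "nat \<Rightarrow> ('k \<Rightarrow> 'c list) \<Rightarrow> 'k set \<Rightarrow> 'k set \<Rightarrow> bool" where
  "defect k h I W \<longleftrightarrow> card (cells h W) \<le> card W * (k - 1) \<or>
     (W \<inter> I \<noteq> {} \<and> card (cells h W) \<le> card W * (k - 1) + 1)"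

text \<open>The number of edges in a tree of depth t below one cell. It serves as a budget:
  everything grown from the root stays within the size L up to which defects are excluded.\<close>

primrec tree_size :: "nat \<Rightarrow> nat \<Rightarrow> nat" where
  "tree_size k 0 = 0"
| "tree_size k (Suc t) = 1 + (k - 1) * tree_size k t"

text \<open>One hashing seen from a fixed root \<open>e0\<close>. Defects are excluded only among
  sets that contain \<open>e0\<close>, which allows a defect to be charged to its own members in the
  union bound.\<close>

locale defect_free =
  fixes h :: "'k \<Rightarrow> 'c list" and k L :: nat and I S :: "'k set" and e0 :: 'k
  assumes k: "k \<ge> 1"
    and edge: "\<And>e. e \<in> S \<union> I \<Longrightarrow> length (h e) = k \<and> distinct (h e)"
    and stopping: "stopping h I S"
    and no_defect: "\<And>W. e0 \<in> W \<Longrightarrow> W \<subseteq> S \<union> I \<Longrightarrow> finite W \<Longrightarrow> card W \<le> L \<Longrightarrow> \<not> defect k h I W"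
begin

text \<open>Only the extremal cell count is recorded, without any incidence structure; the extension
  step argues with counts alone.\<close>

definition hypertree :: "'k set \<Rightarrow> bool" where
  "hypertree W \<longleftrightarrow> e0 \<in> W \<and> W \<subseteq> S \<and> finite W \<and> card (cells h W) = card W * (k - 1) + 1"

definition free :: "'k set \<Rightarrow> 'c \<Rightarrow> bool" where
  "free W u \<longleftrightarrow> (\<exists>e\<in>W. u \<in> set (h e) \<and> (\<forall>e'\<in>W. u \<in> set (h e') \<longrightarrow> e' = e))"

lemma card_edge: "e \<in> S \<union> I \<Longrightarrow> card (set (h e)) = k"
  using edge[of e] by (simp add: distinct_card)

text \<open>A free cell lies on one edge of \<open>W\<close> only, so the stopping condition
  supplies an edge \<open>e'\<close> outside \<open>W\<close>. It adds at most k - 1 cells. If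
  \<open>e'\<close> were invalid, or met \<open>W\<close> in a second cell, then
  \<open>insert e' W\<close> would be a defect.\<close>

lemma hypertree_extend:
  assumes W: "hypertree W" "free W u" "card W < L"
  obtains e where "e \<in> S - W" "u \<in> set (h e)" "hypertree (insert e W)" "set (h e) \<inter> cells h W = {u}"
proof -
  obtain e where e: "e \<in> W" "u \<in> set (h e)" "\<And>e'. e' \<in> W \<Longrightarrow> u \<in> set (h e') \<Longrightarrow> e' = e"
    using W(2) by (auto simp: free_def)
  obtain e' where e': "e' \<in> S \<union> I" "e' \<noteq> e" "u \<in> set (h e')"
    using stopping e(1,2) W(1) unfolding stopping_def hypertree_def by blast
  have nW: "e' \<notin> W" using e(3)[of e'] e' by blast
  have fin: "finite W" "finite (cells h W)" and W': "e0 \<in> W" "W \<subseteq> S"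
    and cW: "card (cells h W) = card W * (k - 1) + 1"
    using W(1) by (auto simp: hypertree_def)
  have u: "u \<in> set (h e') \<inter> cells h W"
    using e(1,2) e'(3) by (auto simp: cells_def)
  let ?i = "card (set (h e') \<inter> cells h W)"
  have i1: "?i \<ge> 1" using u by (metis One_nat_def Suc_leI card_gt_0_iff empty_iff finite_Int List.finite_set)
  have un: "card (cells h (insert e' W)) + ?i = k + card (cells h W)"
    using card_Un_Int[of "set (h e')" "cells h W"] fin card_edge[OF e'(1)] by simp
  have cW': "card (insert e' W) = Suc (card W)" using nW fin by simp
  have nd: "\<not> defect k h I (insert e' W)"
    using W W' e' fin cW' by (intro no_defect) auto
  have "card (cells h (insert e' W)) \<le> card (insert e' W) * (k - 1) + 1"
    using un i1 cW cW' k by simp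
  with nd have "e' \<notin> I" and gt: "card (cells h (insert e' W)) > card (insert e' W) * (k - 1)"
    by (auto simp: defect_def)
  have "?i = 1" using un i1 cW cW' gt k by simp
  then have "set (h e') \<inter> cells h W = {u}"
    using u by (metis card_1_singletonE singletonD)
  moreover have "hypertree (insert e' W)"
    using \<open>e' \<notin> I\<close> e' W' fin un cW cW' \<open>?i = 1\<close> k by (auto simp: hypertree_def)
  ultimately show ?thesis
    using that[of e'] e' nW \<open>e' \<notin> I\<close> by auto
qed

text \<open>The invariant of the growth: \<open>K\<close> carries trees at all cells of
  \<open>us\<close>. That it meets the cells of \<open>W\<close> in \<open>us\<close> only keeps the
  other free cells free and makes trees grown one after another disjoint; that
  \<open>W \<union> K\<close> is again a hypertree lets the growth continue.\<close>

definition branch :: "nat \<Rightarrow> 'k set \<Rightarrow> 'c list \<Rightarrow> 'k set \<Rightarrow> bool" where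
  "branch t W us K \<longleftrightarrow> K \<subseteq> S - W \<and> finite K \<and> card K \<le> length us * tree_size k t \<and> hypertree (W \<union> K) \<and>
     cells h K \<inter> cells h W \<subseteq> set us \<and> all_disj (map (tree t) us) (h ` K)"

lemma free_extend: "free W u \<Longrightarrow> u \<notin> cells h K \<Longrightarrow> free (W \<union> K) u"
  by (auto simp: free_def cells_def)

lemma free_cell: "free W u \<Longrightarrow> u \<in> cells h W"
  by (auto simp: free_def cells_def)

lemma all_disj_single: "upward A \<Longrightarrow> all_disj [A] F \<longleftrightarrow> A F"
  by (auto simp: disj_occ_def dest: upwardD)

text \<open>The trees are grown one cell at a time, and each finished tree is added to
  \<open>W\<close> before the next one starts. The case of a single cell is a hypothesis because it
  is supplied by the induction on the depth in \<open>branch_single\<close>.\<close>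

lemma branches:
  assumes single: "\<And>W u. hypertree W \<Longrightarrow> free W u \<Longrightarrow> card W + tree_size k t \<le> L \<Longrightarrow> \<exists>K. branch t W [u] K"
  shows "hypertree W \<Longrightarrow> distinct us \<Longrightarrow> (\<And>u. u \<in> set us \<Longrightarrow> free W u) \<Longrightarrow>
    card W + length us * tree_size k t \<le> L \<Longrightarrow> \<exists>K. branch t W us K"
proof (induction us arbitrary: W)
  case Nil
  then show ?case by (intro exI[of _ "{}"]) (auto simp: branch_def)
next
  case (Cons u us)
  obtain K where K: "branch t W [u] K"
    using single[of W u] Cons.prems by auto
  have finW: "finite W" using Cons.prems by (auto simp: hypertree_def)
  have Kp: "K \<subseteq> S - W" "finite K" "card K \<le> tree_size k t" "hypertree (W \<union> K)"
    "cells h K \<inter> cells h W \<subseteq> {u}" "tree t u (h ` K)"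
    using K all_disj_single[OF upward_tree, of t u "h ` K"] by (auto simp: branch_def)
  have fr: "free (W \<union> K) v" if "v \<in> set us" for v
  proof -
    have "free W v" "v \<noteq> u" using that Cons.prems by auto
    then show ?thesis using Kp(5) free_cell by (intro free_extend) auto
  qed
  have "card (W \<union> K) = card W + card K"
    using Kp finW by (intro card_Un_disjoint) auto
  then have "card (W \<union> K) + length us * tree_size k t \<le> L"
    using Cons.prems(4) Kp(3) by simp
  then obtain K' where K': "branch t (W \<union> K) us K'"
    using Cons.IH[OF Kp(4) _ fr] Cons.prems(2) by auto
  have K'p: "K' \<subseteq> S - (W \<union> K)" "finite K'" "card K' \<le> length us * tree_size k t" "hypertree (W \<union> K \<union> K')"
    "cells h K' \<inter> cells h (W \<union> K) \<subseteq> set us" "all_disj (map (tree t) us) (h ` K')"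
    using K' by (auto simp: branch_def)
  \<comment> \<open>Disjoint sets of keys could still have equal hash lists, so the images need an
    argument. A common cell would lie in \<open>us\<close>, hence in the cells of \<open>W\<close>,
    hence be \<open>u\<close>, which \<open>us\<close> does not contain.\<close>
  have disj: "h ` K \<inter> h ` K' = {}"
  proof (rule ccontr)
    assume "h ` K \<inter> h ` K' \<noteq> {}"
    then obtain a b where ab: "a \<in> K" "b \<in> K'" "h a = h b" by auto
    then have "h a \<noteq> []" using edge[of a] Kp(1) k by auto
    then obtain v where v: "v \<in> set (h a)" by (cases "h a") auto
    then have "v \<in> cells h K" "v \<in> cells h K'" using ab unfolding cells_def by (blast, metis UN_I)
    then have "v \<in> set us" using K'p(5) by auto
    moreover have "set us \<subseteq> cells h W" using Cons.prems(3) free_cell by auto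
    ultimately have "v = u" using Kp(5) \<open>v \<in> cells h K\<close> by auto
    then show False using \<open>v \<in> set us\<close> Cons.prems(2) by auto
  qed
  have "all_disj (map (tree t) (u # us)) (h ` (K \<union> K'))"
    using disj Kp(6) K'p(6) by (auto simp: disj_occ_def image_Un)
  moreover have "cells h (K \<union> K') \<inter> cells h W \<subseteq> set (u # us)"
    using Kp(5) K'p(5) by auto
  moreover have "card (K \<union> K') \<le> length (u # us) * tree_size k t"
    using Kp(3) K'p(3) card_Un_le[of K K'] by simp
  moreover have "hypertree (W \<union> (K \<union> K'))" using K'p(4) by (simp add: Un_assoc)
  moreover have "K \<union> K' \<subseteq> S - W" "finite (K \<union> K')" using Kp K'p by auto
  ultimately show ?case unfolding branch_def by blast
qed

lemma branch_single:
  "hypertree W \<Longrightarrow> free W u \<Longrightarrow> card W + tree_size k t \<le> L \<Longrightarrow> \<exists>K. branch t W [u] K"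
proof (induction t arbitrary: W u)
  case 0
  then show ?case
    by (intro exI[of _ "{}"]) (auto simp: branch_def disj_occ_def)
next
  case (Suc t)
  have finW: "finite W" using Suc.prems by (auto simp: hypertree_def)
  obtain e where e: "e \<in> S - W" "u \<in> set (h e)" "hypertree (insert e W)" "set (h e) \<inter> cells h W = {u}"
    using hypertree_extend[OF Suc.prems(1,2)] Suc.prems(3) by auto
  define us where "us = filter (\<lambda>v. v \<noteq> u) (h e)"
  have us: "distinct us" "length us = k - 1" "set us = set (h e) - {u}"
    using edge[of e] e length_filter_neq_distinct[of "h e" u] by (auto simp: us_def)
  have "free (insert e W) v" if "v \<in> set us" for v
    using that us e(4) by (auto simp: free_def cells_def)
  moreover have "card (insert e W) + length us * tree_size k t \<le> L"
    using Suc.prems(3) us e finW by simp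
  ultimately obtain K where K: "branch t (insert e W) us K"
    using branches[OF Suc.IH, of "insert e W" us] us e(3) by auto
  have Kp: "K \<subseteq> S - insert e W" "finite K" "card K \<le> (k - 1) * tree_size k t" "hypertree (insert e W \<union> K)"
    "cells h K \<inter> cells h (insert e W) \<subseteq> set us" "all_disj (map (tree t) us) (h ` K)"
    using K us by (auto simp: branch_def)
  \<comment> \<open>Every list in the image of \<open>K\<close> avoids \<open>u\<close>, so removing
    \<open>h e\<close>, as the definition of \<open>tree\<close> demands, does not damage the
    subtrees.\<close>
  have "u \<notin> cells h K" using Kp(5) e(2) us by auto
  then have "h e \<notin> h ` K" using e(2) by (force simp: cells_def)
  then have "all_disj (map (tree t) us) (h ` insert e K - {h e})"
    using Kp(6) by simp
  then have "tree (Suc t) u (h ` insert e K)"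
    using e(2) unfolding us_def by auto
  then have "all_disj (map (tree (Suc t)) [u]) (h ` insert e K)"
    using all_disj_single[OF upward_tree, of "Suc t" u "h ` insert e K"] by (simp only: list.map)
  moreover have "cells h (insert e K) \<inter> cells h W \<subseteq> set [u]"
    using Kp(5) e(4) us by auto
  moreover have "card (insert e K) \<le> length [u] * tree_size k (Suc t)"
    using Kp(1-3) by (simp add: card_insert_if)
  moreover have "hypertree (W \<union> insert e K)" using Kp(4) by simp
  moreover have "insert e K \<subseteq> S - W" "finite (insert e K)" using e Kp by auto
  ultimately show ?case unfolding branch_def by blast
qed

lemma stopping_imp_trees:
  assumes "e0 \<in> S" "1 + k * tree_size k t \<le> L"
  shows "all_disj (map (tree t) (h e0)) (h ` (S - {e0}))"
proof -
  have ed: "length (h e0) = k" "distinct (h e0)" using edge[of e0] assms(1) by auto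
  have "hypertree {e0}"
    using assms card_edge[of e0] k by (auto simp: hypertree_def)
  then obtain K where "branch t {e0} (h e0) K"
    using branches[OF branch_single, where t=t and W="{e0}" and us="h e0"] assms ed by (auto simp: free_def)
  then have "K \<subseteq> S - {e0}" "all_disj (map (tree t) (h e0)) (h ` K)"
    by (auto simp: branch_def)
  then show ?thesis
    using upwardD[OF upward_all_disj, of "h ` K" "h ` (S - {e0})"] by blast
qed

end

section \<open>Decoding\<close>

fun signed :: "('k \<Rightarrow> 'v \<Rightarrow> 'a::ab_group_add) \<Rightarrow> ('k, 'v) operation \<Rightarrow> 'a" where
  "signed g (Insert x y) = g x y"
| "signed g (Delete x y) = - g x y"

definition signed_sum :: "('k \<Rightarrow> 'v \<Rightarrow> 'a::ab_group_add) \<Rightarrow> ('k, 'v) operation list \<Rightarrow> 'a" where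
  "signed_sum g l = sum_list (map (signed g) l)"

lemma signed_sum_simps [simp]:
  "signed_sum g [] = 0" "signed_sum g (a # l) = signed g a + signed_sum g l"
  by (auto simp: signed_sum_def)

lemma fold_update_cell:
  "fold (update_cell G1 G2) l c =
    \<lparr>cell_count = cell_count c + signed_sum (\<lambda>_ _. 1) l,
     key_sum = key_sum c + signed_sum (\<lambda>x _. x) l,
     value_sum = value_sum c + signed_sum (\<lambda>_ y. y) l,
     hashkey_sum = hashkey_sum c + signed_sum (\<lambda>x _. G1 x) l,
     hashvalue_sum = hashvalue_sum c + signed_sum (\<lambda>_ y. G2 y) l\<rparr>"
proof (induction l arbitrary: c)
  case (Cons a l)
  show ?case
    unfolding fold_Cons o_apply Cons.IH by (cases a) (simp_all add: algebra_simps)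
qed simp

lemma net_weight_Nil [simp]: "net_weight [] x y = 0"
  by (simp add: net_weight_def)

lemma net_weight_Cons:
  "net_weight (a # l) x y =
    (if a = Insert x y then 1 else if a = Delete x y then - 1 else 0) + net_weight l x y"
  by (simp add: net_weight_def)

lemma count_list_remove1: "count_list (remove1 a l) b = count_list l b - (if a = b then 1 else 0)"
  by (induction l) (auto simp: count_list_0_iff)

lemma net_weight_remove1:
  "a \<in> set l \<Longrightarrow> net_weight l x y = net_weight (a # remove1 a l) x y"
proof -
  assume "a \<in> set l"
  then have "count_list l a \<noteq> 0" by (simp add: count_list_0_iff)
  then show ?thesis by (auto simp: net_weight_def count_list_remove1)
qed

lemma signed_sum_remove1: "a \<in> set l \<Longrightarrow> signed_sum g l = signed g a + signed_sum g (remove1 a l)"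
  unfolding signed_sum_def by (rule sum_list_map_remove1)

text \<open>Operations cancel in inverse pairs. The inverse of the first operation must occur later,
  as its net weight would be nonzero otherwise; removing both leaves all net weights 0 and shortens
  the list by two, hence the induction on the length.\<close>

lemma signed_sum_eq_0:
  assumes "\<And>x y. net_weight l x y = 0"
  shows "signed_sum g l = 0"
  using assms
proof (induction l rule: length_induct)
  case (1 l)
  show ?case
  proof (cases l)
    case (Cons a l')
    define b where "b = (case a of Insert x y \<Rightarrow> Delete x y | Delete x y \<Rightarrow> Insert x y)"
    have b: "b \<in> set l'"
    proof (rule ccontr)
      assume "b \<notin> set l'"
      then have "count_list l' b = 0" by (simp add: count_list_0_iff)
      then show False
        using 1(2)[of "op_key a" "op_value a"] by (cases a) (auto simp: Cons net_weight_def b_def)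
    qed
    have "net_weight (remove1 b l') x y = 0" for x y
      using 1(2)[of x y] net_weight_remove1[OF b, of x y]
      by (cases a) (auto simp: Cons net_weight_Cons b_def split: if_splits)
    moreover have "length (remove1 b l') < length l"
      using b by (simp add: Cons length_remove1)
    ultimately have "signed_sum g (remove1 b l') = 0"
      using 1(1) by blast
    then show ?thesis
      using signed_sum_remove1[OF b, of g] by (cases a) (auto simp: Cons b_def)
  qed simp
qed

text \<open>Prepending the inverse operation makes all net weights vanish, which reduces the claim
  to \<open>signed_sum_eq_0\<close>.\<close>

lemma signed_sum_single:
  assumes "\<And>x' y'. net_weight l x' y' = (if (x', y') = (x, y) then w else 0)"
  shows "w = 1 \<Longrightarrow> signed_sum g l = g x y" "w = - 1 \<Longrightarrow> signed_sum g l = - g x y"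
proof -
  show "signed_sum g l = g x y" if "w = 1"
    using signed_sum_eq_0[of "Delete x y # l" g] assms that by (auto simp: net_weight_Cons)
  show "signed_sum g l = - g x y" if "w = - 1"
    using signed_sum_eq_0[of "Insert x y # l" g] assms that
    by (auto simp: net_weight_Cons add_eq_0_iff)
qed

lemma count_list_filter: "count_list (filter P l) a = (if P a then count_list l a else 0)"
  by (induction l) auto

lemma net_weight_filter_key:
  "net_weight (filter (\<lambda>a. op_key a \<in> K) l) x y = (if x \<in> K then net_weight l x y else 0)"
  by (simp add: net_weight_def count_list_filter)

text \<open>The cells over which \<open>no_false_matches\<close> quantifies; each cell of a table in
  the listing process is shown to be of this form.\<close>

definition content ::
  "('k \<Rightarrow> 'g) \<Rightarrow> ('v \<Rightarrow> 'w) \<Rightarrow> ('k, 'v) operation list \<Rightarrow> 'k set \<Rightarrow>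
   ('k::ab_group_add, 'v::ab_group_add, 'g::ab_group_add, 'w::ab_group_add) cell" where
  "content G1 G2 ops K = fold (update_cell G1 G2) (filter (\<lambda>a. op_key a \<in> K) ops) empty_cell"

lemma content_eq:
  "content G1 G2 ops K = (let l = filter (\<lambda>a. op_key a \<in> K) ops in
    \<lparr>cell_count = signed_sum (\<lambda>_ _. 1) l, key_sum = signed_sum (\<lambda>x _. x) l,
     value_sum = signed_sum (\<lambda>_ y. y) l, hashkey_sum = signed_sum (\<lambda>x _. G1 x) l,
     hashvalue_sum = signed_sum (\<lambda>_ y. G2 y) l\<rparr>)"
  by (simp add: content_def fold_update_cell empty_cell_def Let_def)

lemma iblt_eq_content: "iblt h G1 G2 ops i = content G1 G2 ops {x. i \<in> set (h x)}"
proof -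
  have "fold (update_table h G1 G2) ops T i
      = fold (update_cell G1 G2) (filter (\<lambda>a. op_key a \<in> {x. i \<in> set (h x)}) ops) (T i)" for T
    by (induction ops arbitrary: T) (auto simp: update_table_def)
  then show ?thesis by (simp add: iblt_def content_def)
qed

lemma signed_sum_filter_key:
  assumes "x \<in> K"
  shows "signed_sum g (filter (\<lambda>a. op_key a \<in> K) l)
    = signed_sum g (filter (\<lambda>a. op_key a \<in> {x}) l) + signed_sum g (filter (\<lambda>a. op_key a \<in> K - {x}) l)"
  using assms by (induction l) (auto simp: algebra_simps)

lemma content_remove:
  assumes "x \<in> K" "\<And>y'. net_weight ops x y' = (if y' = y then w else 0)"
  shows "w = 1 \<Longrightarrow> update_cell G1 G2 (Delete x y) (content G1 G2 ops K) = content G1 G2 ops (K - {x})"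
    and "w = - 1 \<Longrightarrow> update_cell G1 G2 (Insert x y) (content G1 G2 ops K) = content G1 G2 ops (K - {x})"
proof -
  let ?l = "filter (\<lambda>a. op_key a \<in> {x}) ops"
  have nw: "net_weight ?l x' y' = (if (x', y') = (x, y) then w else 0)" for x' y'
    unfolding net_weight_filter_key using assms(2) by auto
  show "update_cell G1 G2 (Delete x y) (content G1 G2 ops K) = content G1 G2 ops (K - {x})" if "w = 1"
    unfolding content_eq Let_def
    by (simp only: update_cell.simps cell.simps signed_sum_filter_key[OF assms(1), of _ ops]
        signed_sum_single(1)[OF nw that]) simp
  show "update_cell G1 G2 (Insert x y) (content G1 G2 ops K) = content G1 G2 ops (K - {x})" if "w = - 1"
    unfolding content_eq Let_def
    by (simp only: update_cell.simps cell.simps signed_sum_filter_key[OF assms(1), of _ ops]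
        signed_sum_single(2)[OF nw that]) simp
qed

lemma content_decodes:
  assumes "x \<in> K" "\<And>x' y'. x' \<in> K \<Longrightarrow> net_weight ops x' y' = (if (x', y') = (x, y) then w else 0)"
  shows "w = 1 \<Longrightarrow> decodes_pos G1 G2 (content G1 G2 ops K) x y"
    and "w = - 1 \<Longrightarrow> decodes_neg G1 G2 (content G1 G2 ops K) x y"
proof -
  let ?l = "filter (\<lambda>a. op_key a \<in> K) ops"
  have nw: "net_weight ?l x' y' = (if (x', y') = (x, y) then w else 0)" for x' y'
    unfolding net_weight_filter_key using assms by auto
  show "decodes_pos G1 G2 (content G1 G2 ops K) x y" if "w = 1"
    unfolding content_eq Let_def decodes_pos_def cell.simps signed_sum_single(1)[OF nw that] by simp
  show "decodes_neg G1 G2 (content G1 G2 ops K) x y" if "w = - 1"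
    unfolding content_eq Let_def decodes_neg_def cell.simps signed_sum_single(2)[OF nw that] by simp
qed

lemma content_no_weight:
  assumes "\<And>x y. x \<in> K \<Longrightarrow> net_weight ops x y = 0"
  shows "cell_count (content G1 G2 ops K) = 0"
  unfolding content_eq Let_def cell.simps
  by (rule signed_sum_eq_0) (use assms in \<open>simp add: net_weight_filter_key\<close>)

text \<open>The assumption constrains only keys in \<open>K\<close>. If the decoded key were outside
  \<open>K\<close>, all weights in \<open>K\<close> would be 0 and so would the count, contrary to a
  count of 1 or -1.\<close>

lemma no_false_matches_content:
  assumes "no_false_matches G1 G2 ops"
  shows "decodes_pos G1 G2 (content G1 G2 ops K) x y \<Longrightarrow>
      x \<in> K \<and> (\<forall>y'. net_weight ops x y' = (if y' = y then 1 else 0))"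
    and "decodes_neg G1 G2 (content G1 G2 ops K) x y \<Longrightarrow>
      x \<in> K \<and> (\<forall>y'. net_weight ops x y' = (if y' = y then - 1 else 0))"
proof -
  show "x \<in> K \<and> (\<forall>y'. net_weight ops x y' = (if y' = y then 1 else 0))"
    if d: "decodes_pos G1 G2 (content G1 G2 ops K) x y"
  proof -
    have nw: "\<forall>x'\<in>K. \<forall>y'. net_weight ops x' y' = (if (x', y') = (x, y) then 1 else 0)"
      using assms d unfolding no_false_matches_def Let_def content_def by blast
    have "x \<in> K"
    proof (rule ccontr)
      assume "x \<notin> K"
      then have "cell_count (content G1 G2 ops K) = 0"
        using nw by (intro content_no_weight) auto
      then show False using d by (simp add: decodes_pos_def)
    qed
    then show ?thesis using nw by auto
  qed
  show "x \<in> K \<and> (\<forall>y'. net_weight ops x y' = (if y' = y then - 1 else 0))"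
    if d: "decodes_neg G1 G2 (content G1 G2 ops K) x y"
  proof -
    have nw: "\<forall>x'\<in>K. \<forall>y'. net_weight ops x' y' = (if (x', y') = (x, y) then - 1 else 0)"
      using assms d unfolding no_false_matches_def Let_def content_def by blast
    have "x \<in> K"
    proof (rule ccontr)
      assume "x \<notin> K"
      then have "cell_count (content G1 G2 ops K) = 0"
        using nw by (intro content_no_weight) auto
      then show False using d by (simp add: decodes_neg_def)
    qed
    then show ?thesis using nw by auto
  qed
qed

lemma stored_keys_subset: "stored_keys ops \<subseteq> op_key ` set ops"
proof
  fix x assume "x \<in> stored_keys ops"
  then obtain y where "net_weight ops x y \<noteq> 0" by (auto simp: stored_keys_def key_values_def)
  then have "Insert x y \<in> set ops \<or> Delete x y \<in> set ops"
    by (auto simp: net_weight_def count_list_0_iff)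
  then show "x \<in> op_key ` set ops" by force
qed

lemma finite_stored_keys: "finite (stored_keys ops)"
  by (rule finite_subset[OF stored_keys_subset]) simp

lemma valid_keys_eq: "fst ` valid_pairs ops = stored_keys ops - invalid_keys ops"
proof (intro set_eqI iffI)
  fix x assume "x \<in> stored_keys ops - invalid_keys ops"
  then obtain y where "key_values ops x = {y}"
    by (auto simp: stored_keys_def invalid_keys_def)
  then show "x \<in> fst ` valid_pairs ops" by (force simp: valid_pairs_def)
qed (auto simp: valid_pairs_def stored_keys_def invalid_keys_def)

lemma invalid_keys_subset: "invalid_keys ops \<subseteq> stored_keys ops"
  by (auto simp: stored_keys_def invalid_keys_def)

lemma inj_on_fst_valid_pairs: "inj_on fst (valid_pairs ops)"
  by (auto simp: inj_on_def valid_pairs_def)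

lemma finite_valid_pairs: "finite (valid_pairs ops)"
  by (rule finite_imageD[OF _ inj_on_fst_valid_pairs]) (simp add: valid_keys_eq finite_stored_keys)

section \<open>The listing process and its invariant\<close>

definition residual where
  "residual h G1 G2 ops = (\<lambda>(T, out). set out \<subseteq> valid_pairs ops \<and>
     (\<forall>i. T i = content G1 G2 ops ({x. i \<in> set (h x)} - fst ` set out)))"

text \<open>A decoded key belongs to the keys of the cell that are not yet output, so each round
  contributes a new valid pair. The growing number of pairs later bounds the number of
  rounds.\<close>

lemma residual_step:
  assumes nfm: "no_false_matches G1 G2 ops"
    and "residual h G1 G2 ops (T, out)" "list_step m h G1 G2 (T, out) (T', out')"
  shows "residual h G1 G2 ops (T', out') \<and> card (set out') = Suc (card (set out))"
proof -
  have res: "set out \<subseteq> valid_pairs ops" "\<And>i. T i = content G1 G2 ops ({x. i \<in> set (h x)} - fst ` set out)"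
    using assms(2) by (auto simp: residual_def)
  have main: "residual h G1 G2 ops (update_table h G1 G2 a T, out @ [(x, y)]) \<and>
      card (set (out @ [(x, y)])) = Suc (card (set out))"
    if x: "x \<in> {x. i \<in> set (h x)} - fst ` set out" and w: "w = 1 \<or> w = - 1"
      and nw: "\<forall>y'. net_weight ops x y' = (if y' = y then w else 0)"
      and a: "a = (if w = 1 then Delete x y else Insert x y)" for x y i a and w :: int
  proof -
    have "(x, y) \<in> valid_pairs ops" using nw w by (auto simp: valid_pairs_def key_values_def)
    moreover have "(x, y) \<notin> set out" using x by force
    moreover have "update_table h G1 G2 a T j
        = content G1 G2 ops ({x. j \<in> set (h x)} - fst ` set (out @ [(x, y)]))" for j
    proof (cases "j \<in> set (h x)")
      case True
      let ?K = "{x. j \<in> set (h x)} - fst ` set out"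
      have K: "x \<in> ?K" using True x by auto
      have key: "op_key a = x" using a by auto
      have "update_cell G1 G2 a (content G1 G2 ops ?K) = content G1 G2 ops (?K - {x})"
        using content_remove[OF K, where ops = ops and y = y and w = w] nw w a by auto
      moreover have "?K - {x} = {x. j \<in> set (h x)} - fst ` set (out @ [(x, y)])" by auto
      ultimately show ?thesis using True by (simp add: update_table_def key res(2))
    next
      case False
      have key: "op_key a = x" using a by auto
      have "{x. j \<in> set (h x)} - fst ` set out = {x. j \<in> set (h x)} - fst ` set (out @ [(x, y)])"
        using False by auto
      then show ?thesis using False by (simp add: update_table_def key res(2))
    qed
    ultimately show ?thesis using res(1) by (simp add: residual_def)
  qed
  show ?thesis using assms(3)
  proof cases
    case (pos i x y)
    then show ?thesis
      using no_false_matches_content(1)[OF nfm, of "{x. i \<in> set (h x)} - fst ` set out" x y]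
        main[of x i 1 y "Delete x y"] by (auto simp: res(2))
  next
    case (neg i x y)
    then show ?thesis
      using no_false_matches_content(2)[OF nfm, of "{x. i \<in> set (h x)} - fst ` set out" x y]
        main[of x i "- 1" y "Insert x y"] by (auto simp: res(2))
  qed
qed

lemma residual_termip:
  assumes "no_false_matches G1 G2 ops"
  shows "residual h G1 G2 ops s \<Longrightarrow> termip (list_step m h G1 G2) s"
proof (induction "card (valid_pairs ops) - card (set (snd s))" arbitrary: s rule: less_induct)
  case less
  show ?case
  proof (rule accpI)
    fix s' assume "(list_step m h G1 G2)\<inverse>\<inverse> s' s"
    then have st: "list_step m h G1 G2 s s'" by simp
    obtain T out T' out' where s: "s = (T, out)" "s' = (T', out')" by (cases s, cases s') auto
    have r: "residual h G1 G2 ops s'" and c: "card (set out') = Suc (card (set out))"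
      using residual_step[OF assms] less.prems st s by blast+
    have "card (set out') \<le> card (valid_pairs ops)"
      using r s finite_valid_pairs by (intro card_mono) (auto simp: residual_def)
    then show "termip (list_step m h G1 G2) s'"
      using less.hyps[OF _ r] c s by simp
  qed
qed

text \<open>In a stuck state let \<open>S\<close> be the set of valid keys not yet output. If it is
  nonempty, it is not stopping, so some cell contains a key of \<open>S\<close> and no other key of
  \<open>S\<close> or of the invalid keys. This cell decodes, a contradiction.\<close>

lemma list_entries_succeeds_if_no_stopping:
  assumes nfm: "no_false_matches G1 G2 ops"
    and unit: "\<And>x y. (x, y) \<in> valid_pairs ops \<Longrightarrow> \<bar>net_weight ops x y\<bar> = 1"
    and cells: "\<And>x. x \<in> stored_keys ops \<Longrightarrow> set (h x) \<subseteq> {..<m}"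
    and peel: "\<And>S. S \<subseteq> stored_keys ops - invalid_keys ops \<Longrightarrow> S \<noteq> {} \<Longrightarrow> \<not> stopping h (invalid_keys ops) S"
  shows "list_entries_succeeds m h G1 G2 (iblt h G1 G2 ops) (valid_pairs ops)"
proof -
  have init: "residual h G1 G2 ops (iblt h G1 G2 ops, [])"
    by (simp add: residual_def iblt_eq_content)
  have reach: "residual h G1 G2 ops s" if "(list_step m h G1 G2)\<^sup>*\<^sup>* (iblt h G1 G2 ops, []) s" for s
    using that
  proof (induction rule: rtranclp_induct)
    case (step s s')
    then show ?case using residual_step[OF nfm] by (cases s, cases s') blast
  qed (rule init)
  have "set out = valid_pairs ops"
    if r: "residual h G1 G2 ops (T, out)" and stuck: "\<nexists>s. list_step m h G1 G2 (T, out) s" for T out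
  proof (rule ccontr)
    assume ne: "set out \<noteq> valid_pairs ops"
    have out: "set out \<subseteq> valid_pairs ops"
      and T: "\<And>i. T i = content G1 G2 ops ({x. i \<in> set (h x)} - fst ` set out)"
      using r by (auto simp: residual_def)
    define S where "S = fst ` valid_pairs ops - fst ` set out"
    have "S \<noteq> {}"
    proof -
      obtain z where z: "z \<in> valid_pairs ops" "z \<notin> set out" using ne out by blast
      then have "fst z \<notin> fst ` set out"
        using inj_on_image_mem_iff[OF inj_on_fst_valid_pairs z(1) out] by blast
      then show ?thesis using z(1) by (auto simp: S_def)
    qed
    moreover have "S \<subseteq> stored_keys ops - invalid_keys ops" by (auto simp: S_def valid_keys_eq[symmetric])
    ultimately have "\<not> stopping h (invalid_keys ops) S" by (intro peel)
    then obtain x i where x: "x \<in> S" "i \<in> set (h x)"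
      and alone: "\<And>x'. x' \<in> S \<union> invalid_keys ops \<Longrightarrow> x' \<noteq> x \<Longrightarrow> i \<notin> set (h x')"
      unfolding stopping_def by blast
    obtain y where y: "(x, y) \<in> valid_pairs ops" using x(1) by (auto simp: S_def)
    have "x \<in> stored_keys ops" using x(1) by (auto simp: S_def valid_keys_eq)
    then have im: "i < m" using cells x(2) by blast
    let ?K = "{x. i \<in> set (h x)} - fst ` set out"
    have xK: "x \<in> ?K" using x by (auto simp: S_def)
    have nw: "net_weight ops x' y' = (if (x', y') = (x, y) then net_weight ops x y else 0)" if "x' \<in> ?K" for x' y'
    proof (cases "x' = x")
      case True
      then show ?thesis using y by (auto simp: valid_pairs_def key_values_def)
    next
      case False
      then have "x' \<notin> S \<union> invalid_keys ops" using alone that by auto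
      \<comment> \<open>What else may share the cell are keys whose operations cancel completely;
        their weights are 0.\<close>
      then have "x' \<notin> stored_keys ops" using that by (auto simp: S_def valid_keys_eq)
      then show ?thesis using False by (auto simp: stored_keys_def key_values_def)
    qed
    have "net_weight ops x y = 1 \<or> net_weight ops x y = - 1" using unit[OF y] by linarith
    then show False
      using content_decodes[OF xK nw, of G1 G2] list_step.intros[OF im, of G1 G2 T x y h out] stuck
      unfolding T by blast
  qed
  then show ?thesis
    unfolding list_entries_succeeds_def using residual_termip[OF nfm init] reach by blast
qed

section \<open>Random hashing\<close>

definition edges :: "nat \<Rightarrow> nat \<Rightarrow> nat list set" where
  "edges k m = {l. length l = k \<and> distinct l \<and> set l \<subseteq> {..<m}}"

lemma random_hashing_eq: "random_hashing k m X = Pi_pmf X [] (\<lambda>_. pmf_of_set (edges k m))"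
  by (simp add: random_hashing_def edges_def)

lemma finite_edges: "finite (edges k m)"
  unfolding edges_def
  by (rule finite_subset[OF _ finite_lists_length_eq[of "{..<m}" k]]) auto

lemma card_edges: "k \<le> m \<Longrightarrow> card (edges k m) = \<Prod>{m - k + 1..m}"
  unfolding edges_def using card_lists_distinct_length_eq[of "{..<m}" k] by simp

lemma edges_nonempty: "k \<le> m \<Longrightarrow> edges k m \<noteq> {}"
proof -
  assume "k \<le> m"
  then have "[0..<k] \<in> edges k m" by (auto simp: edges_def)
  then show ?thesis by blast
qed

lemma card_edges_ge:
  assumes "2 * k \<le> m"
  shows "(real m / 2) ^ k \<le> real (card (edges k m))"
proof -
  have "(real m / 2) ^ k = (\<Prod>i\<in>{m - k + 1..m}. real m / 2)" using assms by simp
  also have "\<dots> \<le> (\<Prod>i\<in>{m - k + 1..m}. real i)"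
    using assms by (intro prod_mono) (auto simp: field_simps)
  also have "\<dots> = real (card (edges k m))" using assms by (simp add: card_edges)
  finally show ?thesis .
qed

text \<open>An edge through v arises by inserting v at one of k positions into a list of k - 1 other
  cells, and m times the number of those lists is the number of edges. The bound is the average
  degree, which makes the later choice of d sharp.\<close>

lemma card_edges_through:
  assumes "1 \<le> k" "k \<le> m"
  shows "m * card {s \<in> edges k m. v \<in> set s} \<le> k * card (edges k m)"
proof (cases "v < m")
  case True
  define Ls where "Ls = {l. length l = k - 1 \<and> distinct l \<and> set l \<subseteq> {..<m} - {v}}"
  have finL: "finite Ls"
    unfolding Ls_def by (rule finite_subset[OF _ finite_lists_length_eq[of "{..<m} - {v}" "k - 1"]]) auto
  have "{s \<in> edges k m. v \<in> set s} \<subseteq> (\<lambda>(j, l). take j l @ v # drop j l) ` ({..<k} \<times> Ls)"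
  proof
    fix s assume s: "s \<in> {s \<in> edges k m. v \<in> set s}"
    then have "v \<in> set s" by simp
    from split_list[OF this] obtain a b where ab: "s = a @ v # b" by blast
    then have "(length a, a @ b) \<in> {..<k} \<times> Ls"
      using s by (auto simp: edges_def Ls_def)
    moreover have "s = (\<lambda>(j, l). take j l @ v # drop j l) (length a, a @ b)" using ab by simp
    ultimately show "s \<in> (\<lambda>(j, l). take j l @ v # drop j l) ` ({..<k} \<times> Ls)" by blast
  qed
  then have "card {s \<in> edges k m. v \<in> set s} \<le> card ((\<lambda>(j, l). take j l @ v # drop j l) ` ({..<k} \<times> Ls))"
    using finL by (intro card_mono) auto
  also have "\<dots> \<le> card ({..<k} \<times> Ls)"
    using finL by (intro card_image_le) auto
  also have "\<dots> = k * card Ls" by (simp add: card_cartesian_product)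
  finally have "m * card {s \<in> edges k m. v \<in> set s} \<le> m * (k * card Ls)" by simp
  also have "\<dots> = k * (m * card Ls)" by simp
  also have "m * card Ls = card (edges k m)"
  proof -
    have "card ({..<m} - {v}) = m - 1" using True by simp
    then have "card Ls = \<Prod>{m - 1 - (k - 1) + 1..m - 1}"
      unfolding Ls_def using assms card_lists_distinct_length_eq[of "{..<m} - {v}" "k - 1"] by simp
    moreover have "{m - k + 1..m} = insert m {m - 1 - (k - 1) + 1..m - 1}"
      using assms by auto
    moreover have "m \<notin> {m - 1 - (k - 1) + 1..m - 1}" using assms by auto
    ultimately show ?thesis using assms by (simp add: card_edges)
  qed
  finally show ?thesis .
next
  case False
  then have "{s \<in> edges k m. v \<in> set s} = {}" by (auto simp: edges_def)
  then show ?thesis by (simp only: card.empty mult_0_right zero_le)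
qed

lemma set_random_hashing:
  assumes "finite X" "k \<le> m" "h \<in> set_pmf (random_hashing k m X)" "x \<in> X"
  shows "h x \<in> edges k m"
  using assms finite_edges[of k m] edges_nonempty[of k m]
  by (auto simp: random_hashing_eq set_Pi_pmf PiE_dflt_def)

lemma card_edges_restricted:
  assumes "\<And>j. j < k \<Longrightarrow> finite (A j)"
  shows "card {l \<in> edges k m. \<forall>j<k. l ! j \<in> A j} \<le> (\<Prod>j<k. card (A j))"
proof -
  have "card {l \<in> edges k m. \<forall>j<k. l ! j \<in> A j} \<le> card (PiE {..<k} A)"
  proof (rule card_inj_on_le[where f = "\<lambda>l. restrict ((!) l) {..<k}"])
    show "inj_on (\<lambda>l. restrict ((!) l) {..<k}) {l \<in> edges k m. \<forall>j<k. l ! j \<in> A j}"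
    proof (rule inj_onI)
      fix l l' assume l: "l \<in> {l \<in> edges k m. \<forall>j<k. l ! j \<in> A j}" "l' \<in> {l \<in> edges k m. \<forall>j<k. l ! j \<in> A j}"
        and eq: "restrict ((!) l) {..<k} = restrict ((!) l') {..<k}"
      have "l ! j = l' ! j" if "j < k" for j
        using fun_cong[OF eq, of j] that by simp
      then show "l = l'" using l by (intro nth_equalityI) (auto simp: edges_def)
    qed
    show "finite (PiE {..<k} A)" using assms by (intro finite_PiE) auto
  qed (auto split: if_splits)
  also have "\<dots> = (\<Prod>j<k. card (A j))" by (simp add: card_PiE)
  finally show ?thesis .
qed

text \<open>The locations of one key are not independent because they are distinct. A factor 2 per
  location pays for this: there are at least (m / 2)^k edges by
  \<open>card_edges_ge\<close>.\<close>

lemma prob_hash_restricted: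
  assumes "finite X" "W \<subseteq> X" "2 * k \<le> m" "1 \<le> k" "\<And>e j. e \<in> W \<Longrightarrow> j < k \<Longrightarrow> finite (A e j)"
  shows "measure_pmf.prob (random_hashing k m X) {h. \<forall>e\<in>W. \<forall>j<k. h e ! j \<in> A e j}
    \<le> (\<Prod>e\<in>W. \<Prod>j<k. 2 * real (card (A e j)) / real m)"
proof -
  let ?E = "edges k m"
  let ?p = "pmf_of_set ?E"
  define B where "B e = (if e \<in> W then {l. \<forall>j<k. l ! j \<in> A e j} else UNIV)" for e
  have m: "k \<le> m" "m > 0" using assms by auto
  have ne: "?E \<noteq> {}" using edges_nonempty m by blast
  have "{h. \<forall>e\<in>W. \<forall>j<k. h e ! j \<in> A e j} = Pi X B"
    using assms(2) by (auto simp: B_def Pi_def)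
  then have "measure_pmf.prob (random_hashing k m X) {h. \<forall>e\<in>W. \<forall>j<k. h e ! j \<in> A e j}
      = (\<Prod>e\<in>X. measure_pmf.prob ?p (B e))"
    unfolding random_hashing_eq using measure_Pi_pmf_Pi[OF assms(1)] by simp
  also have "\<dots> = (\<Prod>e\<in>W. measure_pmf.prob ?p (B e))"
    using assms(1,2) by (intro prod.mono_neutral_right) (auto simp: B_def)
  also have "\<dots> \<le> (\<Prod>e\<in>W. \<Prod>j<k. 2 * real (card (A e j)) / real m)"
  proof (intro prod_mono conjI)
    fix e assume e: "e \<in> W"
    have "measure_pmf.prob ?p (B e) = real (card {l \<in> ?E. \<forall>j<k. l ! j \<in> A e j}) / real (card ?E)"
      using measure_pmf_of_set[OF ne finite_edges, of "B e"] e by (simp add: B_def Int_def)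
    also have "\<dots> \<le> real (\<Prod>j<k. card (A e j)) / real (card ?E)"
      using card_edges_restricted[of k "A e" m] assms(5)[OF e]
      by (intro divide_right_mono of_nat_mono) auto
    also have "\<dots> \<le> real (\<Prod>j<k. card (A e j)) / (real m / 2) ^ k"
      using card_edges_ge[OF assms(3)] m by (intro divide_left_mono mult_pos_pos) (auto intro: prod_nonneg simp: card_gt_0_iff ne finite_edges)
    also have "\<dots> = (\<Prod>j<k. real (card (A e j)) / (real m / 2))"
      by (simp only: prod_dividef prod_constant card_lessThan of_nat_prod power_divide)
    also have "\<dots> = (\<Prod>j<k. 2 * real (card (A e j)) / real m)"
      by (intro prod.cong) auto
    finally show "measure_pmf.prob ?p (B e) \<le> (\<Prod>j<k. 2 * real (card (A e j)) / real m)" .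
  qed simp
  finally show ?thesis .
qed

lemma prob_bind_le:
  assumes "\<And>y. y \<in> set_pmf p \<Longrightarrow> measure_pmf.prob (q y) A \<le> b"
  shows "measure_pmf.prob (bind_pmf p q) A \<le> b"
proof -
  have b: "b \<ge> 0" using assms set_pmf_not_empty[of p] measure_nonneg by (metis all_not_in_conv order_trans)
  have "emeasure (measure_pmf (bind_pmf p q)) A = (\<integral>\<^sup>+y. emeasure (measure_pmf (q y)) A \<partial>measure_pmf p)"
    by simp
  also have "\<dots> \<le> (\<integral>\<^sup>+y. ennreal b \<partial>measure_pmf p)"
    using assms by (intro nn_integral_mono_AE)
      (auto simp: AE_measure_pmf_iff measure_pmf.emeasure_eq_measure intro: ennreal_leI)
  also have "\<dots> = ennreal b" by simp
  finally show ?thesis using b by (simp add: measure_pmf.emeasure_eq_measure)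
qed

lemma prob_Markov_card:
  assumes "finite V" "c > 0"
  shows "measure_pmf.prob M {h. c \<le> real (card {e \<in> V. Q e h})}
    \<le> (\<Sum>e\<in>V. measure_pmf.prob M {h. Q e h}) / c"
proof -
  let ?B = "{h. c \<le> real (card {e \<in> V. Q e h})}"
  have card_eq: "real (card {e \<in> V. Q e h}) = (\<Sum>e\<in>V. indicator {h. Q e h} h)" for h
    using assms(1) by (simp add: indicator_def sum.If_cases Int_def)
  have int: "integrable (measure_pmf M) (indicator S :: _ \<Rightarrow> real)" for S
    by (rule measure_pmf.integrable_const_bound[of _ 1]) (auto simp: indicator_def)
  have "c * measure_pmf.prob M ?B = measure_pmf.expectation M (\<lambda>h. c * indicator ?B h)"
    by simp
  also have "\<dots> \<le> measure_pmf.expectation M (\<lambda>h. \<Sum>e\<in>V. indicator {h. Q e h} h)"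
    using assms(2) card_eq
    by (intro integral_mono integrable_mult_right Bochner_Integration.integrable_sum int)
      (auto simp: indicator_def intro: sum_nonneg)
  also have "\<dots> = (\<Sum>e\<in>V. measure_pmf.prob M {h. Q e h})"
    using int by (subst Bochner_Integration.integral_sum) auto
  finally show ?thesis using assms(2) by (simp add: field_simps)
qed

text \<open>The hash of \<open>e0\<close> is fixed first; the remaining keys are then independent
  uniform draws, to which \<open>draws_le_bern\<close> applies. The bound \<open>b\<close> must
  therefore hold uniformly in the first edge.\<close>

lemma prob_tree_event:
  fixes \<Phi> :: "nat list \<Rightarrow> nat list set \<Rightarrow> bool"
  assumes "finite X" "e0 \<in> X" "k \<le> m" "card X \<le> n" "n \<le> card (edges k m)"
    and up: "\<And>s. upward (\<Phi> s)" and le: "\<And>s. s \<in> edges k m \<Longrightarrow> bern p (edges k m) (\<Phi> s) \<le> b"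
    and p: "0 \<le> p" "p \<le> 1" "real (card (edges k m)) * p = (1 + \<eta>) * real n"
    and \<eta>: "\<eta> > 0" "n > 0" "2 * (1 + \<eta>) \<le> \<eta>\<^sup>2 * real n"
  shows "measure_pmf.prob (random_hashing k m X) {h. \<Phi> (h e0) (h ` (X - {e0}))} \<le> 2 * b"
proof -
  let ?E = "edges k m"
  define X' where "X' = X - {e0}"
  have X': "finite X'" "e0 \<notin> X'" "X = insert e0 X'" using assms by (auto simp: X'_def)
  have ne: "?E \<noteq> {}" by (rule edges_nonempty) fact
  have "measure_pmf.prob (do {f \<leftarrow> Pi_pmf X' [] (\<lambda>_. pmf_of_set ?E); return_pmf (f(e0 := y))})
      {h. \<Phi> (h e0) (h ` X')} \<le> 2 * b" if "y \<in> set_pmf (pmf_of_set ?E)" for y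
  proof -
    have y: "y \<in> ?E" using that finite_edges ne by simp
    have im: "(f(e0 := y)) ` X' = f ` X'" for f using X'(2) by (auto simp: image_def)
    let ?D = "PiE_dflt X' [] (\<lambda>_. ?E)"
    have "measure_pmf.prob (do {f \<leftarrow> Pi_pmf X' [] (\<lambda>_. pmf_of_set ?E); return_pmf (f(e0 := y))})
        {h. \<Phi> (h e0) (h ` X')} = measure_pmf.prob (Pi_pmf X' [] (\<lambda>_. pmf_of_set ?E)) {f. \<Phi> y (f ` X')}"
      unfolding map_pmf_def[symmetric] measure_map_pmf using im by (simp add: vimage_def)
    also have "\<dots> = measure_pmf.prob (pmf_of_set ?D) {f. \<Phi> y (f ` X')}"
      using X' finite_edges ne by (subst Pi_pmf_of_set) auto
    also have "\<dots> = real (card (?D \<inter> {f. \<Phi> y (f ` X')})) / real (card ?D)"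
      using X' finite_edges ne by (intro measure_pmf_of_set) auto
    also have "card ?D = card ?E ^ card X'"
      using X' finite_edges by (subst card_PiE_dflt) auto
    also have "card (?D \<inter> {f. \<Phi> y (f ` X')}) \<le> card {f \<in> X' \<rightarrow>\<^sub>E ?E. \<Phi> y (f ` X')}"
    proof (rule card_inj_on_le[where f = "\<lambda>f. restrict f X'"])
      show "inj_on (\<lambda>f. restrict f X') (?D \<inter> {f. \<Phi> y (f ` X')})"
        by (force simp: inj_on_def restrict_def fun_eq_iff PiE_dflt_def)
      show "finite {f \<in> X' \<rightarrow>\<^sub>E ?E. \<Phi> y (f ` X')}"
        using X' finite_edges by (intro finite_subset[OF _ finite_PiE[of X' "\<lambda>_. ?E"]]) auto
    qed (auto simp: PiE_dflt_def)
    then have "real (card (?D \<inter> {f. \<Phi> y (f ` X')})) / real (card ?E ^ card X')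
        \<le> real (card {f \<in> X' \<rightarrow>\<^sub>E ?E. \<Phi> y (f ` X')}) / real (card ?E ^ card X')"
      by (intro divide_right_mono of_nat_mono) auto
    also have "\<dots> \<le> real (card ?E) ^ card X' * (2 * bern p ?E (\<Phi> y)) / real (card ?E ^ card X')"
      using X' assms(1,4,5) finite_edges by (intro divide_right_mono draws_le_bern[OF _ _ up _ _ p \<eta>]) auto
    also have "\<dots> = 2 * bern p ?E (\<Phi> y)"
      using ne finite_edges by simp
    finally show ?thesis using le[OF y] by linarith
  qed
  then show ?thesis
    unfolding random_hashing_eq X'(3) Pi_pmf_insert'[OF X'(1,2)]
    using X' by (intro prob_bind_le[of "pmf_of_set _"]) simp
qed

section \<open>Defects\<close>

lemma prob_union_le:
  assumes "finite J" "\<And>h. h \<in> set_pmf M \<Longrightarrow> P h \<Longrightarrow> \<exists>i\<in>J. Q i h"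
  shows "measure_pmf.prob M {h. P h} \<le> (\<Sum>i\<in>J. measure_pmf.prob M {h. Q i h})"
proof -
  have "measure_pmf.prob M {h. P h} \<le> measure_pmf.prob M (\<Union>i\<in>J. {h. Q i h})"
    using assms(2) by (intro measure_pmf.finite_measure_mono_AE) (auto simp: AE_measure_pmf_iff)
  also have "\<dots> \<le> (\<Sum>i\<in>J. measure_pmf.prob M {h. Q i h})"
    using assms(1) by (intro measure_pmf.finite_measure_subadditive_finite) auto
  finally show ?thesis .
qed

lemma prob_disj_le:
  assumes "\<And>h. h \<in> set_pmf M \<Longrightarrow> P h \<Longrightarrow> Q h \<or> R h"
  shows "measure_pmf.prob M {h. P h} \<le> measure_pmf.prob M {h. Q h} + measure_pmf.prob M {h. R h}"
proof -
  have "measure_pmf.prob M {h. P h} \<le> (\<Sum>b\<in>UNIV. measure_pmf.prob M {h. if b then Q h else R h})"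
  proof (rule prob_union_le)
    fix h assume "h \<in> set_pmf M" "P h"
    then show "\<exists>b\<in>UNIV. if b then Q h else R h"
      using assms by (metis UNIV_I)
  qed simp
  then show ?thesis by (simp add: UNIV_bool)
qed

lemma card_k_subsets_le: "finite X \<Longrightarrow> card {W. W \<subseteq> X \<and> card W = w} \<le> card X ^ w"
  by (cases "w \<le> card X") (simp_all add: n_subsets binomial_le_pow binomial_eq_0)

lemma cells_subset_iff:
  "(\<And>e. e \<in> W \<Longrightarrow> length (h e) = k) \<Longrightarrow> cells h W \<subseteq> Q \<longleftrightarrow> (\<forall>e\<in>W. \<forall>j<k. h e ! j \<in> Q)"
  unfolding cells_def by (fastforce simp: subset_iff in_set_conv_nth)

text \<open>Union bound over the q-element sets of cells that contain all cells of
  \<open>W\<close>.\<close>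

lemma prob_few_cells:
  assumes "finite X" "W \<subseteq> X" "2 * k \<le> m" "1 \<le> k" "q \<le> m"
  shows "measure_pmf.prob (random_hashing k m X) {h. card (cells h W) \<le> q}
    \<le> real m ^ q * (2 * real q / real m) ^ (k * card W)"
proof -
  let ?Q = "{Q. Q \<subseteq> {..<m} \<and> card Q = q}"
  let ?M = "random_hashing k m X"
  have finQ: "finite ?Q" by (rule finite_subset[of _ "Pow {..<m}"]) auto
  have "measure_pmf.prob ?M {h. card (cells h W) \<le> q}
      \<le> (\<Sum>Q\<in>?Q. measure_pmf.prob ?M {h. \<forall>e\<in>W. \<forall>j<k. h e ! j \<in> Q})"
  proof (intro prob_union_le finQ)
    fix h assume h: "h \<in> set_pmf ?M" "card (cells h W) \<le> q"
    have ed: "h e \<in> edges k m" if "e \<in> W" for e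
      using set_random_hashing[OF assms(1) _ h(1)] that assms by auto
    then have "cells h W \<subseteq> {..<m}" by (auto simp: cells_def edges_def)
    then obtain Q where "cells h W \<subseteq> Q" "Q \<in> ?Q"
      using exists_subset_between[of "cells h W" q "{..<m}"] h(2) assms(5) by auto
    then show "\<exists>Q\<in>?Q. \<forall>e\<in>W. \<forall>j<k. h e ! j \<in> Q"
      using cells_subset_iff[of W h k Q] ed by (auto simp: edges_def)
  qed
  also have "\<dots> \<le> (\<Sum>Q\<in>?Q. (2 * real q / real m) ^ (k * card W))"
  proof (rule sum_mono)
    fix Q assume Q: "Q \<in> ?Q"
    have "measure_pmf.prob ?M {h. \<forall>e\<in>W. \<forall>j<k. h e ! j \<in> Q}
        \<le> (\<Prod>e\<in>W. \<Prod>j<k. 2 * real (card Q) / real m)"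
      using assms Q finite_subset[of Q "{..<m}"] by (intro prob_hash_restricted) auto
    also have "\<dots> = (2 * real q / real m) ^ (k * card W)"
      using Q by (simp only: prod_constant card_lessThan power_mult) simp
    finally show "measure_pmf.prob ?M {h. \<forall>e\<in>W. \<forall>j<k. h e ! j \<in> Q} \<le> (2 * real q / real m) ^ (k * card W)" .
  qed
  also have "\<dots> = real (card ?Q) * (2 * real q / real m) ^ (k * card W)" by simp
  also have "\<dots> \<le> real (m ^ q) * (2 * real q / real m) ^ (k * card W)"
    using card_k_subsets_le[of "{..<m}" q] by (intro mult_right_mono of_nat_mono) auto
  finally show ?thesis by simp
qed

text \<open>Of the k (w + 1) locations, those in excess of the allowed cells each cost a factor 1/m:
  w + 1 of them for too few cells, w for a hypertree with an invalid key. This balances the number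
  of candidate sets, at most m^(w + 1) in all and at most \<open>card I * m ^ w\<close> that meet
  \<open>I\<close>, so the expected number of defects is of order 1 + \<open>card I\<close>.\<close>

lemma prob_defect:
  assumes "finite X" "W \<subseteq> X" "2 * k \<le> m" "1 \<le> k" "card W = Suc w" "Suc w * k \<le> m"
  shows "measure_pmf.prob (random_hashing k m X) {h. defect k h I W}
    \<le> (2 * real (Suc w * k)) ^ (k * Suc w) * (1 / real m ^ Suc w + of_bool (W \<inter> I \<noteq> {}) / real m ^ w)"
proof -
  let ?M = "random_hashing k m X"
  let ?c = "(2 * real (Suc w * k)) ^ (k * Suc w)"
  have m: "real m > 0" using assms by auto
  have few: "measure_pmf.prob ?M {h. card (cells h W) \<le> q} \<le> ?c / real m ^ a"
    if q: "q \<le> Suc w * k" "q + a = k * Suc w" for q a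
  proof -
    have "measure_pmf.prob ?M {h. card (cells h W) \<le> q} \<le> real m ^ q * (2 * real q / real m) ^ (k * Suc w)"
      using prob_few_cells[OF assms(1-4), of q] q(1) assms(5,6) by simp
    also have "\<dots> \<le> real m ^ q * (2 * real (Suc w * k) / real m) ^ (k * Suc w)"
      using q(1) by (intro mult_left_mono power_mono divide_right_mono mult_left_mono of_nat_mono) auto
    also have "\<dots> = ?c * (real m ^ q / real m ^ (q + a))"
      using q(2) by (simp add: power_divide)
    also have "\<dots> = ?c / real m ^ a"
      using m by (simp add: power_add)
    finally show ?thesis .
  qed
  have k1: "Suc w * (k - 1) + Suc w = k * Suc w"
    using assms(4) by (cases k) (auto simp: algebra_simps)
  have "measure_pmf.prob ?M {h. defect k h I W}
      \<le> measure_pmf.prob ?M {h. card (cells h W) \<le> Suc w * (k - 1)}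
        + measure_pmf.prob ?M {h. W \<inter> I \<noteq> {} \<and> card (cells h W) \<le> Suc w * (k - 1) + 1}"
    by (rule prob_disj_le) (auto simp: defect_def assms(5))
  also have "measure_pmf.prob ?M {h. card (cells h W) \<le> Suc w * (k - 1)} \<le> ?c / real m ^ Suc w"
    using k1 by (intro few) (auto simp: mult.commute)
  also have "measure_pmf.prob ?M {h. W \<inter> I \<noteq> {} \<and> card (cells h W) \<le> Suc w * (k - 1) + 1}
      \<le> of_bool (W \<inter> I \<noteq> {}) * (?c / real m ^ w)"
  proof (cases "W \<inter> I = {}")
    case False
    have "Suc w * (k - 1) + 1 + w = k * Suc w" using k1 by simp
    then show ?thesis using few[of "Suc w * (k - 1) + 1" w] False by (simp add: mult.commute)
  qed simp
  finally show ?thesis by (simp add: algebra_simps)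
qed

lemma card_subsets_meeting_le:
  assumes "finite X" "I \<subseteq> X"
  shows "card {W. W \<subseteq> X \<and> card W = Suc w \<and> W \<inter> I \<noteq> {}} \<le> card I * card X ^ w"
proof -
  have finI: "finite I" using assms finite_subset by blast
  let ?S = "{W. W \<subseteq> X \<and> card W = w}"
  have finS: "finite ?S" by (rule finite_subset[of _ "Pow X"]) (use assms in auto)
  have "{W. W \<subseteq> X \<and> card W = Suc w \<and> W \<inter> I \<noteq> {}} \<subseteq> (\<lambda>(i, W). insert i W) ` (I \<times> ?S)"
  proof
    fix W assume W: "W \<in> {W. W \<subseteq> X \<and> card W = Suc w \<and> W \<inter> I \<noteq> {}}"
    then obtain i where i: "i \<in> W" "i \<in> I" by auto
    then have "(i, W - {i}) \<in> I \<times> ?S" using W finite_subset[of W X] assms by auto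
    moreover have "W = (\<lambda>(i, W). insert i W) (i, W - {i})" using i by auto
    ultimately show "W \<in> (\<lambda>(i, W). insert i W) ` (I \<times> ?S)" by blast
  qed
  then have "card {W. W \<subseteq> X \<and> card W = Suc w \<and> W \<inter> I \<noteq> {}} \<le> card ((\<lambda>(i, W). insert i W) ` (I \<times> ?S))"
    using finI finS by (intro card_mono) auto
  also have "\<dots> \<le> card (I \<times> ?S)" using finI finS by (intro card_image_le) auto
  also have "\<dots> \<le> card I * card X ^ w"
    using card_k_subsets_le[OF assms(1), of w] by (simp add: card_cartesian_product)
  finally show ?thesis .
qed

definition defect_const :: "nat \<Rightarrow> nat \<Rightarrow> real" where
  "defect_const k L = (\<Sum>w<L. (2 * real (Suc w * k)) ^ (k * Suc w))"

lemma sum_prob_defect: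
  assumes "finite X" "I \<subseteq> X" "2 * k \<le> m" "1 \<le> k" "L * k \<le> m" "card X \<le> m"
  shows "(\<Sum>W\<in>{W. W \<subseteq> X \<and> W \<noteq> {} \<and> card W \<le> L}. measure_pmf.prob (random_hashing k m X) {h. defect k h I W})
    \<le> defect_const k L * (1 + real (card I))"
proof -
  let ?p = "\<lambda>W. measure_pmf.prob (random_hashing k m X) {h. defect k h I W}"
  let ?S = "\<lambda>w. {W. W \<subseteq> X \<and> card W = Suc w}"
  let ?c = "\<lambda>w. (2 * real (Suc w * k)) ^ (k * Suc w)"
  have m: "real m > 0" using assms by auto
  have finS: "finite (?S w)" for w by (rule finite_subset[of _ "Pow X"]) (use assms in auto)
  have "{W. W \<subseteq> X \<and> W \<noteq> {} \<and> card W \<le> L} = (\<Union>w<L. ?S w)"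
  proof (intro set_eqI iffI)
    fix W assume W: "W \<in> {W. W \<subseteq> X \<and> W \<noteq> {} \<and> card W \<le> L}"
    then have "finite W" using assms(1) finite_subset by blast
    then have "card W = Suc (card W - 1)" using W by (simp add: card_gt_0_iff)
    then show "W \<in> (\<Union>w<L. ?S w)" using W by auto
  qed auto
  then have "(\<Sum>W\<in>{W. W \<subseteq> X \<and> W \<noteq> {} \<and> card W \<le> L}. ?p W) = (\<Sum>w<L. \<Sum>W\<in>?S w. ?p W)"
    using finS by (simp only:) (rule sum.UNION_disjoint, auto)
  also have "\<dots> \<le> (\<Sum>w<L. ?c w * (1 + real (card I)))"
  proof (rule sum_mono)
    fix w assume w: "w \<in> {..<L}"
    have wk: "Suc w * k \<le> m" using w assms(5) by (meson Suc_leI lessThan_iff mult_le_mono1 order_trans)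
    have "(\<Sum>W\<in>?S w. ?p W) \<le> (\<Sum>W\<in>?S w. ?c w * (1 / real m ^ Suc w + of_bool (W \<inter> I \<noteq> {}) / real m ^ w))"
      using assms wk by (intro sum_mono prob_defect) auto
    also have "\<dots> = ?c w * (real (card (?S w)) / real m ^ Suc w
        + real (card {W. W \<subseteq> X \<and> card W = Suc w \<and> W \<inter> I \<noteq> {}}) / real m ^ w)"
    proof -
      have "(\<Sum>W\<in>?S w. of_bool (W \<inter> I \<noteq> {}) / real m ^ w)
          = real (card {W. W \<subseteq> X \<and> card W = Suc w \<and> W \<inter> I \<noteq> {}}) / real m ^ w"
        using finS[of w] by (simp add: sum_divide_distrib[symmetric] sum.If_cases of_bool_def Int_def conj_assoc)
      then show ?thesis
        unfolding sum_distrib_left[symmetric] sum.distrib by simp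
    qed
    also have "\<dots> \<le> ?c w * (1 + real (card I))"
    proof (intro mult_left_mono add_mono)
      have "real (card (?S w)) \<le> real (m ^ Suc w)"
        using card_k_subsets_le[OF assms(1), of "Suc w"] power_mono[OF assms(6), of "Suc w"]
        by (intro of_nat_mono) linarith
      then show "real (card (?S w)) / real m ^ Suc w \<le> 1" using m by simp
      have "card I * card X ^ w \<le> card I * m ^ w"
        using power_mono[OF assms(6), of w] by simp
      then have "real (card {W. W \<subseteq> X \<and> card W = Suc w \<and> W \<inter> I \<noteq> {}}) \<le> real (card I * m ^ w)"
        using card_subsets_meeting_le[OF assms(1,2), of w] by (intro of_nat_mono) linarith
      then show "real (card {W. W \<subseteq> X \<and> card W = Suc w \<and> W \<inter> I \<noteq> {}}) / real m ^ w \<le> real (card I)"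
        using m by (simp add: field_simps)
    qed simp
    finally show "(\<Sum>W\<in>?S w. ?p W) \<le> ?c w * (1 + real (card I))" .
  qed
  also have "\<dots> = defect_const k L * (1 + real (card I))"
    by (simp add: defect_const_def sum_distrib_right)
  finally show ?thesis .
qed

text \<open>A key of a stopping set either lies in a small defect or carries a tree at each of its
  cells. Exchanging the order of summation charges every defect once per member, hence at most L
  times.\<close>

lemma sum_prob_in_stopping:
  assumes X: "finite X" "V \<subseteq> X" "I \<subseteq> X" and k: "1 \<le> k" "2 * k \<le> m"
    and L: "L = 1 + k * tree_size k t" "L * k \<le> m" and m: "card X \<le> m"
    and tree: "\<And>e. e \<in> V \<Longrightarrow> measure_pmf.prob (random_hashing k m X)
        {h. all_disj (map (tree t) (h e)) (h ` (X - {e}))} \<le> b"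
  shows "(\<Sum>e\<in>V. measure_pmf.prob (random_hashing k m X) {h. \<exists>S\<subseteq>V. e \<in> S \<and> stopping h I S})
    \<le> real (card V) * b + real L * (defect_const k L * (1 + real (card I)))"
proof -
  let ?M = "random_hashing k m X"
  let ?W = "{W. W \<subseteq> X \<and> W \<noteq> {} \<and> card W \<le> L}"
  let ?p = "\<lambda>W. measure_pmf.prob ?M {h. defect k h I W}"
  have finW: "finite ?W" by (rule finite_subset[of _ "Pow X"]) (use X in auto)
  have finV: "finite V" using X finite_subset by blast
  have each: "measure_pmf.prob ?M {h. \<exists>S\<subseteq>V. e \<in> S \<and> stopping h I S} \<le> (\<Sum>W\<in>{W\<in>?W. e \<in> W}. ?p W) + b"
    if e: "e \<in> V" for e
  proof -
    have "measure_pmf.prob ?M {h. \<exists>S\<subseteq>V. e \<in> S \<and> stopping h I S}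
        \<le> measure_pmf.prob ?M {h. \<exists>W\<in>{W\<in>?W. e \<in> W}. defect k h I W}
          + measure_pmf.prob ?M {h. all_disj (map (tree t) (h e)) (h ` (X - {e}))}"
    proof (rule prob_disj_le, rule disjCI)
      fix h assume h: "h \<in> set_pmf ?M" "\<exists>S\<subseteq>V. e \<in> S \<and> stopping h I S"
        and nt: "\<not> all_disj (map (tree t) (h e)) (h ` (X - {e}))"
      from h(2) obtain S where S: "S \<subseteq> V" "e \<in> S" "stopping h I S" by blast
      show "\<exists>W\<in>{W\<in>?W. e \<in> W}. defect k h I W"
      proof (rule ccontr)
        assume nd: "\<not> (\<exists>W\<in>{W\<in>?W. e \<in> W}. defect k h I W)"
        interpret defect_free h k L I S e
        proof
          show "length (h e) = k \<and> distinct (h e)" if "e \<in> S \<union> I" for e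
            using set_random_hashing[OF X(1) _ h(1), of e] that S X k by (auto simp: edges_def)
          show "\<not> defect k h I W" if "e \<in> W" "W \<subseteq> S \<union> I" "finite W" "card W \<le> L" for W
            using nd that S X by blast
        qed (use k S in auto)
        have "all_disj (map (tree t) (h e)) (h ` (S - {e}))"
          using stopping_imp_trees[of t] S L by simp
        moreover have "h ` (S - {e}) \<subseteq> h ` (X - {e})" using S X by blast
        ultimately show False using nt upwardD[OF upward_all_disj] by blast
      qed
    qed
    also have "measure_pmf.prob ?M {h. \<exists>W\<in>{W\<in>?W. e \<in> W}. defect k h I W} \<le> (\<Sum>W\<in>{W\<in>?W. e \<in> W}. ?p W)"
    proof (rule prob_union_le)
      show "finite {W\<in>?W. e \<in> W}" using finW by (rule rev_finite_subset) blast
    qed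
    finally show ?thesis using tree[OF e] by linarith
  qed
  have "(\<Sum>e\<in>V. measure_pmf.prob ?M {h. \<exists>S\<subseteq>V. e \<in> S \<and> stopping h I S})
      \<le> (\<Sum>e\<in>V. (\<Sum>W\<in>{W\<in>?W. e \<in> W}. ?p W) + b)"
    by (intro sum_mono each)
  also have "\<dots> = (\<Sum>W\<in>?W. \<Sum>e\<in>{e\<in>V. e \<in> W}. ?p W) + real (card V) * b"
    unfolding sum.distrib using sum.swap_restrict[OF finV finW, of "\<lambda>e. ?p" "\<lambda>e W. e \<in> W"] by simp
  also have "(\<Sum>W\<in>?W. \<Sum>e\<in>{e\<in>V. e \<in> W}. ?p W) \<le> (\<Sum>W\<in>?W. real L * ?p W)"
  proof (rule sum_mono)
    fix W assume W: "W \<in> ?W"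
    then have "card {e\<in>V. e \<in> W} \<le> card W" using X finite_subset[of W X] by (intro card_mono) auto
    then show "(\<Sum>e\<in>{e\<in>V. e \<in> W}. ?p W) \<le> real L * ?p W"
      using W by (auto intro!: mult_right_mono)
  qed
  also have "\<dots> \<le> real L * (defect_const k L * (1 + real (card I)))"
    unfolding sum_distrib_left[symmetric] using sum_prob_defect[OF X(1,3) k(2,1) L(2) m]
    by (intro mult_left_mono) auto
  finally show ?thesis by simp
qed

section \<open>Small stopping sets\<close>

text \<open>The left side divided by the factorial is one term of the series of exp q, and 3 bounds
  exp 1.\<close>

lemma power_self_le_fact: "real q ^ q \<le> 3 ^ q * fact q"
proof -
  have "real q ^ q /\<^sub>R fact q = (\<Sum>n\<in>{q}. real q ^ n /\<^sub>R fact n)" by simp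
  also have "\<dots> \<le> (\<Sum>n. real q ^ n /\<^sub>R fact n)"
    by (intro sum_le_suminf summable_exp_generic) auto
  also have "\<dots> = exp (real q)" by (simp add: exp_def)
  also have "\<dots> = exp 1 ^ q" by (simp add: exp_of_nat_mult[symmetric])
  also have "\<dots> \<le> 3 ^ q" using exp_le by (intro power_mono) auto
  finally show ?thesis by (simp add: field_simps)
qed

lemma choose_times_fact_le: "real (n choose s) * fact s \<le> real n ^ s"
  using binomial_fact_pow[of n s] by (metis of_nat_fact of_nat_le_iff of_nat_mult of_nat_power)

lemma choose_le_power_div:
  assumes "s > 0"
  shows "real (n choose s) \<le> (3 * real n / real s) ^ s"
proof -
  have "real (n choose s) * real s ^ s \<le> real (n choose s) * (3 ^ s * fact s)"
    by (intro mult_left_mono power_self_le_fact) auto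
  also have "\<dots> = 3 ^ s * (real (n choose s) * fact s)" by simp
  also have "\<dots> \<le> 3 ^ s * real n ^ s" by (intro mult_left_mono choose_times_fact_le) auto
  finally show ?thesis using assms by (simp add: power_divide power_mult_distrib field_simps)
qed

text \<open>For even r = 2 q, the bound \<open>power_self_le_fact\<close> turns the product into (12
  q / m)^q, which is at most (6 z)^q. For odd r there is one factor 2 q / m left over, and it is at
  most z \<le> sqrt (6 z).\<close>

lemma choose_cells_le:
  assumes "real r \<le> z * real m" "z \<le> 1" "m > 0"
  shows "real (m choose (r div 2)) * (2 * real (r div 2) / real m) ^ r \<le> sqrt (6 * z) ^ r"
proof -
  define q where "q = r div 2"
  have z: "0 \<le> z" using assms(1,3) by (smt (verit) mult_neg_pos of_nat_0_le_iff of_nat_0_less_iff)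
  have q2: "2 * real q \<le> z * real m"
  proof -
    have "2 * q \<le> r" unfolding q_def by simp
    then have "real (2 * q) \<le> real r" by (rule of_nat_mono)
    then show ?thesis using assms(1) by simp
  qed
  have even: "real (m choose q) * (2 * real q / real m) ^ (2 * q) \<le> sqrt (6 * z) ^ (2 * q)"
  proof -
    have "real (m choose q) * real q ^ q \<le> real (m choose q) * (3 ^ q * fact q)"
      by (intro mult_left_mono power_self_le_fact) auto
    also have "\<dots> = 3 ^ q * (real (m choose q) * fact q)" by simp
    also have "\<dots> \<le> 3 ^ q * real m ^ q" by (intro mult_left_mono choose_times_fact_le) auto
    finally have 1: "real (m choose q) * real q ^ q \<le> (3 * real m) ^ q" by (simp add: power_mult_distrib)
    have "real (m choose q) * (2 * real q / real m) ^ (2 * q)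
        = real (m choose q) * real q ^ q * (4 * real q / (real m * real m)) ^ q"
    proof -
      have "(2 * real q / real m) ^ (2 * q) = ((2 * real q / real m)\<^sup>2) ^ q" by (rule power_mult)
      also have "(2 * real q / real m)\<^sup>2 = real q * (4 * real q / (real m * real m))"
        by (simp add: power2_eq_square)
      finally show ?thesis by (simp only: power_mult_distrib mult.assoc)
    qed
    also have "\<dots> \<le> (3 * real m) ^ q * (4 * real q / (real m * real m)) ^ q"
      using 1 by (intro mult_right_mono) auto
    also have "\<dots> = (12 * real q / real m) ^ q"
      unfolding power_mult_distrib[symmetric] using assms(3) by (simp add: field_simps)
    also have "\<dots> \<le> (6 * z) ^ q"
      using q2 assms(3) by (intro power_mono) (auto simp: field_simps)
    also have "\<dots> = sqrt (6 * z) ^ (2 * q)" using z by (simp add: power_mult)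
    finally show ?thesis .
  qed
  show ?thesis
  proof (cases "even r")
    case True
    then have "r = 2 * q" unfolding q_def by simp
    then show ?thesis using even unfolding q_def[symmetric] by simp
  next
    case False
    then have r: "r = Suc (2 * q)" unfolding q_def by simp
    have "2 * real q / real m \<le> z" using q2 assms(3) by (simp add: field_simps)
    also have "z \<le> sqrt (6 * z)"
    proof (rule real_le_rsqrt)
      have "z * z \<le> 1 * z" using z assms(2) by (intro mult_right_mono)
      then show "z\<^sup>2 \<le> 6 * z" using z by (simp add: power2_eq_square)
    qed
    finally have "2 * real q / real m * (real (m choose q) * (2 * real q / real m) ^ (2 * q))
        \<le> sqrt (6 * z) * sqrt (6 * z) ^ (2 * q)"
      using z by (intro mult_mono even) auto
    then show ?thesis unfolding q_def[symmetric] r by (simp add: mult_ac)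
  qed
qed

text \<open>Every value outside \<open>P\<close> is taken at two positions at least, belonging to
  two different keys. In the application \<open>P\<close> consists of the cells poisoned by invalid
  keys.\<close>

lemma stopping_hits:
  assumes S: "finite S" "\<And>e. e \<in> S \<Longrightarrow> length (g e) = k"
    and stop: "\<forall>e\<in>S. \<forall>u\<in>set (g e). u \<in> P \<or> (\<exists>e'\<in>S. e' \<noteq> e \<and> u \<in> set (g e'))"
  defines "R \<equiv> {(e, j). e \<in> S \<and> j < k \<and> g e ! j \<notin> P}"
  shows "2 * card ((\<lambda>(e, j). g e ! j) ` R) \<le> card R"
proof -
  let ?f = "\<lambda>(e, j). g e ! j"
  have finR: "finite R" by (rule finite_subset[of _ "S \<times> {..<k}"]) (use S in \<open>auto simp: R_def\<close>)
  have "2 \<le> card {x \<in> R. ?f x = u}" if u: "u \<in> ?f ` R" for u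
  proof -
    obtain e j where ej: "e \<in> S" "j < k" "g e ! j = u" "u \<notin> P"
      using u by (auto simp: R_def)
    then have "u \<in> set (g e)" using S(2) by auto
    then obtain e' where e': "e' \<in> S" "e' \<noteq> e" "u \<in> set (g e')" using stop ej by blast
    then obtain j' where j': "j' < k" "g e' ! j' = u" using S(2)[of e'] by (auto simp: in_set_conv_nth)
    have "{(e, j), (e', j')} \<subseteq> {x \<in> R. ?f x = u}" using ej e' j' by (auto simp: R_def)
    then have "card {(e, j), (e', j')} \<le> card {x \<in> R. ?f x = u}" using finR by (intro card_mono) auto
    then show ?thesis using e'(2) by simp
  qed
  then have "(\<Sum>u\<in>?f ` R. 2) \<le> (\<Sum>u\<in>?f ` R. card {x \<in> R. ?f x = u})" by (intro sum_mono)
  also have "\<dots> = card R"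
    using card_eq_sum[of R] sum.image_gen[OF finR, of "\<lambda>_. 1::nat" ?f] by simp
  finally show ?thesis by simp
qed

text \<open>Union bound over the set \<open>R\<close> of positions hashed outside \<open>P\<close>
  and over a set \<open>Q\<close> of \<open>card R div 2\<close> cells that contains their values.
  Each position in \<open>R\<close> then costs sqrt (6 z) and each other position costs x.\<close>

lemma prob_stopping_set:
  assumes V: "finite V" "S \<subseteq> V" and k: "1 \<le> k" "2 * k \<le> m"
    and P: "finite P" and s: "k * card S \<le> m"
  shows "measure_pmf.prob (random_hashing k m V)
      {g. \<forall>e\<in>S. \<forall>u\<in>set (g e). u \<in> P \<or> (\<exists>e'\<in>S. e' \<noteq> e \<and> u \<in> set (g e'))}
    \<le> (2 * real (card P) / real m + sqrt (6 * (real (k * card S) / real m))) ^ (k * card S)"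
proof -
  let ?M = "random_hashing k m V"
  define D where "D = S \<times> {..<k}"
  define z where "z = real (k * card S) / real m"
  define x where "x = 2 * real (card P) / real m"
  have m: "m > 0" using k by auto
  have z: "z \<le> 1" using s m unfolding z_def by (subst divide_le_eq_1_pos) (auto simp del: of_nat_mult)
  have finS: "finite S" using V finite_subset by blast
  have finD: "finite D" using finS by (simp add: D_def)
  have cardD: "card D = k * card S" by (simp add: D_def card_cartesian_product)
  let ?Q = "\<lambda>R. {Q. Q \<subseteq> {..<m} \<and> card Q = card R div 2}"
  have finQ: "finite (?Q R)" for R :: "('a \<times> nat) set" by (rule finite_subset[of _ "Pow {..<m}"]) auto
  let ?A = "\<lambda>R Q e j. if (e, j) \<in> R then Q else P"
  have "measure_pmf.prob ?M {g. \<forall>e\<in>S. \<forall>u\<in>set (g e). u \<in> P \<or> (\<exists>e'\<in>S. e' \<noteq> e \<and> u \<in> set (g e'))}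
      \<le> (\<Sum>R\<in>Pow D. measure_pmf.prob ?M {g. \<exists>Q\<in>?Q R. \<forall>e\<in>S. \<forall>j<k. g e ! j \<in> ?A R Q e j})"
  proof (rule prob_union_le)
    fix g assume g: "g \<in> set_pmf ?M"
      and stop: "\<forall>e\<in>S. \<forall>u\<in>set (g e). u \<in> P \<or> (\<exists>e'\<in>S. e' \<noteq> e \<and> u \<in> set (g e'))"
    have ed: "g e \<in> edges k m" if "e \<in> S" for e
      using set_random_hashing[OF V(1) _ g, of e] that V k by auto
    define R where "R = {(e, j). e \<in> S \<and> j < k \<and> g e ! j \<notin> P}"
    let ?C = "(\<lambda>(e, j). g e ! j) ` R"
    have "2 * card ?C \<le> card R"
      unfolding R_def using finS ed stop by (intro stopping_hits) (auto simp: edges_def)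
    then have c: "card ?C \<le> card R div 2" by simp
    have RD: "R \<in> Pow D" by (auto simp: R_def D_def)
    then have "card R \<le> k * card S" using card_mono[OF finD, of R] cardD by auto
    then have "card R div 2 \<le> card {..<m}" using s by simp
    moreover have "?C \<subseteq> {..<m}"
      using ed by (force simp: R_def edges_def)
    ultimately obtain Q where Q: "?C \<subseteq> Q" "Q \<subseteq> {..<m}" "card Q = card R div 2"
      using exists_subset_between[of ?C "card R div 2" "{..<m}"] c by blast
    have "\<forall>e\<in>S. \<forall>j<k. g e ! j \<in> ?A R Q e j"
      using Q(1) by (auto simp: R_def)
    then show "\<exists>R\<in>Pow D. \<exists>Q\<in>?Q R. \<forall>e\<in>S. \<forall>j<k. g e ! j \<in> ?A R Q e j"
      using RD Q by blast
  qed (use finD in simp)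
  also have "\<dots> \<le> (\<Sum>R\<in>Pow D. (\<Prod>_\<in>R. sqrt (6 * z)) * (\<Prod>_\<in>D - R. x))"
  proof (rule sum_mono)
    fix R assume "R \<in> Pow D"
    then have R: "R \<subseteq> D" "finite R" using finD finite_subset by auto
    have cR: "real (card R) \<le> z * real m"
      using card_mono[OF finD R(1)] cardD m unfolding z_def by (simp del: of_nat_mult)
    have each: "measure_pmf.prob ?M {g. \<forall>e\<in>S. \<forall>j<k. g e ! j \<in> ?A R Q e j}
        \<le> (2 * real (card R div 2) / real m) ^ card R * x ^ card (D - R)" if Q: "Q \<in> ?Q R" for Q
    proof -
      have "finite Q" using Q finite_subset[of Q "{..<m}"] by auto
      then have "measure_pmf.prob ?M {g. \<forall>e\<in>S. \<forall>j<k. g e ! j \<in> ?A R Q e j}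
          \<le> (\<Prod>e\<in>S. \<Prod>j<k. 2 * real (card (?A R Q e j)) / real m)"
        using V k P by (intro prob_hash_restricted) auto
      also have "\<dots> = (\<Prod>(e, j)\<in>D. 2 * real (card (?A R Q e j)) / real m)"
        unfolding D_def using finS by (subst prod.cartesian_product) auto
      also have "\<dots> = (\<Prod>y\<in>D. if y \<in> R then 2 * real (card R div 2) / real m else x)"
        using Q by (intro prod.cong) (auto simp: x_def)
      also have "\<dots> = (2 * real (card R div 2) / real m) ^ card R * x ^ card (D - R)"
        using finD R by (subst prod.If_cases) (auto simp: Int_absorb1 Int_absorb2 Diff_eq[symmetric] inf.absorb2)
      finally show ?thesis .
    qed
    have "measure_pmf.prob ?M {g. \<exists>Q\<in>?Q R. \<forall>e\<in>S. \<forall>j<k. g e ! j \<in> ?A R Q e j}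
        \<le> (\<Sum>Q\<in>?Q R. measure_pmf.prob ?M {g. \<forall>e\<in>S. \<forall>j<k. g e ! j \<in> ?A R Q e j})"
      by (rule prob_union_le[OF finQ])
    also have "\<dots> \<le> (\<Sum>Q\<in>?Q R. (2 * real (card R div 2) / real m) ^ card R * x ^ card (D - R))"
      by (intro sum_mono each)
    also have "\<dots> = real (m choose (card R div 2)) * (2 * real (card R div 2) / real m) ^ card R * x ^ card (D - R)"
      by (simp add: n_subsets)
    also have "\<dots> \<le> sqrt (6 * z) ^ card R * x ^ card (D - R)"
      using choose_cells_le[OF cR z m] by (intro mult_right_mono) (auto simp: x_def)
    finally show "measure_pmf.prob ?M {g. \<exists>Q\<in>?Q R. \<forall>e\<in>S. \<forall>j<k. g e ! j \<in> ?A R Q e j}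
        \<le> (\<Prod>_\<in>R. sqrt (6 * z)) * (\<Prod>_\<in>D - R. x)" by simp
  qed
  \<comment> \<open>The sum over all patterns \<open>R\<close> is the expansion of a product of
    binomials, one for each position.\<close>
  also have "\<dots> = (\<Prod>_\<in>D. sqrt (6 * z) + x)"
    by (rule prod_add[OF finD, symmetric])
  also have "\<dots> = (x + sqrt (6 * z)) ^ (k * card S)"
    by (simp add: cardD add.commute)
  finally show ?thesis unfolding x_def z_def .
qed

section \<open>Summation over the sizes of small stopping sets\<close>

lemma sum_geometric_half_le: "(\<Sum>i<N. (1 / 2 :: real) ^ i) \<le> 2"
proof -
  have "(\<Sum>i<N. (1 / 2 :: real) ^ i) = 2 - 2 * (1 / 2) ^ N"
    by (induction N) auto
  then show ?thesis by simp
qed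

lemma sum_arith_geometric_half_le: "(\<Sum>i<N. real (Suc i) * (1 / 2 :: real) ^ i) \<le> 4"
proof -
  have "(\<Sum>i<N. real (Suc i) * (1 / 2 :: real) ^ i) = 4 - 2 * (real N + 2) * (1 / 2) ^ N"
  proof (induction N)
    case (Suc N)
    show ?case unfolding sum.lessThan_Suc Suc.IH by (simp add: algebra_simps)
  qed simp
  then show ?thesis by simp
qed

text \<open>One factor of each power keeps the sharp bound y + c (i + 1), the other i factors are
  bounded by 1/2.\<close>

lemma sum_superexponential_le:
  fixes a :: "nat \<Rightarrow> real"
  assumes "\<And>i. i < N \<Longrightarrow> 0 \<le> a i \<and> a i \<le> y + c * real (Suc i) \<and> a i \<le> 1 / 2" "0 \<le> y" "0 \<le> c"
  shows "(\<Sum>i<N. a i ^ Suc i) \<le> 2 * y + 4 * c"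
proof -
  have "(\<Sum>i<N. a i ^ Suc i) \<le> (\<Sum>i<N. (y + c * real (Suc i)) * (1 / 2) ^ i)"
  proof (rule sum_mono)
    fix i assume "i \<in> {..<N}"
    then have "0 \<le> a i" "a i \<le> y + c * real (Suc i)" "a i \<le> 1 / 2" using assms(1) by auto
    then show "a i ^ Suc i \<le> (y + c * real (Suc i)) * (1 / 2) ^ i"
      unfolding power_Suc by (intro mult_mono power_mono) auto
  qed
  also have "\<dots> = y * (\<Sum>i<N. (1 / 2) ^ i) + c * (\<Sum>i<N. real (Suc i) * (1 / 2) ^ i)"
    unfolding sum_distrib_left sum.distrib[symmetric] by (intro sum.cong) (auto simp: distrib_right mult.assoc)
  also have "\<dots> \<le> y * 2 + c * 4"
    using assms(2,3) by (intro add_mono mult_left_mono sum_geometric_half_le sum_arith_geometric_half_le)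
  finally show ?thesis by simp
qed

lemma add_power_le:
  fixes x y :: real
  assumes "0 \<le> x" "0 \<le> y"
  shows "(x + y) ^ k \<le> 2 ^ k * (x ^ k + y ^ k)"
proof -
  have "(x + y) ^ k \<le> (2 * max x y) ^ k" using assms by (intro power_mono) auto
  also have "\<dots> = 2 ^ k * max x y ^ k" by (rule power_mult_distrib)
  also have "\<dots> \<le> 2 ^ k * (x ^ k + y ^ k)"
    using assms by (intro mult_left_mono) (auto simp: max_def)
  finally show ?thesis .
qed

text \<open>Here k \<ge> 4 enters: the square root y is at most 1, so y^k \<le> y^4, which is
  quadratic in s / n, and the factor 3 n / s from the choice of the set leaves a term linear in s /
  n. The constant 108 is 3 * 6^2.\<close>

lemma stopping_set_base_le:
  fixes n m k s :: nat and x :: real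
  assumes "n > 0" "n \<le> m" "k \<ge> 4" "s > 0" "0 \<le> x" "6 * (real k * real s) \<le> real n"
  shows "3 * real n / real s * (x + sqrt (6 * (real (k * s) / real m))) ^ k
    \<le> 3 * 2 ^ k * real n * x ^ k + 108 * 2 ^ k * (real k)\<^sup>2 / real n * real s"
proof -
  define y where "y = sqrt (6 * (real (k * s) / real m))"
  have m: "real m > 0" "real n > 0" "real s > 0" "real n \<le> real m" using assms by auto
  have y0: "0 \<le> y" by (simp add: y_def)
  have y2: "y\<^sup>2 \<le> 6 * (real k * real s / real n)"
  proof -
    have "y\<^sup>2 = 6 * (real k * real s / real m)" by (simp add: y_def)
    also have "\<dots> \<le> 6 * (real k * real s / real n)"
      using m by (intro mult_left_mono divide_left_mono) auto
    finally show ?thesis .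
  qed
  have "6 * (real k * real s / real n) \<le> 1" using assms(6) m by (simp add: field_simps)
  then have "y\<^sup>2 \<le> 1\<^sup>2" using y2 by simp
  then have y1: "y \<le> 1" by (rule power2_le_imp_le) simp
  have "y ^ k \<le> y ^ 4" using y0 y1 assms(3) by (intro power_decreasing) auto
  also have "\<dots> = (y\<^sup>2)\<^sup>2" by (simp add: power_mult[symmetric])
  also have "\<dots> \<le> (6 * (real k * real s / real n))\<^sup>2" using y2 by (intro power_mono) auto
  finally have yk: "y ^ k \<le> (6 * (real k * real s / real n))\<^sup>2" .
  have "3 * real n / real s * (x + y) ^ k
      \<le> 3 * real n / real s * (2 ^ k * (x ^ k + (6 * (real k * real s / real n))\<^sup>2))"
    using add_power_le[OF assms(5) y0, of k] yk m
    by (intro mult_left_mono) (auto intro: order_trans)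
  also have "\<dots> = 3 * 2 ^ k * real n * x ^ k * (1 / real s) + 108 * 2 ^ k * (real k)\<^sup>2 / real n * real s"
    using m by (simp add: field_simps power2_eq_square)
  also have "3 * 2 ^ k * real n * x ^ k * (1 / real s) \<le> 3 * 2 ^ k * real n * x ^ k * 1"
    using assms by (intro mult_left_mono) (auto simp: field_simps)
  finally show ?thesis by (simp add: y_def)
qed

text \<open>The hashes of the invalid keys are fixed first, which makes the poisoned cells a
  constant set of at most \<open>k * card I\<close> cells. The conditions y \<le> 1/4 and c \<delta>
  \<le> 1/4 keep the base of each power below 1/2.\<close>

lemma prob_small_stopping:
  fixes \<delta> x y c :: real
  assumes X: "finite V" "finite I" "V \<inter> I = {}" "card V \<le> n" "n > 0" "n \<le> m"
    and k: "k \<ge> 4" "2 * k \<le> m"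
    and x: "x = 2 * real (k * card I) / real m" and y: "y = 3 * 2 ^ k * real n * x ^ k" "y \<le> 1 / 4"
    and c: "c = 108 * 2 ^ k * (real k)\<^sup>2" and \<delta>: "\<delta> > 0" "c * \<delta> \<le> 1 / 4" "6 * real k * \<delta> \<le> 1"
  shows "measure_pmf.prob (random_hashing k m (I \<union> V))
      {h. \<exists>S\<subseteq>V. S \<noteq> {} \<and> real (card S) \<le> \<delta> * real n \<and> stopping h I S} \<le> 2 * y + 4 * (c / real n)"
proof -
  let ?stop = "\<lambda>P g S. \<forall>e\<in>S. \<forall>u\<in>set (g e). u \<in> P \<or> (\<exists>e'\<in>S. e' \<noteq> e \<and> u \<in> set (g e'))"
  let ?M = "random_hashing k m V"
  define N where "N = nat \<lfloor>\<delta> * real n\<rfloor>"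
  define a where "a i = 3 * real n / real (Suc i) * (x + sqrt (6 * (real (k * Suc i) / real m))) ^ k" for i
  have m: "real m > 0" "real n > 0" using X by auto
  have x0: "x \<ge> 0" unfolding x by simp
  have SN: "real (Suc i) \<le> \<delta> * real n" if "i < N" for i
  proof -
    have "Suc i \<le> nat \<lfloor>\<delta> * real n\<rfloor>" using that by (simp add: N_def)
    then have "real (Suc i) \<le> real (nat \<lfloor>\<delta> * real n\<rfloor>)" by (rule of_nat_mono)
    also have "\<dots> \<le> \<delta> * real n" using \<delta>(1) by (intro of_nat_floor) auto
    finally show ?thesis .
  qed
  have six: "6 * (real k * real (Suc i)) \<le> real n" if "i < N" for i
  proof -
    have "6 * real k * real (Suc i) \<le> 6 * real k * (\<delta> * real n)"
      using SN[OF that] by (intro mult_left_mono) auto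
    also have "\<dots> = 6 * real k * \<delta> * real n" by simp
    also have "\<dots> \<le> 1 * real n" using \<delta> by (intro mult_right_mono) auto
    finally show ?thesis by simp
  qed
  have a_le: "a i \<le> y + c / real n * real (Suc i)" if "i < N" for i
    unfolding a_def y c using X k x0 six[OF that] by (intro stopping_set_base_le) auto
  have a_half: "a i \<le> 1 / 2" if "i < N" for i
  proof -
    have "c / real n * real (Suc i) \<le> c / real n * (\<delta> * real n)"
      using SN[OF that] c m by (intro mult_left_mono) auto
    also have "\<dots> = c * \<delta>" using m by simp
    finally show ?thesis using a_le[OF that] y(2) \<delta>(2) by linarith
  qed
  have a0: "0 \<le> a i" for i using x0 by (simp add: a_def)
  have fixed: "measure_pmf.prob ?M {g. \<exists>S\<subseteq>V. S \<noteq> {} \<and> real (card S) \<le> \<delta> * real n \<and> ?stop P g S}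
      \<le> 2 * y + 4 * (c / real n)" if P: "finite P" "card P \<le> k * card I" for P
  proof -
    let ?S = "\<lambda>i. {S. S \<subseteq> V \<and> card S = Suc i}"
    have finS: "finite (?S i)" for i by (rule finite_subset[of _ "Pow V"]) (use X in auto)
    have "measure_pmf.prob ?M {g. \<exists>S\<subseteq>V. S \<noteq> {} \<and> real (card S) \<le> \<delta> * real n \<and> ?stop P g S}
        \<le> (\<Sum>i<N. measure_pmf.prob ?M {g. \<exists>S\<in>?S i. ?stop P g S})"
    proof (rule prob_union_le)
      fix g assume "\<exists>S\<subseteq>V. S \<noteq> {} \<and> real (card S) \<le> \<delta> * real n \<and> ?stop P g S"
      then obtain S where S: "S \<subseteq> V" "S \<noteq> {}" "real (card S) \<le> \<delta> * real n" "?stop P g S" by blast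
      then have "finite S" using X finite_subset by blast
      then have "card S > 0" using S by (simp add: card_gt_0_iff)
      moreover have "card S \<le> N" unfolding N_def using S(3) by (simp add: le_nat_floor)
      ultimately have "card S - 1 < N" "S \<in> ?S (card S - 1)" using S by auto
      then show "\<exists>i\<in>{..<N}. \<exists>S\<in>?S i. ?stop P g S" using S(4) by blast
    qed simp
    also have "\<dots> \<le> (\<Sum>i<N. a i ^ Suc i)"
    proof (rule sum_mono)
      fix i assume "i \<in> {..<N}"
      then have i: "i < N" by simp
      have ks: "k * Suc i \<le> m"
      proof -
        have "real (k * Suc i) \<le> real n" using six[OF i] unfolding of_nat_mult
          by (smt (verit) mult_nonneg_nonneg of_nat_0_le_iff)
        then show ?thesis using X(6) by (metis of_nat_le_iff order_trans)
      qed
      have "measure_pmf.prob ?M {g. \<exists>S\<in>?S i. ?stop P g S} \<le> (\<Sum>S\<in>?S i. measure_pmf.prob ?M {g. ?stop P g S})"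
        by (rule prob_union_le[OF finS])
      also have "\<dots> \<le> (\<Sum>S\<in>?S i. (x + sqrt (6 * (real (k * Suc i) / real m))) ^ (k * Suc i))"
      proof (rule sum_mono)
        fix S assume S: "S \<in> ?S i"
        then have cS: "card S = Suc i" by simp
        have "measure_pmf.prob ?M {g. ?stop P g S}
            \<le> (2 * real (card P) / real m + sqrt (6 * (real (k * card S) / real m))) ^ (k * card S)"
          using S X k P ks by (intro prob_stopping_set) auto
        also have "\<dots> \<le> (x + sqrt (6 * (real (k * card S) / real m))) ^ (k * card S)"
          unfolding x using P(2) m
          by (intro power_mono add_right_mono divide_right_mono mult_left_mono of_nat_mono add_nonneg_nonneg) auto
        finally show "measure_pmf.prob ?M {g. ?stop P g S}
            \<le> (x + sqrt (6 * (real (k * Suc i) / real m))) ^ (k * Suc i)" by (simp only: cS)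
      qed
      also have "\<dots> = real (card V choose Suc i) * (x + sqrt (6 * (real (k * Suc i) / real m))) ^ (k * Suc i)"
        using X(1) by (simp add: n_subsets)
      also have "\<dots> \<le> (3 * real n / real (Suc i)) ^ Suc i * ((x + sqrt (6 * (real (k * Suc i) / real m))) ^ k) ^ Suc i"
      proof -
        have "real (card V choose Suc i) \<le> real (n choose Suc i)"
          using X(4) by (intro of_nat_mono binomial_right_mono)
        also have "\<dots> \<le> (3 * real n / real (Suc i)) ^ Suc i" by (rule choose_le_power_div) simp
        finally show ?thesis unfolding power_mult using x0 by (intro mult_right_mono) auto
      qed
      also have "\<dots> = a i ^ Suc i" by (simp only: a_def power_mult_distrib)
      finally show "measure_pmf.prob ?M {g. \<exists>S\<in>?S i. ?stop P g S} \<le> a i ^ Suc i" .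
    qed
    also have "\<dots> \<le> 2 * y + 4 * (c / real n)"
      using a_le a_half a0 y x0 c by (intro sum_superexponential_le) auto
    finally show ?thesis .
  qed
  let ?B = "{h. \<exists>S\<subseteq>V. S \<noteq> {} \<and> real (card S) \<le> \<delta> * real n \<and> stopping h I S}"
  have eq: "random_hashing k m (I \<union> V) = bind_pmf (random_hashing k m I)
      (\<lambda>f. map_pmf (\<lambda>g e. if e \<in> I then f e else g e) ?M)"
    unfolding random_hashing_eq using X
    by (subst Pi_pmf_union) (auto simp: pair_pmf_def map_bind_pmf map_pmf_def bind_assoc_pmf bind_return_pmf)
  show ?thesis unfolding eq
  proof (rule prob_bind_le)
    fix f assume f: "f \<in> set_pmf (random_hashing k m I)"
    let ?P = "cells f I"
    have "card ?P \<le> (\<Sum>e\<in>I. card (set (f e)))"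
      unfolding cells_def using X(2) by (rule card_UN_le)
    also have "\<dots> \<le> (\<Sum>e\<in>I. k)"
      using set_random_hashing[OF X(2) _ f] k card_length
      by (intro sum_mono) (fastforce simp: edges_def)
    finally have P: "finite ?P" "card ?P \<le> k * card I" using X(2) by (auto simp: mult.commute)
    have "measure_pmf.prob (map_pmf (\<lambda>g e. if e \<in> I then f e else g e) ?M) ?B
        \<le> measure_pmf.prob ?M {g. \<exists>S\<subseteq>V. S \<noteq> {} \<and> real (card S) \<le> \<delta> * real n \<and> ?stop ?P g S}"
      unfolding measure_map_pmf
    proof (rule measure_pmf.finite_measure_mono, rule subsetI)
      fix g assume "g \<in> (\<lambda>g e. if e \<in> I then f e else g e) -` ?B"
      then obtain S where S: "S \<subseteq> V" "S \<noteq> {}" "real (card S) \<le> \<delta> * real n"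
        and st: "stopping (\<lambda>e. if e \<in> I then f e else g e) I S" by auto
      have "?stop ?P g S"
      proof (intro ballI)
        fix e u assume e: "e \<in> S" "u \<in> set (g e)"
        have nI: "e' \<notin> I" if "e' \<in> S" for e' using that S(1) X(3) by auto
        obtain e' where e': "e' \<in> S \<union> I" "e' \<noteq> e" "u \<in> set (if e' \<in> I then f e' else g e')"
          using st e nI[OF e(1)] unfolding stopping_def by force
        show "u \<in> ?P \<or> (\<exists>e'\<in>S. e' \<noteq> e \<and> u \<in> set (g e'))"
          using e' by (cases "e' \<in> I") (auto simp: cells_def)
      qed
      then show "g \<in> {g. \<exists>S\<subseteq>V. S \<noteq> {} \<and> real (card S) \<le> \<delta> * real n \<and> ?stop ?P g S}"
        using S by blast
    qed simp
    also have "\<dots> \<le> 2 * y + 4 * (c / real n)" by (rule fixed[OF P])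
    finally show "measure_pmf.prob (map_pmf (\<lambda>g e. if e \<in> I then f e else g e) ?M) ?B \<le> 2 * y + 4 * (c / real n)" .
  qed
qed

section \<open>The threshold\<close>

text \<open>The branching recursion of \<open>tree_bound\<close> with a Poisson number of edges of
  mean k \<alpha> at each cell.\<close>

primrec survival :: "real \<Rightarrow> nat \<Rightarrow> nat \<Rightarrow> real" where
  "survival \<alpha> k 0 = 1"
| "survival \<alpha> k (Suc t) = 1 - exp (- real k * \<alpha> * survival \<alpha> k t ^ (k - 1))"

lemma survival_nonneg: "0 \<le> \<alpha> \<Longrightarrow> 0 \<le> survival \<alpha> k t"
  by (induction t) auto

lemma survival_step_le:
  assumes \<alpha>: "0 < \<alpha>" "\<And>x. 0 < x \<Longrightarrow> x < 1 \<Longrightarrow> 1 - exp (- real k * \<alpha> * x ^ (k - 1)) < x" and k: "k \<ge> 2"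
    and x: "0 \<le> x" "x \<le> 1"
  shows "1 - exp (- real k * \<alpha> * x ^ (k - 1)) \<le> x" "x \<noteq> 0 \<Longrightarrow> 1 - exp (- real k * \<alpha> * x ^ (k - 1)) \<noteq> x"
  using \<alpha>(2)[of x] x k by (cases "x = 0"; cases "x = 1"; force simp: power_0_left)+

text \<open>The iterates decrease, so they converge to a fixed point in [0, 1]. The open interval
  contains none by subcriticality, and 1 is none because the exponential is positive.\<close>

lemma survival_tendsto_0:
  assumes \<alpha>: "0 < \<alpha>" "\<And>x. 0 < x \<Longrightarrow> x < 1 \<Longrightarrow> 1 - exp (- real k * \<alpha> * x ^ (k - 1)) < x" and k: "k \<ge> 2"
  shows "survival \<alpha> k \<longlonglongrightarrow> 0"
proof -
  let ?g = "\<lambda>x. 1 - exp (- real k * \<alpha> * x ^ (k - 1))"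
  have nn: "0 \<le> survival \<alpha> k t" for t using \<alpha> by (intro survival_nonneg) auto
  have le1: "survival \<alpha> k t \<le> 1" for t
    using nn \<alpha> by (cases t) auto
  have "decseq (survival \<alpha> k)"
    using survival_step_le(1)[OF \<alpha> k nn le1] by (intro decseq_SucI) simp
  then obtain l where l: "survival \<alpha> k \<longlonglongrightarrow> l"
    using decseq_convergent[of "survival \<alpha> k" 0] nn by blast
  have "(\<lambda>t. ?g (survival \<alpha> k t)) \<longlonglongrightarrow> ?g l"
    using l by (intro tendsto_intros)
  moreover have "(\<lambda>t. ?g (survival \<alpha> k t)) \<longlonglongrightarrow> l"
    using LIMSEQ_Suc[OF l] by simp
  ultimately have "?g l = l" by (rule LIMSEQ_unique)
  moreover have "0 \<le> l" "l \<le> 1"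
    using l nn le1 by (auto intro: LIMSEQ_le_const LIMSEQ_le_const2)
  ultimately have "l = 0" using survival_step_le(2)[OF \<alpha> k] by blast
  then show ?thesis using l by simp
qed

text \<open>From ln (1 - y) \<ge> - y - 2 y^2 and y \<le> p it follows that (1 - y)^d \<ge> exp (- d
  y (1 + 2 p)). The factor 1 + 2 p is absorbed into the mean k \<alpha>.\<close>

lemma tree_bound_le_survival:
  assumes p: "0 \<le> p" "p \<le> 1 / 2" and d: "p * real d * (1 + 2 * p) \<le> real k * \<alpha>" and \<alpha>: "0 \<le> \<alpha>"
  shows "tree_bound p k d t \<le> survival \<alpha> k t"
proof (induction t)
  case (Suc t)
  let ?q = "tree_bound p k d t"
  let ?x = "survival \<alpha> k t"
  define y where "y = p * ?q ^ (k - 1)"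
  have q: "0 \<le> ?q" "?q \<le> 1" using tree_bound_range[of p k d t] p by auto
  have qk: "0 \<le> ?q ^ (k - 1)" "?q ^ (k - 1) \<le> 1" using q by (auto intro: power_le_one)
  have y: "0 \<le> y" "y \<le> p" unfolding y_def using p qk by (auto intro: mult_left_le)
  have "- (real k * \<alpha> * ?x ^ (k - 1)) \<le> - (real k * \<alpha> * ?q ^ (k - 1))"
    using Suc.IH q \<alpha> by (intro le_imp_neg_le mult_left_mono power_mono) auto
  also have "\<dots> \<le> - (p * real d * (1 + 2 * p) * ?q ^ (k - 1))"
    using d qk by (intro le_imp_neg_le mult_right_mono) auto
  also have "\<dots> = real d * - (y * (1 + 2 * p))"
    by (simp add: y_def)
  also have "\<dots> \<le> real d * - (y * (1 + 2 * y))"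
    using y by (intro mult_left_mono le_imp_neg_le) auto
  also have "\<dots> \<le> real d * ln (1 - y)"
    using ln_one_minus_pos_lower_bound[of y] y p
    by (intro mult_left_mono) (auto simp: power2_eq_square algebra_simps)
  finally have "exp (- (real k * \<alpha> * ?x ^ (k - 1))) \<le> exp (real d * ln (1 - y))" by simp
  also have "\<dots> = (1 - y) ^ d"
    using y p by (simp add: exp_of_nat_mult)
  finally show ?case by (simp add: y_def)
qed simp

section \<open>Densities below the threshold\<close>

definition subcritical :: "nat \<Rightarrow> real set" where
  "subcritical k = {\<alpha>. 0 < \<alpha> \<and> \<alpha> < 1 \<and> (\<forall>x\<in>{0<..<1}. 1 - exp (- real k * \<alpha> * x ^ (k - 1)) < x)}"

lemma subcritical_small:
  assumes "k \<ge> 2"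
  shows "1 / (2 * real k) \<in> subcritical k"
proof -
  have "1 - exp (- real k * (1 / (2 * real k)) * x ^ (k - 1)) < x" if x: "0 < x" "x < 1" for x
  proof -
    have "1 - exp (- (x ^ (k - 1) / 2)) \<le> x ^ (k - 1) / 2"
      using exp_ge_add_one_self[of "- (x ^ (k - 1) / 2)"] by linarith
    also have "\<dots> \<le> x ^ 1 / 2"
      using x assms by (intro divide_right_mono power_decreasing) auto
    also have "\<dots> < x" using x by simp
    finally show ?thesis using assms by simp
  qed
  then show ?thesis using assms by (auto simp: subcritical_def)
qed

lemma core_threshold_eq: "core_threshold k = inverse (Sup (subcritical k))"
  by (simp add: core_threshold_def subcritical_def)

lemma bdd_above_subcritical: "bdd_above (subcritical k)"
  by (rule bdd_aboveI[of _ 1]) (auto simp: subcritical_def)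

lemma Sup_subcritical:
  assumes "k \<ge> 2"
  shows "0 < Sup (subcritical k)" "Sup (subcritical k) \<le> 1"
proof -
  have "0 < 1 / (2 * real k)" using assms by simp
  also have "\<dots> \<le> Sup (subcritical k)"
    by (rule cSup_upper[OF subcritical_small[OF assms] bdd_above_subcritical])
  finally show "0 < Sup (subcritical k)" .
  show "Sup (subcritical k) \<le> 1"
    using subcritical_small[OF assms] by (intro cSup_least) (auto simp: subcritical_def)
qed

lemma core_threshold_ge_1: "k \<ge> 2 \<Longrightarrow> core_threshold k \<ge> 1"
  using Sup_subcritical[of k] by (simp add: core_threshold_eq one_le_inverse)

text \<open>An element of the set close to its supremum is chosen directly, with a constant factor
  to spare in \<alpha> m > n.\<close>

lemma subcritical_above:
  assumes "k \<ge> 2" "\<epsilon> > 0"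
  obtains \<alpha> where "\<alpha> \<in> subcritical k" "\<alpha> * (core_threshold k + \<epsilon>) > 1"
proof -
  have c: "core_threshold k \<ge> 1" by (rule core_threshold_ge_1) fact
  have "1 / (core_threshold k + \<epsilon>) < 1 / core_threshold k"
    using c assms by (intro divide_strict_left_mono) auto
  also have "\<dots> = Sup (subcritical k)" by (simp add: core_threshold_eq inverse_eq_divide)
  finally obtain \<alpha> where "\<alpha> \<in> subcritical k" "1 / (core_threshold k + \<epsilon>) < \<alpha>"
    using less_cSupD[of "subcritical k"] subcritical_small[OF assms(1)] by blast
  then show ?thesis using that[of \<alpha>] c assms by (simp add: field_simps)
qed

text \<open>The two factors 1 + \<eta> have different purposes: one raises the mean of the Bernoulli
  set above n, the other covers 1 + 2 p. The lower bounds on n make p at most 1/2 and at most \<eta>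
  / 2, since there are at least (m / 2)^2 edges.\<close>

lemma prob_trees_le_survival:
  assumes X: "finite X" "card X \<le> n" "e \<in> X" "n > 0" "n \<le> m" and k: "k \<ge> 2" "2 * k \<le> m"
    and \<eta>: "\<eta> > 0" "2 * (1 + \<eta>) \<le> \<eta>\<^sup>2 * real n" "8 * (1 + \<eta>) \<le> \<eta> * real n" "8 * (1 + \<eta>) \<le> real n"
    and \<alpha>: "(1 + \<eta>)\<^sup>2 * real n \<le> \<alpha> * real m"
  shows "measure_pmf.prob (random_hashing k m X) {h. all_disj (map (tree t) (h e)) (h ` (X - {e}))}
    \<le> 2 * survival \<alpha> k t ^ k"
proof -
  let ?E = "edges k m"
  define M where "M = real (card ?E)"
  define p where "p = (1 + \<eta>) * real n / M"
  define d where "d = k * card ?E div m"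
  have m: "real m > 0" "real n > 0" "real n \<le> real m" using X by auto
  have m4: "4 \<le> real m" using k by linarith
  have "(real m / 2)\<^sup>2 \<le> (real m / 2) ^ k"
    using k m4 by (intro power_increasing) auto
  also have "\<dots> \<le> M" unfolding M_def by (rule card_edges_ge) fact
  finally have M: "(real m / 2)\<^sup>2 \<le> M" .
  have "real m * 4 \<le> real m * real m" using m4 m by (intro mult_left_mono) auto
  then have mM: "real m \<le> M" using M by (simp add: power2_eq_square)
  have Mpos: "M > 0" using mM m by linarith
  have nE: "n \<le> card ?E" using mM m unfolding M_def by linarith
  have p0: "0 \<le> p" unfolding p_def using \<eta> Mpos by simp
  have p_le: "p \<le> 4 * (1 + \<eta>) / real n"
  proof -
    have "p \<le> (1 + \<eta>) * real n / (real m / 2)\<^sup>2"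
      unfolding p_def using M m \<eta> Mpos by (intro divide_left_mono) auto
    also have "\<dots> \<le> (1 + \<eta>) * real n / (real n / 2)\<^sup>2"
      using m \<eta> by (intro divide_left_mono power_mono) auto
    also have "\<dots> = 4 * (1 + \<eta>) / real n" using m by (simp add: field_simps power2_eq_square)
    finally show ?thesis .
  qed
  have "4 * (1 + \<eta>) / real n \<le> 1 / 2" "4 * (1 + \<eta>) / real n \<le> \<eta> / 2"
    using \<eta> m by (auto simp: field_simps)
  then have p: "p \<le> 1 / 2" "2 * p \<le> \<eta>" using p_le by linarith+
  have \<alpha>0: "0 \<le> \<alpha>"
  proof -
    have "0 \<le> \<alpha> * real m" using \<alpha> m by (meson order_trans mult_nonneg_nonneg zero_le_power2 of_nat_0_le_iff)
    then show ?thesis using m by (simp add: zero_le_mult_iff)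
  qed
  have d: "p * real d * (1 + 2 * p) \<le> real k * \<alpha>"
  proof -
    have "real d \<le> real k * M / real m" unfolding d_def M_def using of_nat_div_le_of_nat[of "k * card ?E" m, where 'a=real] by simp
    then have "p * real d * (1 + 2 * p) \<le> p * (real k * M / real m) * (1 + \<eta>)"
      using p0 p by (intro mult_mono mult_nonneg_nonneg) auto
    also have "\<dots> = real k * ((1 + \<eta>)\<^sup>2 * real n / real m)"
      unfolding p_def using Mpos by (simp add: power2_eq_square)
    also have "\<dots> \<le> real k * \<alpha>"
      using \<alpha> m by (intro mult_left_mono) (auto simp: field_simps)
    finally show ?thesis .
  qed
  have tree: "bern p ?E (tree t v) \<le> survival \<alpha> k t" for v
  proof -
    have "card {s \<in> ?E. v \<in> set s} \<le> d" for v
      unfolding d_def using card_edges_through[of k m v] k m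
      by (simp add: less_eq_div_iff_mult_less_eq mult.commute)
    then have "bern p ?E (tree t v) \<le> tree_bound p k d t"
      using p0 p by (intro bern_tree finite_edges) (auto simp: edges_def)
    also have "\<dots> \<le> survival \<alpha> k t" by (rule tree_bound_le_survival[OF p0 p(1) d \<alpha>0])
    finally show ?thesis .
  qed
  show ?thesis
  proof (rule prob_tree_event[where \<Phi> = "\<lambda>s. all_disj (map (tree t) s)"])
    show "bern p ?E (all_disj (map (tree t) s)) \<le> survival \<alpha> k t ^ k" if "s \<in> ?E" for s
    proof -
      have "bern p ?E (all_disj (map (tree t) s)) \<le> survival \<alpha> k t ^ length (map (tree t) s)"
        using tree upward_tree by (intro bern_all_disj[OF finite_edges p0 p(1)]) auto
      then show ?thesis using that by (simp add: edges_def)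
    qed
    show "real (card ?E) * p = (1 + \<eta>) * real n"
      unfolding p_def using Mpos by (simp add: M_def)
  qed (use X k \<eta> p0 p nE in \<open>auto simp: upward_all_disj\<close>)
qed

lemma prob_stopping_le:
  fixes \<delta> \<eta> \<alpha> x y c :: real
  assumes X: "finite V" "finite I" "V \<inter> I = {}" "card (I \<union> V) \<le> n" "n > 0" "n \<le> m"
    and k: "k \<ge> 4" "2 * k \<le> m" and L: "L = 1 + k * tree_size k t" "L * k \<le> m"
    and \<eta>: "\<eta> > 0" "2 * (1 + \<eta>) \<le> \<eta>\<^sup>2 * real n" "8 * (1 + \<eta>) \<le> \<eta> * real n" "8 * (1 + \<eta>) \<le> real n"
    and \<alpha>: "(1 + \<eta>)\<^sup>2 * real n \<le> \<alpha> * real m"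
    and x: "x = 2 * real (k * card I) / real m" and y: "y = 3 * 2 ^ k * real n * x ^ k" "y \<le> 1 / 4"
    and c: "c = 108 * 2 ^ k * (real k)\<^sup>2" and \<delta>: "\<delta> > 0" "c * \<delta> \<le> 1 / 4" "6 * real k * \<delta> \<le> 1"
  shows "measure_pmf.prob (random_hashing k m (I \<union> V)) {h. \<exists>S\<subseteq>V. S \<noteq> {} \<and> stopping h I S}
    \<le> 2 * survival \<alpha> k t ^ k / \<delta> + real L * defect_const k L * ((1 + real (card I)) / real n) / \<delta>
      + (2 * y + 4 * (c / real n))"
proof -
  let ?M = "random_hashing k m (I \<union> V)"
  let ?Q = "\<lambda>e h. \<exists>S\<subseteq>V. e \<in> S \<and> stopping h I S"
  have n: "real n > 0" using X by simp
  have cV: "card V \<le> n" using X card_mono[of "I \<union> V" V] by auto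
  have den: "0 \<le> survival \<alpha> k t ^ k"
  proof -
    have "0 \<le> \<alpha> * real m" using \<alpha> by (meson order_trans mult_nonneg_nonneg zero_le_power2 of_nat_0_le_iff)
    then have "0 \<le> \<alpha>" using X by (simp add: zero_le_mult_iff)
    then show ?thesis by (intro zero_le_power survival_nonneg)
  qed
  have "measure_pmf.prob ?M {h. \<exists>S\<subseteq>V. S \<noteq> {} \<and> stopping h I S}
      \<le> measure_pmf.prob ?M {h. \<delta> * real n \<le> real (card {e \<in> V. ?Q e h})}
        + measure_pmf.prob ?M {h. \<exists>S\<subseteq>V. S \<noteq> {} \<and> real (card S) \<le> \<delta> * real n \<and> stopping h I S}"
  proof (rule prob_disj_le)
    fix h assume "\<exists>S\<subseteq>V. S \<noteq> {} \<and> stopping h I S"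
    then obtain S where S: "S \<subseteq> V" "S \<noteq> {}" "stopping h I S" by blast
    \<comment> \<open>Every key of a stopping set is counted on the right, so one stopping set
      larger than \<delta> n already makes this count large.\<close>
    then have "card S \<le> card {e \<in> V. ?Q e h}" using X(1) by (intro card_mono) auto
    then have "real (card S) \<le> real (card {e \<in> V. ?Q e h})" by simp
    then show "\<delta> * real n \<le> real (card {e \<in> V. ?Q e h}) \<or>
        (\<exists>S\<subseteq>V. S \<noteq> {} \<and> real (card S) \<le> \<delta> * real n \<and> stopping h I S)"
      using S by (cases "\<delta> * real n \<le> real (card {e \<in> V. ?Q e h})") (auto intro!: exI[of _ S])
  qed
  also have "measure_pmf.prob ?M {h. \<delta> * real n \<le> real (card {e \<in> V. ?Q e h})}
      \<le> (\<Sum>e\<in>V. measure_pmf.prob ?M {h. ?Q e h}) / (\<delta> * real n)"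
    using X(1) \<delta> n by (intro prob_Markov_card) auto
  also have "\<dots> \<le> (real (card V) * (2 * survival \<alpha> k t ^ k)
      + real L * (defect_const k L * (1 + real (card I)))) / (\<delta> * real n)"
  proof (intro divide_right_mono sum_prob_in_stopping)
    show "measure_pmf.prob ?M {h. all_disj (map (tree t) (h e)) (h ` (I \<union> V - {e}))} \<le> 2 * survival \<alpha> k t ^ k"
      if "e \<in> V" for e
      using X k \<eta> \<alpha> that by (intro prob_trees_le_survival) auto
  qed (use X k L \<delta> in auto)
  also have "\<dots> \<le> (real n * (2 * survival \<alpha> k t ^ k)
      + real L * (defect_const k L * (1 + real (card I)))) / (\<delta> * real n)"
    using cV den \<delta> n by (intro divide_right_mono add_right_mono mult_right_mono) auto
  also have "\<dots> = 2 * survival \<alpha> k t ^ k / \<delta> + real L * defect_const k L * ((1 + real (card I)) / real n) / \<delta>"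
    using \<delta> n by (simp add: field_simps)
  also have "measure_pmf.prob ?M {h. \<exists>S\<subseteq>V. S \<noteq> {} \<and> real (card S) \<le> \<delta> * real n \<and> stopping h I S}
      \<le> 2 * y + 4 * (c / real n)"
    using X k x y c \<delta> cV by (intro prob_small_stopping) auto
  finally show ?thesis by simp
qed

section \<open>Asymptotics in n\<close>

lemma powr_over_n_tendsto_0:
  fixes \<beta> :: real
  assumes "\<beta> > 0"
  shows "(\<lambda>n. (real n powr (1 - \<beta>) + 2) / real n) \<longlonglongrightarrow> 0"
proof -
  have "(\<lambda>n. real n powr (- \<beta>) + 2 / real n) \<longlonglongrightarrow> 0 + 0"
    using assms by (intro tendsto_add tendsto_neg_powr filterlim_real_sequentially lim_const_over_n) auto
  moreover have "\<forall>\<^sub>F n in sequentially. real n powr (- \<beta>) + 2 / real n = (real n powr (1 - \<beta>) + 2) / real n"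
    using eventually_gt_at_top[of 0]
    by eventually_elim (simp add: add_divide_distrib powr_diff powr_minus_divide)
  ultimately show ?thesis using tendsto_cong by fastforce
qed

text \<open>The summand 1 accounts for rounding the number of invalid keys. By
  \<open>add_power_le\<close> the two parts separate into n^(1 - k \<beta>) and a term of size at
  most 1 / n.\<close>

lemma n_times_powr_power_tendsto_0:
  fixes \<beta> :: real
  assumes "real k * \<beta> > 1" "k \<ge> 2"
  shows "(\<lambda>n. real n * ((real n powr (1 - \<beta>) + 1) / real n) ^ k) \<longlonglongrightarrow> 0"
proof (rule tendsto_sandwich[OF _ _ tendsto_const])
  show "(\<lambda>n. 2 ^ k * (real n powr (1 - real k * \<beta>) + 1 / real n)) \<longlonglongrightarrow> 0"
  proof -
    have "(\<lambda>n. 2 ^ k * (real n powr (1 - real k * \<beta>) + 1 / real n)) \<longlonglongrightarrow> 2 ^ k * (0 + 0)"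
      using assms by (intro tendsto_mult tendsto_const tendsto_add tendsto_neg_powr
          filterlim_real_sequentially lim_const_over_n) auto
    then show ?thesis by simp
  qed
  show "\<forall>\<^sub>F n in sequentially. real n * ((real n powr (1 - \<beta>) + 1) / real n) ^ k
      \<le> 2 ^ k * (real n powr (1 - real k * \<beta>) + 1 / real n)"
    using eventually_gt_at_top[of 0]
  proof eventually_elim
    case (elim n)
    have n: "real n > 0" "1 / real n \<le> 1" using elim by auto
    have "real n * ((real n powr (1 - \<beta>) + 1) / real n) ^ k = real n * (real n powr (- \<beta>) + 1 / real n) ^ k"
      using n by (simp add: add_divide_distrib powr_diff powr_minus_divide)
    also have "\<dots> \<le> real n * (2 ^ k * ((real n powr (- \<beta>)) ^ k + (1 / real n) ^ k))"
      using n by (intro mult_left_mono add_power_le) auto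
    also have "\<dots> \<le> real n * (2 ^ k * ((real n powr (- \<beta>)) ^ k + (1 / real n) ^ 2))"
      using n assms(2) by (intro mult_left_mono add_left_mono power_decreasing) auto
    also have "\<dots> = 2 ^ k * (real n * (real n powr (- \<beta>)) ^ k + 1 / real n)"
      using n by (simp add: field_simps power2_eq_square)
    also have "real n * (real n powr (- \<beta>)) ^ k = real n powr (1 - real k * \<beta>)"
    proof -
      have "(real n powr (- \<beta>)) ^ k = real n powr (- \<beta> * real k)"
        using n by (simp add: powr_power mult.commute)
      then show ?thesis using n by (simp add: powr_diff powr_minus_divide mult.commute)
    qed
    finally show ?case .
  qed
qed simp

text \<open>The order of the choices matters: \<delta> depends on k only; \<alpha> and \<eta> depend
  on k and \<epsilon>; the depth t is then taken so large that the survival term is small even after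
  division by \<delta>; L and the defect constant are now fixed, and n grows last.\<close>

lemma prob_stopping_tendsto_0:
  fixes V I :: "nat \<Rightarrow> 'k set" and m :: "nat \<Rightarrow> nat" and \<beta> \<epsilon> :: real
  assumes \<beta>: "\<beta> > 0" "real k * \<beta> > 1" and \<epsilon>: "\<epsilon> > 0" and k: "k \<ge> 4"
    and X: "\<And>n. finite (V n)" "\<And>n. finite (I n)" "\<And>n. V n \<inter> I n = {}" "\<And>n. card (I n \<union> V n) = n"
    and I: "\<And>n. real (card (I n)) \<le> real n powr (1 - \<beta>) + 1"
    and m: "\<And>n. real (m n) > (core_threshold k + \<epsilon>) * real n"
  shows "(\<lambda>n. measure_pmf.prob (random_hashing k (m n) (I n \<union> V n))
      {h. \<exists>S\<subseteq>V n. S \<noteq> {} \<and> stopping h (I n) S}) \<longlonglongrightarrow> 0"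
proof (rule tendstoI)
  fix e :: real assume e: "e > 0"
  define c where "c = 108 * 2 ^ k * (real k)\<^sup>2"
  have c0: "c > 0" using k by (simp add: c_def)
  define \<delta> where "\<delta> = min (1 / (4 * c)) (1 / (6 * real k))"
  have \<delta>: "\<delta> > 0" "c * \<delta> \<le> 1 / 4" "6 * real k * \<delta> \<le> 1"
  proof -
    show "\<delta> > 0" using c0 k by (simp add: \<delta>_def)
    have "c * \<delta> \<le> c * (1 / (4 * c))" using c0 by (intro mult_left_mono) (auto simp: \<delta>_def)
    then show "c * \<delta> \<le> 1 / 4" using c0 by simp
    have "6 * real k * \<delta> \<le> 6 * real k * (1 / (6 * real k))" by (intro mult_left_mono) (auto simp: \<delta>_def)
    then show "6 * real k * \<delta> \<le> 1" using k by simp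
  qed
  have thr: "core_threshold k \<ge> 1" using k by (intro core_threshold_ge_1) auto
  obtain \<alpha> where \<alpha>: "\<alpha> \<in> subcritical k" "\<alpha> * (core_threshold k + \<epsilon>) > 1"
    using subcritical_above[of k \<epsilon>] k \<epsilon> by auto
  have \<alpha>0: "\<alpha> > 0" using \<alpha>(1) by (simp add: subcritical_def)
  \<comment> \<open>The square root splits the spare factor evenly, as the slack is spent
    twice.\<close>
  define \<eta> where "\<eta> = sqrt (\<alpha> * (core_threshold k + \<epsilon>)) - 1"
  have \<eta>0: "\<eta> > 0" using \<alpha>(2) by (simp add: \<eta>_def)
  have \<eta>2: "(1 + \<eta>)\<^sup>2 = \<alpha> * (core_threshold k + \<epsilon>)" using \<alpha>(2) by (simp add: \<eta>_def)
  have "survival \<alpha> k \<longlonglongrightarrow> 0"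
    using \<alpha>(1) k by (intro survival_tendsto_0) (auto simp: subcritical_def)
  then have "(\<lambda>t. 2 * survival \<alpha> k t ^ k / \<delta>) \<longlonglongrightarrow> 2 * 0 ^ k / \<delta>"
    using \<delta> by (intro tendsto_intros) auto
  then have "(\<lambda>t. 2 * survival \<alpha> k t ^ k / \<delta>) \<longlonglongrightarrow> 0" using k by (simp add: power_0_left)
  then have "\<forall>\<^sub>F t in sequentially. 2 * survival \<alpha> k t ^ k / \<delta> < e / 2"
    using e by (intro order_tendstoD) auto
  then obtain t where t: "2 * survival \<alpha> k t ^ k / \<delta> < e / 2"
    by (auto simp: eventually_sequentially)
  define L where "L = 1 + k * tree_size k t"
  define D where "D = real L * defect_const k L"
  have D0: "D \<ge> 0" unfolding D_def defect_const_def by (intro mult_nonneg_nonneg sum_nonneg) auto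
  define u where "u n = (real n powr (1 - \<beta>) + 2) / real n" for n
  define Y where "Y n = 3 * 2 ^ k * (2 * real k) ^ k * (real n * ((real n powr (1 - \<beta>) + 1) / real n) ^ k)" for n
  have u0: "u \<longlonglongrightarrow> 0" unfolding u_def using \<beta>(1) by (rule powr_over_n_tendsto_0)
  have "Y \<longlonglongrightarrow> 3 * 2 ^ k * (2 * real k) ^ k * 0"
    unfolding Y_def using \<beta>(2) k by (intro tendsto_mult tendsto_const n_times_powr_power_tendsto_0) auto
  then have Y0: "Y \<longlonglongrightarrow> 0" by simp
  have "(\<lambda>n. D * u n / \<delta> + (2 * Y n + 4 * (c / real n))) \<longlonglongrightarrow> D * 0 / \<delta> + (2 * 0 + 4 * 0)"
    using \<delta> by (intro tendsto_intros u0 Y0 lim_const_over_n) auto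
  then have small: "\<forall>\<^sub>F n in sequentially. D * u n / \<delta> + (2 * Y n + 4 * (c / real n)) < e / 2"
    using e by (intro order_tendstoD) auto
  have quarter: "\<forall>\<^sub>F n in sequentially. Y n < 1 / 4"
    using Y0 by (intro order_tendstoD) auto
  have large: "\<forall>\<^sub>F n in sequentially. z \<le> real n" for z
    using filterlim_real_sequentially by (simp add: filterlim_at_top)
  show "\<forall>\<^sub>F n in sequentially. dist (measure_pmf.prob (random_hashing k (m n) (I n \<union> V n))
      {h. \<exists>S\<subseteq>V n. S \<noteq> {} \<and> stopping h (I n) S}) 0 < e"
    using small quarter large[of "2 * (1 + \<eta>) / \<eta>\<^sup>2"] large[of "8 * (1 + \<eta>) / \<eta>"] large[of "8 * (1 + \<eta>)"]
      large[of "real (2 * k)"] large[of "real (L * k)"] eventually_gt_at_top[of 0]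
  proof eventually_elim
    case (elim n)
    let ?p = "measure_pmf.prob (random_hashing k (m n) (I n \<union> V n)) {h. \<exists>S\<subseteq>V n. S \<noteq> {} \<and> stopping h (I n) S}"
    have n: "real n > 0" using elim by simp
    have "1 * real n \<le> (core_threshold k + \<epsilon>) * real n"
      using thr \<epsilon> by (intro mult_right_mono) auto
    then have nm: "real n \<le> real (m n)" using m[of n] by linarith
    define x where "x = 2 * real (k * card (I n)) / real (m n)"
    have x_le: "x \<le> 2 * real k * ((real n powr (1 - \<beta>) + 1) / real n)"
    proof -
      have "x \<le> 2 * real (k * card (I n)) / real n"
        unfolding x_def using n nm by (intro divide_left_mono) auto
      also have "\<dots> = 2 * real k * (real (card (I n)) / real n)" by simp
      also have "\<dots> \<le> 2 * real k * ((real n powr (1 - \<beta>) + 1) / real n)"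
        using I n by (intro mult_left_mono divide_right_mono) auto
      finally show ?thesis .
    qed
    have x0: "0 \<le> x" by (simp add: x_def)
    define y where "y = 3 * 2 ^ k * real n * x ^ k"
    have y_le: "y \<le> Y n"
    proof -
      have "y \<le> 3 * 2 ^ k * real n * (2 * real k * ((real n powr (1 - \<beta>) + 1) / real n)) ^ k"
        unfolding y_def using x_le x0 by (intro mult_left_mono power_mono) auto
      also have "\<dots> = Y n"
        unfolding Y_def power_mult_distrib by (simp only: mult_ac)
      finally show ?thesis .
    qed
    have \<alpha>m: "(1 + \<eta>)\<^sup>2 * real n \<le> \<alpha> * real (m n)"
    proof -
      have "(1 + \<eta>)\<^sup>2 * real n = \<alpha> * ((core_threshold k + \<epsilon>) * real n)" by (simp add: \<eta>2)
      also have "\<dots> \<le> \<alpha> * real (m n)" using m[of n] \<alpha>0 by (intro mult_left_mono) auto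
      finally show ?thesis .
    qed
    have nat_nm: "n \<le> m n" using nm by simp
    have "?p \<le> 2 * survival \<alpha> k t ^ k / \<delta> + real L * defect_const k L * ((1 + real (card (I n))) / real n) / \<delta>
        + (2 * y + 4 * (c / real n))"
    proof (rule prob_stopping_le[where x = x and \<eta> = \<eta>])
      show "2 * (1 + \<eta>) \<le> \<eta>\<^sup>2 * real n" using elim \<eta>0 by (simp add: field_simps)
      show "8 * (1 + \<eta>) \<le> \<eta> * real n" using elim \<eta>0 by (simp add: field_simps)
      show "2 * k \<le> m n" using elim nat_nm by linarith
      show "L * k \<le> m n" using elim(7) nat_nm by (metis of_nat_le_iff order_trans)
      show "y \<le> 1 / 4" using y_le elim by linarith
    qed (use X elim k \<eta>0 \<alpha>m nat_nm \<delta> in \<open>auto simp: L_def x_def y_def c_def\<close>)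
    also have "\<dots> \<le> 2 * survival \<alpha> k t ^ k / \<delta> + (D * u n / \<delta> + (2 * Y n + 4 * (c / real n)))"
    proof -
      have "(1 + real (card (I n))) / real n \<le> u n"
        unfolding u_def using I[of n] n by (intro divide_right_mono) auto
      then have "D * ((1 + real (card (I n))) / real n) / \<delta> \<le> D * u n / \<delta>"
        using D0 \<delta> by (intro divide_right_mono mult_left_mono) auto
      then show ?thesis using y_le by (simp add: D_def)
    qed
    also have "\<dots> < e" using t elim by linarith
    finally show ?case by simp
  qed
qed

lemma stopping_cong:
  assumes "\<And>e. e \<in> S \<union> I \<Longrightarrow> h e = h' e"
  shows "stopping h I S \<longleftrightarrow> stopping h' I S"
  using assms unfolding stopping_def by auto

theorem theorem2:
  fixes \<beta> \<epsilon> :: real and k :: nat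
    and m :: "nat \<Rightarrow> nat"
    and ops :: "nat \<Rightarrow> ('k::ab_group_add, 'v::ab_group_add) operation list"
    and G1 :: "nat \<Rightarrow> 'k \<Rightarrow> 'g::ab_group_add"
    and G2 :: "nat \<Rightarrow> 'v \<Rightarrow> 'w::ab_group_add"
  assumes "\<beta> > 0" and "\<epsilon> > 0"
    and "k = nat \<lceil>1 / \<beta>\<rceil> + 4"
    and "\<And>n. card (stored_keys (ops n)) = n"
    and "\<And>n. \<bar>real (card (invalid_keys (ops n))) - real n powr (1 - \<beta>)\<bar> < 1"
    and "\<And>n x y. (x, y) \<in> valid_pairs (ops n) \<Longrightarrow> \<bar>net_weight (ops n) x y\<bar> = 1"
    and "\<And>n. no_false_matches (G1 n) (G2 n) (ops n)"
    and "\<And>n. real (m n) > (core_threshold k + \<epsilon>) * real n"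
  shows "(\<lambda>n. measure_pmf.prob (random_hashing k (m n) (op_key ` set (ops n)))
            {h. list_entries_succeeds (m n) h (G1 n) (G2 n) (iblt h (G1 n) (G2 n) (ops n))
                  (valid_pairs (ops n))}) \<longlonglongrightarrow> 1"
proof -
  define I where "I n = invalid_keys (ops n)" for n
  define V where "V n = stored_keys (ops n) - I n" for n
  let ?X = "\<lambda>n. op_key ` set (ops n)"
  let ?M = "\<lambda>n. random_hashing k (m n) (?X n)"
  let ?stop = "\<lambda>n (h :: 'k \<Rightarrow> nat list). \<exists>S\<subseteq>V n. S \<noteq> {} \<and> stopping h (I n) S"
  let ?succ = "\<lambda>n h. list_entries_succeeds (m n) h (G1 n) (G2 n) (iblt h (G1 n) (G2 n) (ops n)) (valid_pairs (ops n))"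
  have IV: "I n \<union> V n = stored_keys (ops n)" for n
    using invalid_keys_subset[of "ops n"] by (auto simp: I_def V_def)
  have fin: "finite (V n)" "finite (I n)" for n
    using finite_stored_keys[of "ops n"] finite_subset[OF invalid_keys_subset[of "ops n"]] by (auto simp: V_def I_def)
  have k: "k \<ge> 4" using assms(3) by simp
  have "1 / \<beta> \<le> real (nat \<lceil>1 / \<beta>\<rceil>)" by (rule real_nat_ceiling_ge)
  \<comment> \<open>The summand 4 in \<open>k\<close> makes this strict.\<close>
  then have "1 / \<beta> < real k" unfolding assms(3) by simp
  then have k\<beta>: "real k * \<beta> > 1" using assms(1) by (simp add: field_simps)
  have "(\<lambda>n. measure_pmf.prob (random_hashing k (m n) (I n \<union> V n)) {h. ?stop n h}) \<longlonglongrightarrow> 0"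
  proof (rule prob_stopping_tendsto_0[OF assms(1) k\<beta> assms(2) k fin _ _ _ assms(8)])
    show "real (card (I n)) \<le> real n powr (1 - \<beta>) + 1" for n
      using assms(5)[of n] unfolding I_def by linarith
    show "card (I n \<union> V n) = n" for n by (simp only: IV assms(4))
  qed (auto simp: V_def)
  moreover have "measure_pmf.prob (random_hashing k (m n) (I n \<union> V n)) {h. ?stop n h}
      = measure_pmf.prob (?M n) {h. ?stop n h}" for n
  proof -
    let ?r = "\<lambda>(h :: 'k \<Rightarrow> nat list) x. if x \<in> I n \<union> V n then h x else []"
    \<comment> \<open>Hashes are drawn for every key that occurs in an operation, also for those
      that cancel. Restriction to the stored keys projects the product onto some of its coordinates,
      and stopping depends on these alone.\<close>
    have "random_hashing k (m n) (I n \<union> V n) = map_pmf ?r (?M n)"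
      unfolding random_hashing_def using stored_keys_subset[of "ops n"] by (intro Pi_pmf_subset) (auto simp: IV)
    moreover have "?r -` {h. ?stop n h} = {h. ?stop n h}"
    proof (rule set_eqI)
      fix h
      have "stopping (?r h) (I n) S \<longleftrightarrow> stopping h (I n) S" if "S \<subseteq> V n" for S
        using that by (intro stopping_cong) auto
      then show "h \<in> ?r -` {h. ?stop n h} \<longleftrightarrow> h \<in> {h. ?stop n h}"
        unfolding vimage_eq mem_Collect_eq by (intro ex_cong1 conj_cong refl)
    qed
    ultimately show ?thesis by (simp only: measure_map_pmf)
  qed
  ultimately have "(\<lambda>n. measure_pmf.prob (?M n) {h. ?stop n h}) \<longlonglongrightarrow> 0" by simp
  then have lower: "(\<lambda>n. 1 - measure_pmf.prob (?M n) {h. ?stop n h}) \<longlonglongrightarrow> 1"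
    using tendsto_diff[OF tendsto_const[of 1]] by fastforce
  \<comment> \<open>With fewer than k cells there are no edges, and a hash value need not be
    one.\<close>
  have large: "\<forall>\<^sub>F n in sequentially. k \<le> m n"
    using eventually_ge_at_top[of k]
  proof eventually_elim
    case (elim n)
    have "1 * real n \<le> (core_threshold k + \<epsilon>) * real n"
      using core_threshold_ge_1[of k] k assms(2) by (intro mult_right_mono) auto
    then show ?case using assms(8)[of n] elim by linarith
  qed
  show ?thesis
  proof (rule tendsto_sandwich[OF _ _ lower tendsto_const])
    show "\<forall>\<^sub>F n in sequentially. 1 - measure_pmf.prob (?M n) {h. ?stop n h} \<le> measure_pmf.prob (?M n) {h. ?succ n h}"
      using large
    proof eventually_elim
      case (elim n)
      have "measure_pmf.prob (?M n) {h. True} \<le> measure_pmf.prob (?M n) {h. ?succ n h} + measure_pmf.prob (?M n) {h. ?stop n h}"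
      proof (rule prob_disj_le, rule disjCI)
        fix h assume h: "h \<in> set_pmf (?M n)" and ns: "\<not> ?stop n h"
        show "?succ n h"
        proof (rule list_entries_succeeds_if_no_stopping)
          show "set (h x) \<subseteq> {..<m n}" if "x \<in> stored_keys (ops n)" for x
            using set_random_hashing[OF _ elim h, of x] stored_keys_subset[of "ops n"] that
            by (auto simp: edges_def)
          show "\<not> stopping h (invalid_keys (ops n)) S"
            if "S \<subseteq> stored_keys (ops n) - invalid_keys (ops n)" "S \<noteq> {}" for S
            using ns that unfolding V_def I_def by blast
        qed (fact assms(7), fact assms(6))
      qed
      then show ?case by simp
    qed
  qed simp
qed

end
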